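(* Let $x_1,\dots,x_n$ be a sequence of non-negative integers and let $m=\sum_{i=1}^n x_i$. On a word RAM with words of $\Omega(\lg n)$ bits, the sequence can be represented using at most $m+2n+o(m+n)$ bits such that, given $i$, one can determine in constant time whether $x_i=0$ and, if not, decrement $x_i$ in constant time.
   Formalization: The sum m is additionally assumed to be less than 2^(a·w), where w is the word length and a is an arbitrary constant, so that m and memory addresses fit in O(1) words; for unrestricted m the claim fails (e.g. n = 1, w = 1, m large). *)

theory Defs
  imports Complex_Main "HOL-Library.Landau_Symbols"
begin

text \<open>
  A word RAM. The word length w is a parameter of the semantics, not of the program, so that one
  program can be run for every word length. Words are natural numbers below 2^w. Programs are finite,
  hence use finitely many registers.

  A memory address is given by a list of registers, read as a number in base 2^w, least significant
  word first. A singleton list is ordinary indirect addressing. Longer lists are needed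
  because words of c * lg n bits with c < 1 cannot address n cells individually.
\<close>

datatype binop = Add | Sub | Mul | Div | Mod | And | Or | Xor | Shl | Shr | Less | Equal

datatype instr =
    Const nat nat
  | Binop binop nat nat nat
  | Load nat "nat list"
  | Store "nat list" nat
  | JumpZero nat nat

datatype state = State (pc: nat) (regs: "nat \<Rightarrow> nat") (mem: "nat \<Rightarrow> nat")

fun eval_binop :: "nat \<Rightarrow> binop \<Rightarrow> nat \<Rightarrow> nat \<Rightarrow> nat" where
  "eval_binop w Add x y = (x + y) mod 2 ^ w"
| "eval_binop w Sub x y = (x + 2 ^ w - y) mod 2 ^ w"
| "eval_binop w Mul x y = (x * y) mod 2 ^ w"
| "eval_binop w Div x y = x div y"
| "eval_binop w Mod x y = x mod y"
| "eval_binop w And x y = and x y"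
| "eval_binop w Or x y = or x y"
| "eval_binop w Xor x y = xor x y"
| "eval_binop w Shl x y = (x * 2 ^ y) mod 2 ^ w"
| "eval_binop w Shr x y = x div 2 ^ y"
| "eval_binop w Less x y = (if x < y then 1 else 0)"
| "eval_binop w Equal x y = (if x = y then 1 else 0)"

definition address :: "nat \<Rightarrow> (nat \<Rightarrow> nat) \<Rightarrow> nat list \<Rightarrow> nat" where
  "address w R as = horner_sum R (2 ^ w) as"

fun exec_instr :: "nat \<Rightarrow> instr \<Rightarrow> state \<Rightarrow> state" where
  "exec_instr w (Const d k) (State p R M) = State (Suc p) (R(d := k mod 2 ^ w)) M"
| "exec_instr w (Binop f d a b) (State p R M) =
     State (Suc p) (R(d := eval_binop w f (R a) (R b) mod 2 ^ w)) M"
| "exec_instr w (Load d as) (State p R M) = State (Suc p) (R(d := M (address w R as))) M"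
| "exec_instr w (Store as a) (State p R M) = State (Suc p) R (M(address w R as := R a))"
| "exec_instr w (JumpZero a l) (State p R M) = State (if R a = 0 then l else Suc p) R M"

definition halted :: "instr list \<Rightarrow> state \<Rightarrow> bool" where
  "halted P s \<longleftrightarrow> length P \<le> pc s"

definition step :: "nat \<Rightarrow> instr list \<Rightarrow> state \<Rightarrow> state" where
  "step w P s = (if halted P s then s else exec_instr w (P ! pc s) s)"

definition run :: "nat \<Rightarrow> instr list \<Rightarrow> nat \<Rightarrow> state \<Rightarrow> state" where
  "run w P t s = (step w P ^^ t) s"

text \<open>
  Halted states are fixed points of step, so halted P (run w P T s) says that P halts within T steps.
  The argument i is passed as its base-2^w digits: if i < 2^w, register 0 holds i and all other
  registers are 0.
\<close>

definition start :: "nat \<Rightarrow> nat \<Rightarrow> (nat \<Rightarrow> nat) \<Rightarrow> state" where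
  "start w i M = State 0 (\<lambda>j. (i div 2 ^ (w * j)) mod 2 ^ w) M"

definition is_memory :: "nat \<Rightarrow> (nat \<Rightarrow> nat) \<Rightarrow> bool" where
  "is_memory w M \<longleftrightarrow> (\<forall>a. M a < 2 ^ w)"

definition mem_bit :: "nat \<Rightarrow> (nat \<Rightarrow> nat) \<Rightarrow> nat \<Rightarrow> bool" where
  "mem_bit w M j = bit (M (j div w)) (j mod w)"

definition stored :: "nat \<Rightarrow> bool list \<Rightarrow> (nat \<Rightarrow> nat) \<Rightarrow> bool" where
  "stored w B M \<longleftrightarrow> (\<forall>j < length B. mem_bit w M j = B ! j)"

definition unchanged_beyond :: "nat \<Rightarrow> nat \<Rightarrow> (nat \<Rightarrow> nat) \<Rightarrow> (nat \<Rightarrow> nat) \<Rightarrow> bool" where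
  "unchanged_beyond w S M M' \<longleftrightarrow> (\<forall>j \<ge> S. mem_bit w M' j = mem_bit w M j)"

definition tests_zero ::
    "nat \<Rightarrow> instr list \<Rightarrow> nat \<Rightarrow> nat list \<Rightarrow> bool list \<Rightarrow> nat \<Rightarrow> bool" where
  "tests_zero w P T ys B i \<longleftrightarrow>
     (\<forall>M. is_memory w M \<and> stored w B M \<longrightarrow>
        (let s = run w P T (start w i M)
         in halted P s \<and> regs s 0 = (if ys ! i = 0 then 1 else 0) \<and> mem s = M))"

definition transforms ::
    "nat \<Rightarrow> instr list \<Rightarrow> nat \<Rightarrow> bool list \<Rightarrow> bool list set \<Rightarrow> nat \<Rightarrow> bool" where
  "transforms w P T B \<B> i \<longleftrightarrow>
     (\<forall>M. is_memory w M \<and> stored w B M \<longrightarrow>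
        (let s = run w P T (start w i M)
         in halted P s \<and> unchanged_beyond w (length B) M (mem s) \<and>
            (\<exists>B' \<in> \<B>. stored w B' (mem s))))"

text \<open>
  Rep ys is the set of bit strings representing the current sequence ys; only the sequence xs
  and those arising from it by decrements need to have representations. All of them occupy the same S
  bits of memory. The memory contents outside these bits are arbitrary before each operation, and
  registers do not survive it, so all information is in the S bits.
\<close>

definition decrement_structure ::
    "nat \<Rightarrow> instr list \<Rightarrow> instr list \<Rightarrow> nat \<Rightarrow> nat \<Rightarrow> nat list \<Rightarrow> bool" where
  "decrement_structure w zero_prog dec_prog T S xs \<longleftrightarrow>
     (\<exists>Rep :: nat list \<Rightarrow> bool list set.
        Rep xs \<noteq> {} \<and>
        (\<forall>ys. \<forall>B \<in> Rep ys. length B = S \<and>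
           (\<forall>i < length ys.
              tests_zero w zero_prog T ys B i \<and>
              (ys ! i \<noteq> 0 \<longrightarrow> transforms w dec_prog T B (Rep (ys[i := ys ! i - 1])) i))))"

end

theory Submission
  imports Defs "HOL-Real_Asymp.Real_Asymp"
begin

text \<open>
  A counter with initial value x and current value y is written as 0^y 1 0^(x - y) 1. These words
  of length x + 2 form a prefix code, even a complete one (the sum of (x + 1) / 2^(x + 2) over x is 1),
  and a decrement moves one bit without changing the length. This gives the m + 2 n bits.

  To find counter i, put N = m + n and let s be of the order of lg lg N. Groups of s^2 counters are
  encoded together, in binary with 6 s bits per counter when this is shorter than the code above.
  A group then has poly(lg lg N) bits, so one table of N^o(1) entries handles test and decrement.
  A superblock consists of 2^(3 s) counters and has one pointer of O(lg N) bits and a pointer of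
  4 s bits for each of its groups. The superblocks that contain a counter of at least 2^(6 s) are so
  rare that their counters can have O(lg N) bits each.

  Memory is divided into slots of Theta(lg N) bits, 2^e in each word, and nothing crosses the
  boundary of a slot. Hence addresses, which may need several words, are computed by shifts and
  additions only. Conditional updates are arithmetic, so the programs have no jumps. If w is
  below a constant, then so are n and m, and each counter gets words of its own.
\<close>

subsection \<open>Expressions and straight-line programs\<close>

text \<open>The sizes are tuned so that every loss is a fraction O(1/s) of the main term. A pointer
  of 4 s bits is shared by s^2 counters; a superblock of 2^(3 s) counters faces a record of 2^(s +
  O(1)) bits; a heavy superblock costs O(2^(4 s)) bits and is paid for by its single counter of at
  least 2^(6 s), even after multiplication by s. A group has T = O(s^3) bits at most, while a slot
  has at least 32 s^4, so that T bits can be given up in every slot, and a table indexed by windows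
  of T bits has O(sqrt N) bits.

  The obstacle is the word length. It is not known to the programs, may be smaller than lg N by a
  constant factor, and may exceed the size of the whole structure. Therefore the programs learn f, s
  and e from a header in word 0, and multi-word numbers are only divided by powers of 2. The bits of
  a word outside its slots are charged as one further bit per slot.\<close>

datatype expr = Var nat | Num nat | Op binop expr expr | Ld "expr list"

text \<open>
  Registers c, c + 1, ... serve as scratch space, so reading one of them as a variable yields 0 by
  convention.
\<close>

primrec ev :: "nat \<Rightarrow> nat \<Rightarrow> (nat \<Rightarrow> nat) \<Rightarrow> (nat \<Rightarrow> nat) \<Rightarrow> expr \<Rightarrow> nat" where
  "ev c w R M (Var r) = (if r < c then R r else 0)"
| "ev c w R M (Num k) = k mod 2 ^ w"
| "ev c w R M (Op f x y) = eval_binop w f (ev c w R M x) (ev c w R M y) mod 2 ^ w"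
| "ev c w R M (Ld es) = M (horner_sum id (2 ^ w) (map (ev c w R M) es))"

text \<open>Stack discipline: the value goes to register b, and only registers from b on are
  overwritten. There is no move instruction, so \<open>And b r r\<close> copies r to b.\<close>

fun compile :: "nat \<Rightarrow> nat \<Rightarrow> expr \<Rightarrow> instr list" and compiles :: "nat \<Rightarrow> nat \<Rightarrow> expr list \<Rightarrow> instr list" where
  "compile c b (Var r) = [if r < c then Binop And b r r else Const b 0]"
| "compile c b (Num k) = [Const b k]"
| "compile c b (Op f x y) = compile c b x @ compile c (Suc b) y @ [Binop f b b (Suc b)]"
| "compile c b (Ld es) = compiles c b es @ [Load b [b..<b + length es]]"
| "compiles c b [] = []"
| "compiles c b (e # es) = compile c b e @ compiles c (Suc b) es"

lemma horner_sum_eq_map: "horner_sum f x as = horner_sum id x (map f as)"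
  by (induction as) simp_all

lemma address_block:
  assumes "\<forall>j < length es. R (b + j) = g (es ! j)"
  shows "address w R [b..<b + length es] = horner_sum id (2 ^ w) (map g es)"
proof -
  have "map R [b..<b + length es] = map g es"
    using assms by (intro nth_equalityI) auto
  then show ?thesis
    unfolding address_def by (subst horner_sum_eq_map) simp
qed

text \<open>\<open>R0\<close> is the register file in which variables are read. The current file
  only has to agree with it below c, which persists because all writes go to registers b \<ge>
  c.\<close>

lemma compile_correct:
  fixes w c :: nat and R0 :: "nat \<Rightarrow> nat"
  assumes R0: "\<forall>r. R0 r < 2 ^ w"
  shows "c \<le> b \<Longrightarrow> \<forall>r<c. R r = R0 r \<Longrightarrow>
     \<exists>R'. fold (exec_instr w) (compile c b e) (State p R M) = State (p + length (compile c b e)) R' M \<and>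
          R' b = ev c w R0 M e \<and> (\<forall>r<b. R' r = R r)"
   and "c \<le> b \<Longrightarrow> \<forall>r<c. R r = R0 r \<Longrightarrow>
     \<exists>R'. fold (exec_instr w) (compiles c b es) (State p R M) = State (p + length (compiles c b es)) R' M \<and>
          (\<forall>j<length es. R' (b + j) = ev c w R0 M (es ! j)) \<and> (\<forall>r<b. R' r = R r)"
proof (induction c b e and c b es arbitrary: p R and p R rule: compile_compiles.induct)
  case (1 c b r)
  then show ?case using R0 by auto
next
  case (2 c b k)
  then show ?case by auto
next
  case (3 c b f x y)
  obtain R1 where 1: "fold (exec_instr w) (compile c b x) (State p R M) = State (p + length (compile c b x)) R1 M"
     "R1 b = ev c w R0 M x" "\<forall>r<b. R1 r = R r" using 3 by blast
  have "\<forall>r<c. R1 r = R0 r" using 1(3) 3 by auto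
  then obtain R2 where 2: "fold (exec_instr w) (compile c (Suc b) y) (State (p + length (compile c b x)) R1 M)
       = State (p + length (compile c b x) + length (compile c (Suc b) y)) R2 M"
     "R2 (Suc b) = ev c w R0 M y" "\<forall>r<Suc b. R2 r = R1 r" using 3(2)[of R1] 3(3) by (metis le_SucI)
  show ?case using 1 2 by (auto simp: add.assoc)
next
  case (4 c b es)
  obtain R1 where 1: "fold (exec_instr w) (compiles c b es) (State p R M) = State (p + length (compiles c b es)) R1 M"
     "\<forall>j<length es. R1 (b + j) = ev c w R0 M (es ! j)" "\<forall>r<b. R1 r = R r" using 4 by blast
  show ?case using 1 address_block[OF 1(2)] by auto
next
  case (5 c b)
  then show ?case by auto
next
  case (6 c b e es)
  obtain R1 where 1: "fold (exec_instr w) (compile c b e) (State p R M) = State (p + length (compile c b e)) R1 M"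
     "R1 b = ev c w R0 M e" "\<forall>r<b. R1 r = R r" using 6 by blast
  have "\<forall>r<c. R1 r = R0 r" using 1(3) 6 by auto
  then obtain R2 where 2: "fold (exec_instr w) (compiles c (Suc b) es) (State (p + length (compile c b e)) R1 M)
       = State (p + length (compile c b e) + length (compiles c (Suc b) es)) R2 M"
     "\<forall>j<length es. R2 (Suc b + j) = ev c w R0 M (es ! j)" "\<forall>r<Suc b. R2 r = R1 r"
    using 6(2)[of R1] 6(3) by (metis le_SucI)
  have "R2 (b + j) = ev c w R0 M ((e # es) ! j)" if "j < length (e # es)" for j
    using that 1 2 by (cases j) auto
  then show ?case using 1 2 by (auto simp: add.assoc)
qed

type_synonym assign = "expr list \<times> expr"

definition comp_store :: "nat \<Rightarrow> assign \<Rightarrow> instr list" where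
  "comp_store c a = compiles c c (fst a) @ compile c (c + length (fst a)) (snd a) @
     [Store [c..<c + length (fst a)] (c + length (fst a))]"

text \<open>In a sequence of assignments only the memory advances; each of them still reads the
  initial registers R.\<close>

definition do_store :: "nat \<Rightarrow> nat \<Rightarrow> (nat \<Rightarrow> nat) \<Rightarrow> assign \<Rightarrow> (nat \<Rightarrow> nat) \<Rightarrow> (nat \<Rightarrow> nat)" where
  "do_store c w R a M = M(horner_sum id (2 ^ w) (map (ev c w R M) (fst a)) := ev c w R M (snd a))"

definition comp_stores :: "nat \<Rightarrow> assign list \<Rightarrow> instr list" where
  "comp_stores c as = concat (map (comp_store c) as)"

definition comp_result :: "nat \<Rightarrow> expr \<Rightarrow> instr list" where
  "comp_result c e = compile c c e @ [Binop And 0 c c]"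

lemma comp_store_correct:
  assumes R0: "\<forall>r. R0 r < 2 ^ w" and "\<forall>r<c. R r = R0 r"
  shows "\<exists>R'. fold (exec_instr w) (comp_store c a) (State p R M) =
      State (p + length (comp_store c a)) R' (do_store c w R0 a M) \<and> (\<forall>r<c. R' r = R0 r)"
proof -
  obtain es v where a: "a = (es, v)" by fastforce
  obtain R1 where 1: "fold (exec_instr w) (compiles c c es) (State p R M) = State (p + length (compiles c c es)) R1 M"
     "\<forall>j<length es. R1 (c + j) = ev c w R0 M (es ! j)" "\<forall>r<c. R1 r = R r"
    using compile_correct(2)[OF R0 order_refl assms(2)] by blast
  have "c \<le> c + length es" "\<forall>r<c. R1 r = R0 r" using 1 assms by auto
  from compile_correct(1)[OF R0 this]
  obtain R2 where 2: "fold (exec_instr w) (compile c (c + length es) v) (State (p + length (compiles c c es)) R1 M)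
       = State (p + length (compiles c c es) + length (compile c (c + length es) v)) R2 M"
     "R2 (c + length es) = ev c w R0 M v" "\<forall>r<c + length es. R2 r = R1 r" by blast
  have "\<forall>j<length es. R2 (c + j) = ev c w R0 M (es ! j)" using 1 2 by auto
  from address_block[OF this] show ?thesis
    using 1 2 assms by (auto simp: comp_store_def do_store_def a add.assoc)
qed

lemma comp_stores_correct:
  assumes R0: "\<forall>r. R0 r < 2 ^ w" and "\<forall>r<c. R r = R0 r"
  shows "\<exists>R'. fold (exec_instr w) (comp_stores c as) (State p R M) =
      State (p + length (comp_stores c as)) R' (fold (do_store c w R0) as M) \<and> (\<forall>r<c. R' r = R0 r)"
  using assms(2)
proof (induction as arbitrary: p R M)
  case (Cons a as)
  obtain R1 where 1: "fold (exec_instr w) (comp_store c a) (State p R M) =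
      State (p + length (comp_store c a)) R1 (do_store c w R0 a M)" "\<forall>r<c. R1 r = R0 r"
    using comp_store_correct[OF R0 Cons.prems] by blast
  from Cons.IH[OF 1(2)] obtain R2 where
    "fold (exec_instr w) (comp_stores c as) (State (p + length (comp_store c a)) R1 (do_store c w R0 a M)) =
      State (p + length (comp_store c a) + length (comp_stores c as)) R2 (fold (do_store c w R0) as (do_store c w R0 a M))"
     "\<forall>r<c. R2 r = R0 r" by blast
  then show ?case using 1 by (auto simp: comp_stores_def add.assoc)
qed (auto simp: comp_stores_def)

section \<open>Running programs without jumps\<close>

fun jump_free :: "instr \<Rightarrow> bool" where
  "jump_free (JumpZero a l) = False"
| "jump_free _ = True"

lemma comp_jump_free:
  "\<forall>x \<in> set (compile c b e). jump_free x" "\<forall>x \<in> set (compiles c b es). jump_free x"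
  by (induction c b e and c b es rule: compile_compiles.induct) auto

text \<open>Without jumps the program counter counts the steps, so that running is folding over the
  instruction list.\<close>

lemma run_straight:
  assumes "\<forall>x \<in> set P. jump_free x"
  shows "t \<le> length P \<Longrightarrow> run w P t (State 0 R M) = fold (exec_instr w) (take t P) (State 0 R M) \<and>
     pc (run w P t (State 0 R M)) = t"
proof (induction t)
  case (Suc t)
  let ?s = "run w P t (State 0 R M)"
  have s: "pc ?s = t" "?s = fold (exec_instr w) (take t P) (State 0 R M)" using Suc by auto
  have r: "run w P (Suc t) (State 0 R M) = exec_instr w (P ! t) ?s"
    using Suc.prems s(1) by (simp add: run_def step_def halted_def)
  have "jump_free (P ! t)" using assms Suc.prems by auto
  then have "pc (exec_instr w (P ! t) ?s) = Suc t"
    using s(1) by (cases "P ! t"; cases ?s) auto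
  then show ?case using r s(2) Suc.prems by (simp add: take_Suc_conv_app_nth)
qed (simp add: run_def)

lemma run_halted: "halted P s \<Longrightarrow> run w P t s = s"
  by (induction t) (auto simp: run_def step_def)

lemma run_straight_full:
  assumes "\<forall>x \<in> set P. jump_free x" "length P \<le> T"
    and "fold (exec_instr w) P (State 0 R M) = State (length P) R' M'"
  shows "run w P T (State 0 R M) = State (length P) R' M'"
proof -
  have 1: "run w P (length P) (State 0 R M) = State (length P) R' M'"
    using run_straight[OF assms(1), of "length P" w R M] assms(3) by simp
  have "run w P T (State 0 R M) = run w P (T - length P) (run w P (length P) (State 0 R M))"
    using assms(2) by (simp add: run_def flip: funpow_add[unfolded o_def, THEN fun_cong])
  then show ?thesis unfolding 1 by (simp add: run_halted halted_def)
qed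

abbreviation digits :: "nat \<Rightarrow> nat \<Rightarrow> nat \<Rightarrow> nat" where
  "digits w i \<equiv> \<lambda>j. (i div 2 ^ (w * j)) mod 2 ^ w"

lemma run_comp_stores:
  assumes "length (comp_stores c as) \<le> T"
  shows "\<exists>R'. run w (comp_stores c as) T (start w i M) =
    State (length (comp_stores c as)) R' (fold (do_store c w (digits w i)) as M)"
proof -
  have R0: "\<forall>r. digits w i r < 2 ^ w" by simp
  obtain R' where "fold (exec_instr w) (comp_stores c as) (State 0 (digits w i) M) =
      State (length (comp_stores c as)) R' (fold (do_store c w (digits w i)) as M)"
    using comp_stores_correct[OF R0, of c "digits w i" as 0 M] by auto
  moreover have "\<forall>x \<in> set (comp_stores c as). jump_free x"
    using comp_jump_free by (fastforce simp: comp_stores_def comp_store_def)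
  ultimately show ?thesis
    using run_straight_full[OF _ assms] by (fastforce simp: start_def)
qed

lemma run_comp_result:
  assumes "length (comp_result c e) \<le> T" "is_memory w M"
  shows "\<exists>R'. run w (comp_result c e) T (start w i M) =
    State (length (comp_result c e)) R' M \<and> R' 0 = ev c w (digits w i) M e mod 2 ^ w"
proof -
  have R0: "\<forall>r. digits w i r < 2 ^ w" by simp
  obtain R' where "fold (exec_instr w) (compile c c e) (State 0 (digits w i) M) =
      State (length (compile c c e)) R' M" "R' c = ev c w (digits w i) M e"
    using compile_correct(1)[OF R0 order_refl, of c "digits w i" e 0 M] by auto
  then have "fold (exec_instr w) (comp_result c e) (State 0 (digits w i) M) =
      State (length (comp_result c e)) (R'(0 := ev c w (digits w i) M e mod 2 ^ w)) M"
    by (simp add: comp_result_def)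
  moreover have "\<forall>x \<in> set (comp_result c e). jump_free x"
    using comp_jump_free by (fastforce simp: comp_result_def)
  ultimately show ?thesis
    using run_straight_full[OF _ assms(1)] by (fastforce simp: start_def)
qed

subsection \<open>Bit fields and multi-word arithmetic\<close>

definition fld :: "nat \<Rightarrow> nat \<Rightarrow> nat \<Rightarrow> nat" where
  "fld X p t = X div 2 ^ p mod 2 ^ t"

definition fld_upd :: "nat \<Rightarrow> nat \<Rightarrow> nat \<Rightarrow> nat \<Rightarrow> nat" where
  "fld_upd X p t u = X - fld X p t * 2 ^ p + u * 2 ^ p"

lemma fld_less: "fld X p t < 2 ^ t"
  by (simp add: fld_def)

lemma bit_fld: "bit (fld X p t) b \<longleftrightarrow> b < t \<and> bit X (p + b)"
  unfolding fld_def by (simp add: bit_take_bit_iff bit_drop_bit_eq flip: take_bit_eq_mod drop_bit_eq_div)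

text \<open>The summands occupy disjoint bits, so the addition is a bitwise or.\<close>

lemma bit_add_high:
  fixes a b :: nat
  assumes "a < 2 ^ p"
  shows "bit (a + 2 ^ p * b) j \<longleftrightarrow> (if j < p then bit a j else bit b (j - p))"
proof -
  have h: "\<not> bit a j" if "p \<le> j" for j
    using assms that by (metis bit_take_bit_iff linorder_not_le take_bit_nat_eq_self)
  have "and a (push_bit p b) = 0"
    by (rule bit_eqI) (use h in \<open>auto simp: bit_and_iff bit_push_bit_iff\<close>)
  then have "a + 2 ^ p * b = or a (push_bit p b)"
    by (simp add: disjunctive_add_eq_or push_bit_eq_mult mult.commute)
  then show ?thesis using h[of j] by (auto simp: bit_or_iff bit_push_bit_iff)
qed

lemma fld_upd_split:
  "fld_upd X p t u = X mod 2 ^ p + 2 ^ p * (u + 2 ^ t * (X div 2 ^ (p + t)))"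
proof -
  have "X = X mod 2 ^ p + 2 ^ p * (X div 2 ^ p)" by simp
  also have "X div 2 ^ p = fld X p t + 2 ^ t * (X div 2 ^ (p + t))"
    by (simp add: fld_def power_add div_mult2_eq)
  finally have "X = X mod 2 ^ p + fld X p t * 2 ^ p + 2 ^ p * (2 ^ t * (X div 2 ^ (p + t)))"
    by (simp add: algebra_simps)
  then have "X - fld X p t * 2 ^ p = X mod 2 ^ p + 2 ^ p * (2 ^ t * (X div 2 ^ (p + t)))"
    by linarith
  then show ?thesis by (simp add: fld_upd_def algebra_simps)
qed

lemma fld_mult_le: "fld X p t * 2 ^ p \<le> X"
proof -
  have "fld X p t * 2 ^ p \<le> X div 2 ^ p * 2 ^ p" by (simp add: fld_def)
  then show ?thesis using div_times_less_eq_dividend le_trans by blast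
qed

text \<open>Reduces the later facts about field updates to comparisons of bit positions.\<close>

lemma bit_fld_upd:
  assumes "u < 2 ^ t"
  shows "bit (fld_upd X p t u) j \<longleftrightarrow> (if p \<le> j \<and> j < p + t then bit u (j - p) else bit X j)"
proof -
  have "bit (X mod 2 ^ p) j = bit X j" if "j < p"
    using that by (simp add: bit_take_bit_iff flip: take_bit_eq_mod)
  moreover have "bit (X div 2 ^ (p + t)) (j - p - t) = bit X j" if "p + t \<le> j"
    using that by (simp add: bit_drop_bit_eq flip: drop_bit_eq_div)
  ultimately show ?thesis
    unfolding fld_upd_split using assms by (auto simp: bit_add_high)
qed

lemma fld_fld_upd_same: "u < 2 ^ t \<Longrightarrow> fld (fld_upd X p t u) p t = u"
  by (rule bit_eqI) (auto simp: bit_fld bit_fld_upd dest: bit_imp_possible_bit,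
     metis bit_take_bit_iff take_bit_nat_eq_self)

lemma fld_fld_upd_disjoint:
  "u < 2 ^ t \<Longrightarrow> p + t \<le> p' \<or> p' + t' \<le> p \<Longrightarrow> fld (fld_upd X p t u) p' t' = fld X p' t'"
  by (rule bit_eqI) (auto simp: bit_fld bit_fld_upd)

lemma fld_fld: "p' + t' \<le> t \<Longrightarrow> fld (fld X p t) p' t' = fld X (p + p') t'"
  by (rule bit_eqI) (auto simp: bit_fld add.assoc)

lemma fld_upd_less:
  assumes "X < 2 ^ w" "p + t \<le> w" "u < 2 ^ t"
  shows "fld_upd X p t u < 2 ^ w"
proof -
  have "take_bit w (fld_upd X p t u) = fld_upd X p t u"
  proof (rule bit_eqI)
    fix n
    have "\<not> bit X n" if "w \<le> n"
      using assms(1) that by (metis bit_take_bit_iff linorder_not_le take_bit_nat_eq_self)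
    then show "bit (take_bit w (fld_upd X p t u)) n = bit (fld_upd X p t u) n"
      using assms by (cases "w \<le> n") (auto simp: bit_take_bit_iff bit_fld_upd)
  qed
  then show ?thesis by (metis take_bit_nat_less_exp)
qed

text \<open>Serves to pass from a change of a code word in its window to a change of the slot, and
  from there to a change of the memory word.\<close>

lemma fld_fld_upd_nested:
  assumes "p' + t' \<le> t" "u < 2 ^ t'"
  shows "fld_upd X (p + p') t' u = fld_upd X p t (fld_upd (fld X p t) p' t' u)"
  using assms fld_upd_less[OF fld_less assms, of X p]
  by (intro bit_eqI) (auto simp: bit_fld_upd bit_fld)

text \<open>Locates the lowest set bit of a word, which delimits the header.\<close>

lemma xor_pred:
  fixes y :: nat
  shows "xor (2 ^ p * (2 * y + 1)) (2 ^ p * (2 * y + 1) - 1) = 2 ^ (p + 1) - 1"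
proof (induction p)
  case 0
  show ?case by (simp add: xor_nat_rec[of "Suc (2 * y)"])
next
  case (Suc p)
  define x where "x = (2::nat) ^ p * (2 * y + 1)"
  have x: "x \<ge> 1" unfolding x_def by (simp add: Suc_le_eq del: mult_Suc_right)
  have "xor (2 * x) (2 * x - 1) = 2 * xor x (x - 1) + 1"
  proof -
    have "(2 * x - 1) div 2 = x - 1" by presburger
    then show ?thesis using x by (subst xor_nat_rec) auto
  qed
  moreover have "xor x (x - 1) = 2 ^ (p + 1) - 1" using Suc by (simp only: x_def)
  moreover have "2 * ((2::nat) ^ (p + 1) - 1) + 1 = 2 ^ (Suc p + 1) - 1"
  proof -
    have "2 * (2 * q - 1) + 1 = 2 * (2 * q) - 1" if "1 \<le> q" for q :: nat using that by linarith
    from this[of "2 ^ p"] show ?thesis by simp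
  qed
  ultimately show ?case by (simp only: power_Suc mult.assoc x_def)
qed

section \<open>Values of expressions when nothing overflows\<close>

definition good :: "nat \<Rightarrow> (nat \<Rightarrow> nat) \<Rightarrow> (nat \<Rightarrow> nat) \<Rightarrow> bool" where
  "good w R M \<longleftrightarrow> w \<ge> 1 \<and> (\<forall>r. R r < 2 ^ w) \<and> (\<forall>a. M a < 2 ^ w)"

lemma good_pow: "good w R M \<Longrightarrow> 1 < (2::nat) ^ w"
  unfolding good_def using one_less_power[of "2::nat" w] by simp

lemma good_one: "good w R M \<Longrightarrow> 1 mod (2::nat) ^ w = 1"
  using good_pow by (rule mod_less)

lemma ev_less: "good w R M \<Longrightarrow> ev c w R M e < 2 ^ w"
  by (induction e) (auto simp: good_def)

lemma ev_num: "k < 2 ^ w \<Longrightarrow> ev c w R M (Num k) = k"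
  by simp

lemma ev_add: "ev c w R M a + ev c w R M b < 2 ^ w \<Longrightarrow> ev c w R M (Op Add a b) = ev c w R M a + ev c w R M b"
  by simp

lemma ev_mul: "ev c w R M a * ev c w R M b < 2 ^ w \<Longrightarrow> ev c w R M (Op Mul a b) = ev c w R M a * ev c w R M b"
  by simp

lemma ev_sub:
  assumes "good w R M" "ev c w R M b \<le> ev c w R M a"
  shows "ev c w R M (Op Sub a b) = ev c w R M a - ev c w R M b"
proof -
  have "ev c w R M a + 2 ^ w - ev c w R M b = (ev c w R M a - ev c w R M b) + 2 ^ w" using assms by simp
  moreover have "ev c w R M a - ev c w R M b < 2 ^ w"
    by (rule le_less_trans[OF diff_le_self ev_less[OF assms(1)]])
  ultimately have "(ev c w R M a + 2 ^ w - ev c w R M b) mod 2 ^ w = ev c w R M a - ev c w R M b"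
    by (simp only: mod_add_self2 mod_less)
  then show ?thesis unfolding ev.simps eval_binop.simps mod_mod_trivial .
qed

lemma ev_div:
  assumes "good w R M" shows "ev c w R M (Op Div a b) = ev c w R M a div ev c w R M b"
proof -
  have "ev c w R M a div ev c w R M b < 2 ^ w"
    by (rule le_less_trans[OF div_le_dividend ev_less[OF assms]])
  then show ?thesis by simp
qed

lemma ev_mod:
  assumes "good w R M" shows "ev c w R M (Op Mod a b) = ev c w R M a mod ev c w R M b"
proof -
  have "ev c w R M a mod ev c w R M b < 2 ^ w"
    by (rule le_less_trans[OF mod_less_eq_dividend ev_less[OF assms]])
  then show ?thesis by simp
qed

lemma ev_eq: "good w R M \<Longrightarrow> ev c w R M (Op Equal a b) = (if ev c w R M a = ev c w R M b then 1 else 0)"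
  by (auto simp: good_def)

lemma ev_shl: "ev c w R M a * 2 ^ ev c w R M b < 2 ^ w \<Longrightarrow>
    ev c w R M (Op Shl a b) = ev c w R M a * 2 ^ ev c w R M b"
  by simp

lemma ev_pow2: "good w R M \<Longrightarrow> ev c w R M b < w \<Longrightarrow> ev c w R M (Op Shl (Num 1) b) = 2 ^ ev c w R M b"
  by (subst ev_shl) (auto simp: good_def)

text \<open>For t = w the modulus overflows to 0, and reduction modulo 0 is the identity.\<close>

lemma ev_mod_pow2:
  assumes "good w R M" "ev c w R M t \<le> w"
  shows "ev c w R M (Op Mod a (Op Shl (Num 1) t)) = ev c w R M a mod 2 ^ ev c w R M t"
proof (cases "ev c w R M t = w")
  case True
  have "1 mod (2::nat) ^ w = 1" by (rule good_one[OF assms(1)])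
  then show ?thesis using True ev_mod[OF assms(1)] ev_less[OF assms(1)] by simp
next
  case False
  then have "ev c w R M t < w" using assms(2) by simp
  then show ?thesis by (simp only: ev_mod[OF assms(1)] ev_pow2[OF assms(1)])
qed

definition Ite :: "expr \<Rightarrow> expr \<Rightarrow> expr \<Rightarrow> expr" where
  "Ite b x y = Op Add (Op Mul b x) (Op Mul (Op Sub (Num 1) b) y)"

text \<open>The discarded branch is evaluated as well, possibly to a meaningless word, and is then
  multiplied by 0.\<close>

lemma ev_Ite:
  assumes "good w R M" "ev c w R M b = (if P then 1 else 0)"
  shows "ev c w R M (Ite b x y) = (if P then ev c w R M x else ev c w R M y)"
proof -
  have "ev c w R M (Op Sub (Num 1) b) = 1 - ev c w R M b"
    using assms(2) ev_num[OF good_pow[OF assms(1)], of c R M] by (subst ev_sub[OF assms(1)]) (simp_all del: ev.simps)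
  moreover have "ev c w R M (Ite b x y) =
      ((ev c w R M b * ev c w R M x) mod 2 ^ w + (ev c w R M (Op Sub (Num 1) b) * ev c w R M y) mod 2 ^ w) mod 2 ^ w"
    unfolding Ite_def ev.simps(3)[of _ _ _ _ Add] ev.simps(3)[of _ _ _ _ Mul] by simp
  ultimately show ?thesis using assms(2) ev_less[OF assms(1)] by (cases P) (simp_all del: ev.simps)
qed

definition Conj :: "expr \<Rightarrow> expr \<Rightarrow> expr" where "Conj = Op Mul"

lemma ev_Conj:
  assumes "good w R M" "ev c w R M a = (if P then 1 else 0)" "ev c w R M b = (if Q then 1 else 0)"
  shows "ev c w R M (Conj a b) = (if P \<and> Q then 1 else 0)"
  using assms good_pow[OF assms(1)] unfolding Conj_def by simp

definition fld_exp :: "expr \<Rightarrow> expr \<Rightarrow> expr \<Rightarrow> expr" where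
  "fld_exp X p t = Op Mod (Op Div X (Op Shl (Num 1) p)) (Op Shl (Num 1) t)"

text \<open>The power 2^p must be a word to divide by, hence p < w; a field of t = w bits is covered
  by \<open>ev_mod_pow2\<close>.\<close>

lemma ev_fld_exp:
  assumes "good w R M" "ev c w R M p < w" "ev c w R M t \<le> w"
  shows "ev c w R M (fld_exp X p t) = fld (ev c w R M X) (ev c w R M p) (ev c w R M t)"
  unfolding fld_exp_def fld_def
  by (simp only: ev_mod_pow2[OF assms(1,3)] ev_div[OF assms(1)] ev_pow2[OF assms(1,2)])

definition upd_exp :: "expr \<Rightarrow> expr \<Rightarrow> expr \<Rightarrow> expr \<Rightarrow> expr" where
  "upd_exp X p x y = Op Add (Op Sub X (Op Mul x (Op Shl (Num 1) p))) (Op Mul y (Op Shl (Num 1) p))"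

lemma ev_upd_exp:
  assumes g: "good w R M" and p: "ev c w R M p < w" and x: "ev c w R M x = fld (ev c w R M X) (ev c w R M p) t"
    and y: "ev c w R M y < 2 ^ t" and t: "ev c w R M p + t \<le> w"
  shows "ev c w R M (upd_exp X p x y) = fld_upd (ev c w R M X) (ev c w R M p) t (ev c w R M y)"
proof -
  let ?X = "ev c w R M X" and ?p = "ev c w R M p"
  have 1: "ev c w R M (Op Mul x (Op Shl (Num 1) p)) = fld ?X ?p t * 2 ^ ?p"
    using fld_mult_le[of ?X ?p t] ev_less[OF g, of c X]
    by (subst ev_mul) (simp_all only: ev_pow2[OF g p] x)
  have "fld_upd ?X ?p t (ev c w R M y) < 2 ^ w"
    by (rule fld_upd_less[OF ev_less[OF g] t y])
  then have 4: "?X - fld ?X ?p t * 2 ^ ?p + ev c w R M y * 2 ^ ?p < 2 ^ w" by (simp only: fld_upd_def)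
  then have 2: "ev c w R M (Op Mul y (Op Shl (Num 1) p)) = ev c w R M y * 2 ^ ?p"
    by (subst ev_mul) (simp_all only: ev_pow2[OF g p])
  have 3: "ev c w R M (Op Sub X (Op Mul x (Op Shl (Num 1) p))) = ?X - fld ?X ?p t * 2 ^ ?p"
    using fld_mult_le by (subst ev_sub[OF g]) (simp_all only: 1)
  show ?thesis unfolding upd_exp_def fld_upd_def
    using 4 by (subst ev_add) (simp_all only: 2 3)
qed

section \<open>Numbers that span several words\<close>

definition val :: "nat \<Rightarrow> nat \<Rightarrow> (nat \<Rightarrow> nat) \<Rightarrow> (nat \<Rightarrow> nat) \<Rightarrow> expr list \<Rightarrow> nat" where
  "val c w R M es = horner_sum id (2 ^ w) (map (ev c w R M) es)"

lemma val_simps [simp]: "val c w R M [] = 0" "val c w R M (e # es) = ev c w R M e + 2 ^ w * val c w R M es"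
  by (simp_all add: val_def)

lemma ev_Ld: "ev c w R M (Ld es) = M (val c w R M es)"
  by (simp add: val_def)

lemma val_mod:
  assumes "good w R M" "es \<noteq> []" "e \<le> w"
  shows "val c w R M es mod 2 ^ e = ev c w R M (hd es) mod 2 ^ e"
proof -
  obtain d ds where es: "es = d # ds" using assms by (cases es) auto
  have "(2::nat) ^ w = 2 ^ e * 2 ^ (w - e)" using assms(3) by (simp flip: power_add)
  then show ?thesis by (simp add: es mult.assoc)
qed

text \<open>
  The power 2^(w - e) for E = 2^e, obtained without knowing w. For e = 0 it overflows to 0, but is
  then only multiplied by 0.
\<close>

definition co_pow :: "expr \<Rightarrow> expr" where
  "co_pow E = Op Add (Op Div (Op Sub (Num 0) E) E) (Num 1)"

text \<open>A right shift: the e low bits of the next word enter at the top of the current one, by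
  multiplication with 2^(w - e).\<close>

fun shr :: "expr \<Rightarrow> expr list \<Rightarrow> expr list" where
  "shr E [] = []"
| "shr E [d] = [Op Div d E]"
| "shr E (d # d' # ds) = Op Add (Op Div d E) (Op Mul (Op Mod d' E) (co_pow E)) # shr E (d' # ds)"

lemma ev_co_pow:
  assumes g: "good w R M" and E: "ev c w R M E = 2 ^ e" and "e < w"
  shows "ev c w R M (co_pow E) = 2 ^ (w - e) mod 2 ^ w"
proof -
  have w: "(2::nat) ^ w = 2 ^ e * 2 ^ (w - e)" using assms(3) by (simp flip: power_add)
  have "ev c w R M (Op Sub (Num 0) E) = 2 ^ w - 2 ^ e"
    using E by simp
  then have "ev c w R M (Op Div (Op Sub (Num 0) E) E) = (2 ^ w - 2 ^ e) div 2 ^ e"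
    by (simp only: ev_div[OF g] E)
  also have "(2::nat) ^ w - 2 ^ e = 2 ^ e * (2 ^ (w - e) - 1)" by (simp add: w right_diff_distrib')
  finally have "ev c w R M (Op Div (Op Sub (Num 0) E) E) = 2 ^ (w - e) - 1" by simp
  moreover have "1 mod (2::nat) ^ w = 1" by (rule good_one[OF g])
  ultimately show ?thesis unfolding co_pow_def by simp
qed

text \<open>In base n = p q, the remainder of the higher part modulo p enters the lowest digit at
  place q. The second claim says that this digit stays below n, so the word operations do not
  overflow.\<close>

lemma div_two_digits:
  fixes x Y n p q :: nat
  assumes n: "n = p * q" and x: "x < n"
  shows "(x + n * Y) div p = x div p + Y mod p * q + n * (Y div p)"
    and "x div p + Y mod p * q < n"
proof -
  have p: "p > 0" using assms by (cases p) auto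
  have "(x + n * Y) div p = x div p + q * Y" using p by (simp add: n mult.assoc)
  also have "q * Y = q * (Y mod p + p * (Y div p))" by simp
  also have "\<dots> = Y mod p * q + n * (Y div p)" unfolding n by (simp only: distrib_left ac_simps)
  finally show "(x + n * Y) div p = x div p + Y mod p * q + n * (Y div p)" by simp
  have "x div p < q" using x n by (simp add: less_mult_imp_div_less mult.commute)
  moreover have "(Y mod p + 1) * q \<le> n" unfolding n using p by (intro mult_right_mono) (auto simp: Suc_leI)
  ultimately show "x div p + Y mod p * q < n" by simp
qed

lemma length_shr [simp]: "length (shr E es) = length es"
  by (induction E es rule: shr.induct) auto

lemma val_shr:
  assumes g: "good w R M" and E: "ev c w R M E = 2 ^ e" and e: "e < w"
  shows "val c w R M (shr E es) = val c w R M es div 2 ^ e"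
  using E
proof (induction E es rule: shr.induct)
  case (2 E d)
  then show ?case by (simp only: shr.simps val_simps ev_div[OF g] mult_0_right add_0_right)
next
  case (3 E d d' ds)
  let ?v = "ev c w R M"
  define Y where "Y = val c w R M (d' # ds)"
  have Y: "Y mod 2 ^ e = ?v d' mod 2 ^ e"
    using val_mod[OF g, of "d' # ds" e] e by (simp only: Y_def list.sel) simp
  have w: "(2::nat) ^ w = 2 ^ e * 2 ^ (w - e)" using e by (simp flip: power_add)
  note sp = div_two_digits[OF w ev_less[OF g, of c d], of Y]
  have "?v (Op Mul (Op Mod d' E) (co_pow E)) = Y mod 2 ^ e * 2 ^ (w - e)"
  proof -
    have "?v (Op Mul (Op Mod d' E) (co_pow E)) = ?v (Op Mod d' E) * ?v (co_pow E) mod 2 ^ w" by simp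
    also have "\<dots> = Y mod 2 ^ e * (2 ^ (w - e) mod 2 ^ w) mod 2 ^ w"
      by (simp only: ev_mod[OF g] "3.prems" Y ev_co_pow[OF g "3.prems" e])
    also have "\<dots> = Y mod 2 ^ e * 2 ^ (w - e) mod 2 ^ w" by (rule mod_mult_right_eq)
    also have "\<dots> = Y mod 2 ^ e * 2 ^ (w - e)" using sp(2) by (intro mod_less) linarith
    finally show ?thesis .
  qed
  moreover have "?v (Op Div d E) = ?v d div 2 ^ e" by (simp only: ev_div[OF g] "3.prems")
  ultimately have 1: "?v (Op Add (Op Div d E) (Op Mul (Op Mod d' E) (co_pow E))) = ?v d div 2 ^ e + Y mod 2 ^ e * 2 ^ (w - e)"
    using sp(2) by (subst ev_add) (simp_all only:)
  have "val c w R M (shr E (d # d' # ds)) =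
      ?v d div 2 ^ e + Y mod 2 ^ e * 2 ^ (w - e) + 2 ^ w * (Y div 2 ^ e)"
    using "3.IH"[OF "3.prems"] by (simp only: shr.simps val_simps(2)[of _ _ _ _ "Op Add _ _"] 1 Y_def)
  then show ?case using sp(1) by (simp only: val_simps(2)[of _ _ _ _ d] Y_def)
qed simp

text \<open>The wrapped sum of two words is less than \<open>r\<close> exactly if the addition
  overflows, so \<open>Less\<close> yields the carry for the next word.\<close>

fun addl :: "expr list \<Rightarrow> expr \<Rightarrow> expr list" where
  "addl [] r = []"
| "addl (d # ds) r = Op Add d r # addl ds (Op Less (Op Add d r) r)"

lemma addl_Nil [simp]: "addl es r = [] \<longleftrightarrow> es = []"
  by (cases es) auto

lemma add_mod_carry:
  fixes x r n :: nat
  assumes "x < n" "r < n"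
  shows "(x + r) mod n + n * (if (x + r) mod n < r then 1 else 0) = x + r"
proof (cases "x + r < n")
  case False
  then have "(x + r) mod n = (x + r - n) mod n" by (simp add: le_mod_geq)
  also have "\<dots> = x + r - n" using assms by (intro mod_less) linarith
  finally have "(x + r) mod n = x + r - n" .
  then show ?thesis using assms False by (auto; linarith)
qed auto

text \<open>\<open>k\<close> stands for what is carried out of the top word; keeping it makes the
  induction go through.\<close>

lemma val_addl:
  assumes g: "good w R M"
  shows "\<exists>k. val c w R M (addl es r) + k * 2 ^ (w * length es) = val c w R M es + ev c w R M r"
proof (induction es r rule: addl.induct)
  case (2 d ds r)
  let ?v = "ev c w R M"
  have lt: "?v d < 2 ^ w" "?v r < 2 ^ w" using ev_less[OF g] by auto
  have one: "1 mod (2::nat) ^ w = 1" by (rule good_one[OF g])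
  have c: "?v (Op Add d r) + 2 ^ w * ?v (Op Less (Op Add d r) r) = ?v d + ?v r"
  proof -
    have "?v (Op Less (Op Add d r) r) = (if (?v d + ?v r) mod 2 ^ w < ?v r then 1 else 0)"
      using one by simp
    moreover have "?v (Op Add d r) = (?v d + ?v r) mod 2 ^ w" by simp
    ultimately show ?thesis using add_mod_carry[OF lt] by (simp only:)
  qed
  obtain k where k: "val c w R M (addl ds (Op Less (Op Add d r) r)) + k * 2 ^ (w * length ds) =
      val c w R M ds + ?v (Op Less (Op Add d r) r)" using 2 by blast
  have "A + 2 ^ w * C + k * (2 ^ w * L) = Y + 2 ^ w * V + X"
    if "A + 2 ^ w * D = X + Y" "C + k * L = V + D" for A C L Y V X D :: nat
  proof -
    have "A + 2 ^ w * C + k * (2 ^ w * L) = A + 2 ^ w * (C + k * L)" by (simp add: distrib_left mult.left_commute)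
    also have "\<dots> = (A + 2 ^ w * D) + 2 ^ w * V" unfolding that(2) by (simp add: distrib_left)
    finally show ?thesis unfolding that(1) by simp
  qed
  from this[OF c k] show ?case
    by (intro exI[of _ k]) (simp only: addl.simps val_simps list.size power_add mult_Suc_right add.assoc add_0_right add_Suc_right One_nat_def add.commute[of "?v r"])
qed auto

lemma val_addl_exact:
  assumes "good w R M" "val c w R M es + ev c w R M r < 2 ^ (w * length es)"
  shows "val c w R M (addl es r) = val c w R M es + ev c w R M r"
proof -
  obtain k where k: "val c w R M (addl es r) + k * 2 ^ (w * length es) = val c w R M es + ev c w R M r"
    using val_addl[OF assms(1)] by blast
  have "k = 0" using k assms(2) by (cases k) auto
  then show ?thesis using k by simp
qed

section \<open>Slots within words\<close>

definition slot :: "nat \<Rightarrow> nat \<Rightarrow> (nat \<Rightarrow> nat) \<Rightarrow> nat \<Rightarrow> nat" where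
  "slot e f M z = fld (M (z div 2 ^ e)) (z mod 2 ^ e * f) f"

text \<open>The lowest word of the slot number determines the position in the word, as 2^e divides
  2^w.\<close>

definition slot_off :: "expr \<Rightarrow> expr \<Rightarrow> expr list \<Rightarrow> expr" where
  "slot_off E F z = Op Mul (Op Mod (hd z) E) F"

definition slot_rd :: "expr \<Rightarrow> expr \<Rightarrow> expr list \<Rightarrow> expr" where
  "slot_rd E F z = fld_exp (Ld (shr E z)) (slot_off E F z) F"

definition slot_wr :: "expr \<Rightarrow> expr \<Rightarrow> expr list \<Rightarrow> expr \<Rightarrow> expr" where
  "slot_wr E F z y = upd_exp (Ld (shr E z)) (slot_off E F z) (slot_rd E F z) y"

lemma slot_bound:
  fixes z e f w :: nat
  assumes "2 ^ e * f \<le> w"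
  shows "z mod 2 ^ e * f + f \<le> w"
proof -
  have "(z mod 2 ^ e + 1) * f \<le> 2 ^ e * f"
    by (intro mult_right_mono) (auto simp: Suc_leI)
  then show ?thesis using assms by simp
qed

lemma ev_slot:
  assumes g: "good w R M" and E: "ev c w R M E = 2 ^ e" and F: "ev c w R M F = f"
    and f: "2 ^ e * f \<le> w" "f \<ge> 1" and z: "z \<noteq> []" "val c w R M z = Z"
  shows "ev c w R M (slot_off E F z) = Z mod 2 ^ e * f"
    and "ev c w R M (slot_rd E F z) = slot e f M Z"
    and "ev c w R M y < 2 ^ f \<Longrightarrow>
      ev c w R M (slot_wr E F z y) = fld_upd (M (Z div 2 ^ e)) (Z mod 2 ^ e * f) f (ev c w R M y)"
proof -
  have b: "Z mod 2 ^ e * f + f \<le> w" by (rule slot_bound[OF f(1)])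
  have e: "e < w"
  proof -
    have "e < 2 ^ e" by simp
    also have "\<dots> \<le> 2 ^ e * f" using f(2) by simp
    finally show ?thesis using f(1) by simp
  qed
  have w: "w < 2 ^ w" by simp
  have m: "ev c w R M (Op Mod (hd z) E) = Z mod 2 ^ e"
    using val_mod[OF g z(1) less_imp_le[OF e], of c] by (simp only: ev_mod[OF g] E z(2))
  then show o: "ev c w R M (slot_off E F z) = Z mod 2 ^ e * f"
  proof -
    have "Z mod 2 ^ e * f < 2 ^ w" using b w by linarith
    then show ?thesis unfolding slot_off_def using m F by (subst ev_mul) (simp_all only:)
  qed
  have L: "ev c w R M (Ld (shr E z)) = M (Z div 2 ^ e)"
    using val_shr[OF g E e] z(2) by (simp only: ev_Ld)
  have ob: "ev c w R M (slot_off E F z) < w" using b f(2) o by linarith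
  show rd: "ev c w R M (slot_rd E F z) = slot e f M Z"
    unfolding slot_rd_def slot_def using ev_fld_exp[OF g ob, of F] b by (simp only: o L F)
  show "ev c w R M (slot_wr E F z y) = fld_upd (M (Z div 2 ^ e)) (Z mod 2 ^ e * f) f (ev c w R M y)"
    if "ev c w R M y < 2 ^ f"
    unfolding slot_wr_def using ev_upd_exp[OF g ob _ that, of "slot_rd E F z" "Ld (shr E z)"] b
    by (simp only: rd L o slot_def)
qed

subsection \<open>Codes for groups of counters\<close>

abbreviation num :: "bool list \<Rightarrow> nat" where
  "num \<equiv> horner_sum of_bool 2"

lemma num_less: "num cs < 2 ^ length cs"
proof -
  have "take_bit (length cs) (num cs) = num cs"
    by (rule bit_eqI) (auto simp: bit_take_bit_iff bit_horner_sum_bit_iff)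
  then show ?thesis by (metis take_bit_nat_less_exp)
qed

lemma fld_eq_num_iff: "fld X p (length cs) = num cs \<longleftrightarrow> cs = map (\<lambda>b. bit X (p + b)) [0..<length cs]"
proof
  assume h: "fld X p (length cs) = num cs"
  have "cs ! b = bit X (p + b)" if "b < length cs" for b
    using arg_cong[OF h, of "\<lambda>n. bit n b"] that by (auto simp: bit_fld bit_horner_sum_bit_iff)
  then show "cs = map (\<lambda>b. bit X (p + b)) [0..<length cs]" by (intro nth_equalityI) auto
next
  assume h: "cs = map (\<lambda>b. bit X (p + b)) [0..<length cs]"
  have "cs ! b = bit X (p + b)" if "b < length cs" for b
    using arg_cong[OF h, of "\<lambda>l. l ! b"] that by simp
  then show "fld X p (length cs) = num cs"
    by (intro bit_eqI) (auto simp: bit_fld bit_horner_sum_bit_iff)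
qed

text \<open>\<open>z\<close> counts the decrements so far. As it is left open, a decrement turns a
  code word into a code word of the same length, and the initial value is not recorded.\<close>

inductive unary_code :: "nat list \<Rightarrow> bool list \<Rightarrow> bool" where
  unary_Nil: "unary_code [] []"
| unary_Cons: "unary_code ys cs \<Longrightarrow>
    unary_code (y # ys) (replicate y False @ True # replicate z False @ True # cs)"

inductive binary_code :: "nat \<Rightarrow> nat list \<Rightarrow> bool list \<Rightarrow> bool" for l where
  binary_Nil: "binary_code l [] []"
| binary_Cons: "binary_code l ys cs \<Longrightarrow> y < 2 ^ l \<Longrightarrow>
    binary_code l (y # ys) (map (bit y) [0..<l] @ cs)"

definition group_code :: "nat \<Rightarrow> nat list \<Rightarrow> bool list \<Rightarrow> bool" where
  "group_code l ys cw \<longleftrightarrow>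
     (\<exists>cs. cw = False # cs \<and> unary_code ys cs) \<or> (\<exists>cs. cw = True # cs \<and> binary_code l ys cs)"

text \<open>The first argument of the minimum leads to the m + 2 n bits; the second one keeps a
  group within the window that indexes the table, however large its counters are.\<close>

definition group_len :: "nat \<Rightarrow> nat list \<Rightarrow> nat" where
  "group_len l xs = 1 + min (\<Sum>x\<leftarrow>xs. x + 2) (length xs * l)"

lemma group_code_exists:
  assumes "\<forall>x \<in> set xs. x < 2 ^ l"
  shows "\<exists>cw. group_code l xs cw \<and> length cw = group_len l xs"
proof -
  have "\<exists>cs. unary_code xs cs \<and> length cs = (\<Sum>x\<leftarrow>xs. x + 2)"
  proof (induction xs)
    case (Cons x xs)
    then obtain cs where "unary_code xs cs" "length cs = (\<Sum>x\<leftarrow>xs. x + 2)" by blast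
    then show ?case using unary_Cons[of xs cs x 0] by fastforce
  qed (auto intro: unary_Nil)
  moreover have "\<exists>cs. binary_code l xs cs \<and> length cs = length xs * l"
    using assms
  proof (induction xs)
    case (Cons x xs)
    then obtain cs where "binary_code l xs cs" "length cs = length xs * l" by auto
    then show ?case using binary_Cons[of l xs cs x] Cons.prems by fastforce
  qed (auto intro: binary_Nil)
  ultimately obtain cs ds where c: "unary_code xs cs" "length cs = (\<Sum>x\<leftarrow>xs. x + 2)"
    "binary_code l xs ds" "length ds = length xs * l" by blast
  show ?thesis
  proof (cases "(\<Sum>x\<leftarrow>xs. x + 2) \<le> length xs * l")
    case True
    then have "group_code l xs (False # cs) \<and> length (False # cs) = group_len l xs"
      using c by (simp add: group_code_def group_len_def)
    then show ?thesis by blast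
  next
    case False
    then have "group_code l xs (True # ds) \<and> length (True # ds) = group_len l xs"
      using c by (simp add: group_code_def group_len_def)
    then show ?thesis by blast
  qed
qed

lemma unary_code_step:
  "unary_code ys cs \<Longrightarrow> j < length ys \<Longrightarrow> ys ! j \<noteq> 0 \<Longrightarrow>
    \<exists>cs'. unary_code (ys[j := ys ! j - 1]) cs' \<and> length cs' = length cs"
proof (induction arbitrary: j rule: unary_code.induct)
  case (unary_Cons ys cs y z)
  show ?case
  proof (cases j)
    case 0
    then show ?thesis using unary_code.unary_Cons[OF unary_Cons.hyps, of "y - 1" "Suc z"] unary_Cons.prems
      by (intro exI conjI) auto
  next
    case (Suc k)
    then obtain cs' where "unary_code (ys[k := ys ! k - 1]) cs'" "length cs' = length cs"
      using unary_Cons.IH[of k] unary_Cons.prems by auto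
    then show ?thesis using unary_code.unary_Cons[of _ cs' y z] Suc by (intro exI conjI) auto
  qed
qed simp

lemma binary_code_step:
  "binary_code l ys cs \<Longrightarrow> j < length ys \<Longrightarrow> ys ! j \<noteq> 0 \<Longrightarrow>
    \<exists>cs'. binary_code l (ys[j := ys ! j - 1]) cs' \<and> length cs' = length cs"
proof (induction arbitrary: j rule: binary_code.induct)
  case (binary_Cons ys cs y)
  show ?case
  proof (cases j)
    case 0
    have "y - 1 < 2 ^ l" using binary_Cons.hyps(2) by simp
    from binary_code.binary_Cons[OF binary_Cons.hyps(1) this] 0 show ?thesis
      by (intro exI[of _ "map (bit (y - 1)) [0..<l] @ cs"]) simp
  next
    case (Suc k)
    then obtain cs' where "binary_code l (ys[k := ys ! k - 1]) cs'" "length cs' = length cs"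
      using binary_Cons.IH[of k] binary_Cons.prems by auto
    then show ?thesis using binary_code.binary_Cons[of l _ cs' y] Suc binary_Cons.hyps
      by (intro exI conjI) auto
  qed
qed simp

lemma group_code_step:
  assumes "group_code l ys cw" "j < length ys" "ys ! j \<noteq> 0"
  shows "\<exists>cw'. group_code l (ys[j := ys ! j - 1]) cw' \<and> length cw' = length cw"
proof -
  from assms(1) consider cs where "cw = False # cs" "unary_code ys cs" | cs where "cw = True # cs" "binary_code l ys cs"
    unfolding group_code_def by blast
  then show ?thesis
  proof cases
    case 1
    with unary_code_step[OF _ assms(2,3)] obtain cs' where
      "unary_code (ys[j := ys ! j - 1]) cs'" "length cs' = length cs" by blast
    then show ?thesis using 1 unfolding group_code_def by (intro exI[of _ "False # cs'"]) simp
  next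
    case 2
    with binary_code_step[OF _ assms(2,3)] obtain cs' where
      "binary_code l (ys[j := ys ! j - 1]) cs'" "length cs' = length cs" by blast
    then show ?thesis using 2 unfolding group_code_def by (intro exI[of _ "True # cs'"]) simp
  qed
qed

section \<open>Unique decoding\<close>

lemma replicate_prefix_unique:
  "replicate y False @ True # u = replicate y' False @ True # u' \<Longrightarrow> y = y' \<and> u = u'"
proof (induction y arbitrary: y')
  case 0 then show ?case by (cases y') auto
next
  case (Suc y) then show ?case by (cases y') auto
qed

text \<open>Only sequences of the same length are compared, since the code of a sequence is a prefix
  of codes of longer ones. The suffixes \<open>r\<close> and \<open>r'\<close> allow for induction
  along the concatenation.\<close>

lemma unary_code_prefix_free:
  "unary_code ys cs \<Longrightarrow> unary_code ys' cs' \<Longrightarrow> length ys = length ys' \<Longrightarrow> cs @ r = cs' @ r' \<Longrightarrow>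
     ys = ys' \<and> cs = cs'"
proof (induction arbitrary: ys' cs' rule: unary_code.induct)
  case unary_Nil
  then show ?case by (auto elim: unary_code.cases)
next
  case (unary_Cons ys cs y z)
  from unary_Cons.prems(1,2) obtain y' zs' z' ds' where
    e: "ys' = y' # zs'" "cs' = replicate y' False @ True # replicate z' False @ True # ds'" "unary_code zs' ds'"
    by (cases rule: unary_code.cases) auto
  have 1: "y = y'" "replicate z False @ True # (cs @ r) = replicate z' False @ True # (ds' @ r')"
  proof -
    have "replicate y False @ True # (replicate z False @ True # cs @ r) =
        replicate y' False @ True # (replicate z' False @ True # ds' @ r')"
      using unary_Cons.prems(3) unfolding e(2) by simp
    from replicate_prefix_unique[OF this]
    show "y = y'" "replicate z False @ True # (cs @ r) = replicate z' False @ True # (ds' @ r')" by simp_all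
  qed
  have "z = z'" "cs @ r = ds' @ r'" using replicate_prefix_unique[OF 1(2)] by auto
  with unary_Cons.IH[OF e(3)] unary_Cons.prems(2) e 1 show ?case by auto
qed

lemma bits_inject:
  assumes "map (bit (y :: nat)) [0..<l] = map (bit y') [0..<l]" "y < 2 ^ l" "y' < 2 ^ l"
  shows "y = y'"
proof -
  have "bit y b = bit y' b" if "b < l" for b
    using arg_cong[OF assms(1), of "\<lambda>xs. xs ! b"] that by simp
  then have "take_bit l y = take_bit l y'" by (intro bit_eqI) (auto simp: bit_take_bit_iff)
  then show ?thesis using assms(2,3) by (simp add: take_bit_nat_eq_self)
qed

lemma binary_code_prefix_free:
  "binary_code l ys cs \<Longrightarrow> binary_code l ys' cs' \<Longrightarrow> length ys = length ys' \<Longrightarrow> cs @ r = cs' @ r' \<Longrightarrow>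
     ys = ys' \<and> cs = cs'"
proof (induction arbitrary: ys' cs' rule: binary_code.induct)
  case binary_Nil
  then show ?case by (auto elim: binary_code.cases)
next
  case (binary_Cons ys cs y)
  from binary_Cons.prems(1,2) obtain y' zs' ds' where
    e: "ys' = y' # zs'" "cs' = map (bit y') [0..<l] @ ds'" "binary_code l zs' ds'" "y' < 2 ^ l"
    by (cases rule: binary_code.cases) auto
  have 1: "map (bit y) [0..<l] = map (bit y') [0..<l]" "cs @ r = ds' @ r'"
    using binary_Cons.prems(3) by (auto simp: e(2))
  have "y = y'" using bits_inject[OF 1(1) binary_Cons.hyps(2) e(4)] .
  with binary_Cons.IH[OF e(3) _ 1(2)] binary_Cons.prems(2) e show ?case by auto
qed

lemma group_code_prefix_free:
  assumes "group_code l ys cw" "group_code l ys' cw'" "length ys = length ys'" "cw @ r = cw' @ r'"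
  shows "ys = ys' \<and> cw = cw'"
proof -
  from assms(1) consider cs where "cw = False # cs" "unary_code ys cs" | cs where "cw = True # cs" "binary_code l ys cs"
    unfolding group_code_def by blast
  then show ?thesis
  proof cases
    case 1
    then obtain cs' where "cw' = False # cs'" "unary_code ys' cs'"
      using assms(2,4) unfolding group_code_def by auto
    then show ?thesis using 1 assms(3,4) unary_code_prefix_free[of ys cs ys' cs' r r'] by simp
  next
    case 2
    then obtain cs' where "cw' = True # cs'" "binary_code l ys' cs'"
      using assms(2,4) unfolding group_code_def by auto
    then show ?thesis using 2 assms(3,4) binary_code_prefix_free[of l ys cs ys' cs' r r'] by simp
  qed
qed

text \<open>Both code words are prefixes of the same bits of \<open>W\<close>, so they can be
  extended to equal lists and prefix-freeness applies.\<close>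

lemma group_code_unique:
  assumes "group_code l ys cw" "group_code l ys' cw'" "length ys = length ys'"
    "fld W p (length cw) = num cw" "fld W p (length cw') = num cw'"
  shows "ys = ys' \<and> cw = cw'"
proof -
  define N where "N = max (length cw) (length cw')"
  have pre: "map (\<lambda>b. bit W (p + b)) [0..<N] = map (\<lambda>b. bit W (p + b)) [0..<k] @ map (\<lambda>b. bit W (p + b)) [k..<N]"
    if "k \<le> N" for k using that by (metis le_add_diff_inverse map_append upt_add_eq_append zero_le)
  have "cw @ map (\<lambda>b. bit W (p + b)) [length cw..<N] = cw' @ map (\<lambda>b. bit W (p + b)) [length cw'..<N]"
    using pre[of "length cw"] pre[of "length cw'"] assms(4,5) unfolding fld_eq_num_iff
    by (metis N_def max.cobounded1 max.cobounded2)
  then show ?thesis using group_code_prefix_free[OF assms(1-3)] by blast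
qed

text \<open>Any code word of length t serves, even one that distributes the second runs of zeros
  differently among the counters of the group: only the decoded values and the total length
  matter.\<close>

definition next_code :: "nat \<Rightarrow> nat list \<Rightarrow> nat \<Rightarrow> nat \<Rightarrow> bool list" where
  "next_code l ys j t = (SOME cw. group_code l (ys[j := ys ! j - 1]) cw \<and> length cw = t)"

definition decodes :: "nat \<Rightarrow> nat \<Rightarrow> nat \<Rightarrow> nat \<Rightarrow> bool list \<times> nat list \<Rightarrow> bool" where
  "decodes l h T W p \<longleftrightarrow> (case p of (cw, ys) \<Rightarrow>
     group_code l ys cw \<and> length ys = h \<and> length cw \<le> T \<and> fld W 0 (length cw) = num cw)"

text \<open>
  W is a window of T bits: a code word followed by unrelated bits, which the entry preserves. The
  value 2^T, which is not a window, means that counter j is 0.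
\<close>

definition table :: "nat \<Rightarrow> nat \<Rightarrow> nat \<Rightarrow> nat \<Rightarrow> nat \<Rightarrow> nat" where
  "table l h T W j = (if \<exists>p. decodes l h T W p
     then let (cw, ys) = (SOME p. decodes l h T W p)
       in if ys ! j \<noteq> 0 \<and> j < h then fld_upd W 0 (length cw) (num (next_code l ys j (length cw))) else 2 ^ T
     else 0)"

lemma decodes_unique: "decodes l h T W p \<Longrightarrow> decodes l h T W q \<Longrightarrow> p = q"
  unfolding decodes_def by (auto split: prod.splits dest: group_code_unique)

lemma next_code:
  assumes "group_code l ys cw" "j < length ys" "ys ! j \<noteq> 0"
  shows "group_code l (ys[j := ys ! j - 1]) (next_code l ys j (length cw))"
    "length (next_code l ys j (length cw)) = length cw"
  using someI_ex[OF group_code_step[OF assms]] unfolding next_code_def by auto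

lemma table_eq:
  assumes "decodes l h T W (cw, ys)" "j < h"
  shows "table l h T W j =
    (if ys ! j \<noteq> 0 then fld_upd W 0 (length cw) (num (next_code l ys j (length cw))) else 2 ^ T)"
proof -
  have "(SOME p. decodes l h T W p) = (cw, ys)"
    using decodes_unique[OF someI[of "decodes l h T W", OF assms(1)] assms(1)] .
  then show ?thesis using assms unfolding table_def by auto
qed

lemma table_le:
  assumes "W < 2 ^ T"
  shows "table l h T W j \<le> 2 ^ T"
proof (cases "\<exists>p. decodes l h T W p")
  case True
  then obtain cw ys where p: "decodes l h T W (cw, ys)" by auto
  have s: "(SOME p. decodes l h T W p) = (cw, ys)"
    using decodes_unique[OF someI[of "decodes l h T W", OF p] p] .
  have "fld_upd W 0 (length cw) (num (next_code l ys j (length cw))) < 2 ^ T" if "ys ! j \<noteq> 0" "j < h"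
    using p that next_code[of l ys cw j] num_less[of "next_code l ys j (length cw)"]
    by (intro fld_upd_less assms) (auto simp: decodes_def)
  then show ?thesis using True unfolding table_def s by (auto simp: less_imp_le)
qed (auto simp: table_def)

text \<open>A successor window is never mistaken for the mark 2^T of a zero counter, and it fits
  where the old window was.\<close>

lemma table_step_less:
  assumes "W < 2 ^ T" "decodes l h T W (cw, ys)" "j < h" "ys ! j \<noteq> 0"
  shows "table l h T W j < 2 ^ T"
  unfolding table_eq[OF assms(2,3)] using assms next_code[of l ys cw j] num_less[of "next_code l ys j (length cw)"]
  by (auto intro!: fld_upd_less simp: decodes_def)

text \<open>Decrement in positional notation: a digit changes iff a borrow passes through all lower
  ones. The summand b turns the borrow from a digit 0 into b - 1 without truncated
  subtraction.\<close>

definition dec_digit :: "nat \<Rightarrow> (nat \<Rightarrow> nat) \<Rightarrow> nat \<Rightarrow> nat" where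
  "dec_digit b \<delta> t = (if \<forall>u<t. \<delta> u = 0 then (\<delta> t + b - 1) mod b else \<delta> t)"

text \<open>The number 0 wraps around to b^D - 1. The induction needs this case: it is the borrow
  that the lower D digits pass on to digit D.\<close>

lemma sum_dec_digit:
  assumes "\<forall>t<D. \<delta> t < b"
  shows "(\<Sum>t<D. dec_digit b \<delta> t * b ^ t) + 1 = (\<Sum>t<D. \<delta> t * b ^ t) + (if \<forall>t<D. \<delta> t = 0 then b ^ D else 0)"
  using assms
proof (induction D)
  case (Suc D)
  show ?case
  proof (cases "\<forall>t<D. \<delta> t = 0")
    case True
    have b: "\<delta> D < b" using Suc.prems by simp
    have f1: "dec_digit b \<delta> D = (if \<delta> D = 0 then b - 1 else \<delta> D - 1)"
    proof (cases "\<delta> D = 0")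
      case False
      then have "(\<delta> D + b - 1) mod b = (\<delta> D - 1 + b) mod b" by simp
      also have "\<dots> = \<delta> D - 1" using b by (simp only: mod_add_self2) simp
      finally show ?thesis using True False by (simp add: dec_digit_def)
    qed (use b True in \<open>simp add: dec_digit_def\<close>)
    have f2: "(\<Sum>t<D. dec_digit b \<delta> t * b ^ t) + 1 = b ^ D"
    proof -
      have "\<forall>t<D. \<delta> t < b" using Suc.prems by simp
      from Suc.IH[OF this] True show ?thesis by simp
    qed
    have f3: "(b - 1) * b ^ D + b ^ D = b ^ Suc D" using b by (cases b) auto
    have f4: "(\<delta> D - 1) * b ^ D + b ^ D = \<delta> D * b ^ D" if "\<delta> D \<noteq> 0" using that by (cases "\<delta> D") auto
    have f5: "(\<forall>t<Suc D. \<delta> t = 0) \<longleftrightarrow> \<delta> D = 0" using True by (auto simp: less_Suc_eq)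
    have f6: "(\<Sum>t<D. \<delta> t * b ^ t) = 0" using True by (intro sum.neutral) simp
    have "A + e * P + 1 = Z + d * P + (if Q then P' else 0)"
      if "e = (if d = 0 then b - 1 else d - 1)" "A + 1 = P" "(b - 1) * P + P = P'"
        "d \<noteq> 0 \<Longrightarrow> (d - 1) * P + P = d * P" "Q \<longleftrightarrow> d = 0" "Z = 0" for A e P Z d Q P'
      using that by (cases "d = 0") auto
    from this[OF f1 f2 f3 f4 f5 f6] show ?thesis unfolding sum.lessThan_Suc .
  next
    case False
    then have 1: "\<not> (\<forall>t<Suc D. \<delta> t = 0)" using less_SucI by blast
    have 2: "dec_digit b \<delta> D = \<delta> D" using False by (simp only: dec_digit_def if_False)
    have 3: "\<forall>t<D. \<delta> t < b" using Suc.prems by simp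
    show ?thesis using Suc.IH[OF 3] unfolding sum.lessThan_Suc 2 if_not_P[OF False] if_not_P[OF 1] by simp
  qed
qed simp

lemma dec_digit_less: "\<delta> t < b \<Longrightarrow> dec_digit b \<delta> t < b"
  unfolding dec_digit_def by (cases "\<forall>u<t. \<delta> u = 0") simp_all

lemma sum_dec_digit_pos:
  fixes \<delta> :: "nat \<Rightarrow> nat"
  assumes "\<forall>t<D. \<delta> t < b" "(\<Sum>t<D. \<delta> t * b ^ t) \<noteq> 0"
  shows "(\<Sum>t<D. dec_digit b \<delta> t * b ^ t) = (\<Sum>t<D. \<delta> t * b ^ t) - 1"
proof -
  have "\<not> (\<forall>t<D. \<delta> t = 0)"
  proof
    assume "\<forall>t<D. \<delta> t = 0"
    then have "(\<Sum>t<D. \<delta> t * b ^ t) = 0" by (intro sum.neutral) simp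
    then show False using assms(2) by contradiction
  qed
  then show ?thesis using sum_dec_digit[OF assms(1)] by (simp only: if_False)
qed

lemma sum_digits_zero_iff:
  fixes \<delta> :: "nat \<Rightarrow> nat"
  assumes "b > 0"
  shows "(\<Sum>t<D. \<delta> t * b ^ t) = 0 \<longleftrightarrow> (\<forall>t<D. \<delta> t = 0)"
  using assms by auto

lemma sum_digits:
  fixes x b :: nat
  assumes "x < b ^ D"
  shows "(\<Sum>t<D. (x div b ^ t mod b) * b ^ t) = x"
  using assms
proof (induction D arbitrary: x)
  case (Suc D)
  have b: "b > 0" using Suc.prems by (cases b) auto
  have "x div b < b ^ D" using Suc.prems b by (simp add: less_mult_imp_div_less mult.commute)
  note ih = Suc.IH[OF this]
  have "(\<Sum>t<D. (x div b ^ Suc t mod b) * b ^ Suc t) = (\<Sum>t<D. b * ((x div b div b ^ t mod b) * b ^ t))"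
    by (simp add: div_mult2_eq mult.left_commute)
  also have "\<dots> = b * (x div b)" unfolding sum_distrib_left[symmetric] ih ..
  finally show ?case by (subst sum.lessThan_Suc_shift) simp
qed simp

subsection \<open>Memory layout\<close>

text \<open>Disjoint fields can be filled one after another. This yields the initial memory both for
  the slots and for the cells used with short words.\<close>

lemma exists_fields:
  fixes a p t u :: "'i \<Rightarrow> nat"
  assumes "finite I" "\<forall>x\<in>I. p x + t x \<le> w \<and> u x < 2 ^ t x"
    and "\<forall>x\<in>I. \<forall>y\<in>I. x \<noteq> y \<longrightarrow> a x \<noteq> a y \<or> p x + t x \<le> p y \<or> p y + t y \<le> p x"
  shows "\<exists>M. (\<forall>b. M b < 2 ^ w) \<and> (\<forall>x\<in>I. fld (M (a x)) (p x) (t x) = u x)"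
  using assms
proof (induction I rule: finite_induct)
  case empty
  show ?case by (intro exI[of _ "\<lambda>_. 0"]) simp
next
  case (insert x I)
  then obtain M where M: "\<forall>b. M b < 2 ^ w" "\<forall>x\<in>I. fld (M (a x)) (p x) (t x) = u x" by auto
  let ?M = "M(a x := fld_upd (M (a x)) (p x) (t x) (u x))"
  have x: "p x + t x \<le> w" "u x < 2 ^ t x" using insert.prems by auto
  have "fld_upd (M (a x)) (p x) (t x) (u x) < 2 ^ w" by (rule fld_upd_less) (use M x in auto)
  then have "\<forall>b. ?M b < 2 ^ w" using M by simp
  moreover have "fld (?M (a y)) (p y) (t y) = u y" if "y \<in> insert x I" for y
  proof (cases "y = x")
    case True
    then show ?thesis using fld_fld_upd_same[OF x(2)] by simp
  next
    case False
    then have y: "y \<in> I" using that by simp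
    have "a x \<noteq> a y \<or> p x + t x \<le> p y \<or> p y + t y \<le> p x" using insert.prems y False by auto
    then show ?thesis using M y fld_fld_upd_disjoint[OF x(2), of "p x" "p y" "t y" "M (a x)"]
      by (cases "a y = a x") auto
  qed
  ultimately show ?case by blast
qed

lemma mod_less_div_ge:
  fixes x y c t :: nat
  assumes "x div c = y div c" "x + t \<le> y"
  shows "x mod c + t \<le> y mod c"
  using assms by (metis add.assoc add_le_cancel_left div_mult_mod_eq)

lemma mult_add_less:
  fixes a A b n :: nat
  assumes "a < A" "b < n"
  shows "a * n + b < A * n"
proof -
  have "a * n + b < (a + 1) * n" using assms(2) by simp
  also have "\<dots> \<le> A * n" using assms(1) by (intro mult_right_mono) auto
  finally show ?thesis .
qed

lemma mult_add_inject:
  fixes a a' b b' n :: nat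
  assumes "a * n + b = a' * n + b'" "b < n" "b' < n"
  shows "a = a' \<and> b = b'"
proof -
  have "(b + a * n) div n = a" "(b' + a' * n) div n = a'" using assms by auto
  then have "a = a'" using assms(1) by (simp add: add.commute)
  then show ?thesis using assms(1) by simp
qed

text \<open>A name for each field of the structure, so that disjointness, updates and dependence on
  the first \<open>S\<close> bits are proved once for all kinds of fields.\<close>

datatype item = Hdr | Tbl nat nat | Flag nat | Dig nat nat | Ptr nat nat | Ctr nat nat nat | Grp nat nat

text \<open>The default 0 pads the sequence with zero counters, so that the last superblock is
  complete.\<close>

definition get :: "nat list \<Rightarrow> nat \<Rightarrow> nat" where
  "get ys i = (if i < length ys then ys ! i else 0)"

text \<open>
  Each record in the first R slots consists of 2^d slots, of which slot 0 is used in record 0 only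
  (for the header), slot 1 holds a table entry, slot 2 tells whether superblock k is heavy, and the
  others hold the base-2^w digits of the number Zs k of its first slot. There an item of a light
  superblock is found by the pointer vpos k g: group g starts at bit (vpos k g mod cap) of slot
  (vpos k g div cap). Since cap = f - T, a window that starts there does not leave the slot.
\<close>

locale structure_layout =
  fixes w e f s K D d :: nat and xs :: "nat list"
begin

definition "h = s * s"
definition B :: nat where "B = 2 ^ (3 * s)"
definition "NG = B div h"
definition "T = 6 * s * h + 1"
definition "cap = f - T"
definition "E3 = f div (4 * s)"
definition "grp ys \<gamma> = map (\<lambda>j. get ys (\<gamma> * h + j)) [0..<h]"
definition "heavy k \<longleftrightarrow> (\<exists>j<B. 2 ^ (6 * s) \<le> get xs (k * B + j))"
definition "glen \<gamma> = group_len (6 * s) (grp xs \<gamma>)"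
definition "np = NG div E3 + 1"
definition "vpos k g = np * cap + (\<Sum>i<g. glen (k * NG + i))"
definition "len k = (if heavy k then B * D else vpos k NG div cap + 1)"
definition "nsb = length xs div B + 1"
text \<open>Record r serves both table entry r and superblock r. Both kinds of addresses thus start
  from 0, and no base address has to be stored. The sum is a convenient bound for the maximum of the
  two numbers.\<close>

definition "recs = nsb + 2 ^ T * h"
definition "R = recs * 2 ^ d"
definition "Zs k = R + (\<Sum>i<k. len i)"
definition "Zmax = Zs nsb"
text \<open>A complete word counts with all its w bits, including those outside the slots. The last
  one counts only up to its last slot, which is essential if a word is longer than the
  structure.\<close>

definition "S = Zmax div 2 ^ e * w + Zmax mod 2 ^ e * f"

lemma h_le: "h \<le> 2 ^ (2 * s)"
proof -
  have "s * s \<le> 2 ^ s * 2 ^ s" by (intro mult_mono) (auto intro: less_imp_le)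
  then show ?thesis by (simp add: h_def mult_2 power_add)
qed

lemma glen_le: "glen \<gamma> \<le> T"
  by (simp add: glen_def group_len_def T_def grp_def mult.commute[of h] min.coboundedI2)

primrec islot :: "item \<Rightarrow> nat" where
  "islot Hdr = 0"
| "islot (Tbl W j) = (W * h + j) * 2 ^ d + 1"
| "islot (Flag k) = k * 2 ^ d + 2"
| "islot (Dig k t) = k * 2 ^ d + (3 + t)"
| "islot (Ptr k g) = Zs k + g div E3"
| "islot (Ctr k j t) = Zs k + (j * D + t)"
| "islot (Grp k g) = Zs k + vpos k g div cap"

primrec ioff :: "item \<Rightarrow> nat" where
  "ioff Hdr = 0"
| "ioff (Tbl W j) = 0"
| "ioff (Flag k) = 0"
| "ioff (Dig k t) = 0"
| "ioff (Ptr k g) = g mod E3 * (4 * s)"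
| "ioff (Ctr k j t) = 0"
| "ioff (Grp k g) = vpos k g mod cap"

primrec iwid :: "item \<Rightarrow> nat" where
  "iwid Hdr = f"
| "iwid (Tbl W j) = f"
| "iwid (Flag k) = f"
| "iwid (Dig k t) = f"
| "iwid (Ptr k g) = 4 * s"
| "iwid (Ctr k j t) = f"
| "iwid (Grp k g) = glen (k * NG + g)"

primrec valid :: "item \<Rightarrow> bool" where
  "valid Hdr = True"
| "valid (Tbl W j) = (W < 2 ^ T \<and> j < h)"
| "valid (Flag k) = (k < nsb)"
| "valid (Dig k t) = (k < nsb \<and> t < K)"
| "valid (Ptr k g) = (k < nsb \<and> \<not> heavy k \<and> g < NG)"
| "valid (Ctr k j t) = (k < nsb \<and> heavy k \<and> j < B \<and> t < D)"
| "valid (Grp k g) = (k < nsb \<and> \<not> heavy k \<and> g < NG)"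

primrec static :: "item \<Rightarrow> bool" where
  "static Hdr = True"
| "static (Tbl W j) = True"
| "static (Flag k) = True"
| "static (Dig k t) = True"
| "static (Ptr k g) = True"
| "static (Ctr k j t) = False"
| "static (Grp k g) = False"

text \<open>
  The lowest 1 of the header is at position 2 s - 1, so that the width 2 s of the fields for f, s
  and e can be determined when nothing is known yet.
\<close>

primrec sval :: "item \<Rightarrow> nat" where
  "sval Hdr = 2 ^ (2 * s - 1) + 2 ^ (2 * s) * (f + 2 ^ (2 * s) * (s + 2 ^ (2 * s) * e))"
| "sval (Tbl W j) = table (6 * s) h T W j"
| "sval (Flag k) = (if heavy k then 1 else 0)"
| "sval (Dig k t) = Zs k div 2 ^ (w * t) mod 2 ^ w"
| "sval (Ptr k g) = vpos k g"
| "sval (Ctr k j t) = 0"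
| "sval (Grp k g) = 0"

definition content :: "(nat \<Rightarrow> nat) \<Rightarrow> item \<Rightarrow> nat" where
  "content M x = fld (slot e f M (islot x)) (ioff x) (iwid x)"

definition iword :: "item \<Rightarrow> nat" where "iword x = islot x div 2 ^ e"
definition ipos :: "item \<Rightarrow> nat" where "ipos x = islot x mod 2 ^ e * f + ioff x"

definition put :: "item \<Rightarrow> nat \<Rightarrow> (nat \<Rightarrow> nat) \<Rightarrow> (nat \<Rightarrow> nat)" where
  "put x u M = M(iword x := fld_upd (M (iword x)) (ipos x) (iwid x) u)"

definition fixed :: "(nat \<Rightarrow> nat) \<Rightarrow> bool" where
  "fixed M \<longleftrightarrow> (\<forall>x. valid x \<and> static x \<longrightarrow> content M x = sval x)"

definition ctr :: "(nat \<Rightarrow> nat) \<Rightarrow> nat \<Rightarrow> nat \<Rightarrow> nat" where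
  "ctr M k j = (\<Sum>t<D. content M (Ctr k j t) * (2 ^ f) ^ t)"

definition coded :: "nat list \<Rightarrow> (nat \<Rightarrow> nat) \<Rightarrow> nat \<Rightarrow> nat \<Rightarrow> bool" where
  "coded ys M k g \<longleftrightarrow> (\<exists>cw. group_code (6 * s) (grp ys (k * NG + g)) cw \<and>
     length cw = glen (k * NG + g) \<and> content M (Grp k g) = num cw)"

definition represents :: "nat list \<Rightarrow> (nat \<Rightarrow> nat) \<Rightarrow> bool" where
  "represents ys M \<longleftrightarrow> length ys = length xs \<and> fixed M \<and>
     (\<forall>k<nsb. heavy k \<longrightarrow> (\<forall>j<B. ctr M k j = get ys (k * B + j))) \<and>
     (\<forall>k<nsb. \<not> heavy k \<longrightarrow> (\<forall>g<NG. coded ys M k g))"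

end

text \<open>What the correctness of the programs requires of the parameters, independently of how
  they are chosen and of how large \<open>S\<close> becomes.\<close>

locale valid_layout = structure_layout +
  assumes h_dvd: "s * s dvd 2 ^ (3 * s)"
    and T_less: "T < f"
    and hdr_fits: "8 * s \<le> f"
    and f_less: "f < 2 ^ (2 * s)"
    and e_less: "e < 2 ^ (2 * s)"
    and slots_fit: "2 ^ e * f \<le> w"
    and slot_wide: "Zmax < 2 ^ f \<or> f = w"
    and Zmax_le: "Zmax < 2 ^ (w * K)"
    and K_pos: "1 \<le> K"
    and n_le: "length xs \<le> 2 ^ (w * K)"
    and d_le: "d \<le> 3 * s"
    and d_ge: "K + 3 \<le> 2 ^ d"
    and tab_idx: "T + 2 * s + d \<le> w"
    and ctr_idx: "B * D < 2 ^ w"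
    and vpos_less: "\<And>k g. k < nsb \<Longrightarrow> \<not> heavy k \<Longrightarrow> g \<le> NG \<Longrightarrow> vpos k g < 2 ^ (4 * s)"
    and ctr_fits: "sum_list xs < 2 ^ (f * D)"
begin

lemma s_pos: "1 \<le> s"
  using h_dvd by (cases s) auto

lemma h_pos: "1 \<le> h" using s_pos by (simp add: h_def)

lemma B_eq: "NG * h = B"
  using h_dvd by (simp add: NG_def h_def B_def)

lemma cap_pos: "1 \<le> cap"
  using T_less by (simp add: cap_def)

lemma E3_pos: "1 \<le> E3"
  using s_pos hdr_fits by (simp add: E3_def div_greater_zero_iff Suc_leI)

lemma f_pos: "1 \<le> f" using hdr_fits s_pos by simp

lemma e_less_w: "e < w"
proof -
  have "e < 2 ^ e" by simp
  also have "\<dots> \<le> 2 ^ e * f" using f_pos by simp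
  finally show ?thesis using slots_fit by simp
qed

lemma f_le_w: "f \<le> w"
proof -
  have "1 * f \<le> 2 ^ e * f" by (intro mult_right_mono) auto
  also note slots_fit
  finally show ?thesis by simp
qed

lemma length_grp [simp]: "length (grp ys \<gamma>) = h" by (simp add: grp_def)

lemma Zs_Suc: "Zs (Suc k) = Zs k + len k"
  by (simp add: Zs_def)

lemma Zs_mono: "k \<le> k' \<Longrightarrow> Zs k \<le> Zs k'"
  by (simp add: Zs_def sum_mono2)

lemma Zs_step: "k < k' \<Longrightarrow> Zs k + len k \<le> Zs k'"
  using Zs_mono[of "Suc k" k'] by (simp add: Zs_Suc)

lemma R_le: "R \<le> Zs k" by (simp add: Zs_def)

lemma vpos_step: "g < g' \<Longrightarrow> vpos k g + glen (k * NG + g) \<le> vpos k g'"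
proof -
  assume "g < g'"
  then have "(\<Sum>i<Suc g. glen (k * NG + i)) \<le> (\<Sum>i<g'. glen (k * NG + i))"
    by (intro sum_mono2) auto
  then show ?thesis by (simp add: vpos_def)
qed

lemma vpos_mono: "g \<le> g' \<Longrightarrow> vpos k g \<le> vpos k g'"
  using vpos_step[of g g' k] by (cases "g = g'") auto

lemma np_le: "np \<le> vpos k g div cap"
  using cap_pos by (simp add: vpos_def)

section \<open>Disjointness of the fields\<close>

fun rec_pos :: "item \<Rightarrow> nat \<times> nat" where
  "rec_pos (Tbl W j) = (W * h + j, 1)"
| "rec_pos (Flag k) = (k, 2)"
| "rec_pos (Dig k t) = (k, 3 + t)"
| "rec_pos _ = (0, 0)"

fun block :: "item \<Rightarrow> nat option" where
  "block (Ptr k g) = Some k"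
| "block (Ctr k j t) = Some k"
| "block (Grp k g) = Some k"
| "block _ = None"

lemma tbl_index_less: "W < 2 ^ T \<Longrightarrow> j < h \<Longrightarrow> W * h + j < 2 ^ T * h"
  by (rule mult_add_less)

lemma recs_pos: "1 \<le> recs" by (simp add: recs_def nsb_def)

lemma record_slot:
  assumes "valid x" "block x = None"
  shows "islot x = fst (rec_pos x) * 2 ^ d + snd (rec_pos x)" "snd (rec_pos x) < 2 ^ d" "fst (rec_pos x) < recs"
proof -
  show "islot x = fst (rec_pos x) * 2 ^ d + snd (rec_pos x)" using assms by (cases x) auto
  show "snd (rec_pos x) < 2 ^ d" using assms d_ge by (cases x) auto
  show "fst (rec_pos x) < recs" using assms recs_pos tbl_index_less
    by (cases x) (auto simp: recs_def trans_less_add2)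
qed

lemma record_less:
  assumes "valid x" "block x = None"
  shows "islot x < R"
proof -
  have "islot x < (fst (rec_pos x) + 1) * 2 ^ d" using record_slot[OF assms] by simp
  also have "\<dots> \<le> recs * 2 ^ d" using record_slot(3)[OF assms] by (intro mult_right_mono) auto
  finally show ?thesis by (simp add: R_def)
qed

lemma block_slot:
  assumes "valid x" "block x = Some k"
  shows "k < nsb" "Zs k \<le> islot x" "islot x < Zs k + len k"
proof -
  show "k < nsb" "Zs k \<le> islot x" using assms by (cases x; auto)+
  show "islot x < Zs k + len k"
  proof (cases x)
    case (Ptr k' g)
    then have "g div E3 \<le> NG div E3" using assms by (simp add: div_le_mono)
    then have "g div E3 < vpos k NG div cap + 1" using np_le[of k NG] by (simp add: np_def)
    then show ?thesis using Ptr assms by (auto simp: len_def)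
  next
    case (Ctr k' j t)
    then have "j * D + t < B * D" using assms by (intro mult_add_less) auto
    then show ?thesis using Ctr assms by (auto simp: len_def)
  next
    case (Grp k' g)
    then have "vpos k g div cap \<le> vpos k NG div cap" using assms vpos_mono[of g NG k] by (auto simp: div_le_mono)
    then show ?thesis using Grp assms by (auto simp: len_def)
  qed (use assms in auto)
qed

lemma islot_less: "valid x \<Longrightarrow> islot x < Zmax"
proof (cases "block x")
  case None
  then show "valid x \<Longrightarrow> ?thesis" using record_less[of x] R_le[of nsb] by (simp add: Zmax_def)
next
  case (Some k)
  then show "valid x \<Longrightarrow> ?thesis" using block_slot[of x k] Zs_step[of k nsb] by (simp add: Zmax_def)
qed

lemma ifit: "valid x \<Longrightarrow> ioff x + iwid x \<le> f"
proof (cases x)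
  case (Ptr k g)
  have "(g mod E3 + 1) * (4 * s) \<le> E3 * (4 * s)" using E3_pos by (intro mult_right_mono) (auto simp: Suc_leI)
  also have "\<dots> \<le> f" by (simp add: E3_def)
  finally show ?thesis using Ptr by simp
next
  case (Grp k g)
  have "vpos k g mod cap < cap" using cap_pos by simp
  moreover have "cap + T = f" using T_less by (simp add: cap_def)
  ultimately show ?thesis using Grp glen_le[of "k * NG + g"] by simp
qed auto

lemma rec_pos_inj:
  assumes "valid x" "valid y" "block x = None" "block y = None" "rec_pos x = rec_pos y"
  shows "x = y"
proof -
  have tbl: "W = W' \<and> j = j'" if "W * h + j = W' * h + j'" "j < h" "j' < h" for W j W' j'
    using mult_add_inject[OF that] .
  show ?thesis
  proof (cases x)
    case (Tbl W j)
    then obtain W' j' where y: "y = Tbl W' j'" using assms by (cases y) auto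
    show ?thesis using tbl[of W j W' j'] assms Tbl y by simp
  qed (use assms in \<open>cases y; simp\<close>)+
qed

text \<open>Records lie below all superblocks, and superblocks do not overlap. Two fields can share
  a slot only if both are pointers, or both are groups, of one light superblock; then their offsets
  are apart by the width of the first.\<close>

lemma idisj:
  assumes x: "valid x" and y: "valid y" and ne: "x \<noteq> y"
  shows "islot x \<noteq> islot y \<or> ioff x + iwid x \<le> ioff y \<or> ioff y + iwid y \<le> ioff x"
proof (cases "block x"; cases "block y")
  assume n: "block x = None" "block y = None"
  have "islot x \<noteq> islot y"
  proof
    assume "islot x = islot y"
    then have "fst (rec_pos x) * 2 ^ d + snd (rec_pos x) = fst (rec_pos y) * 2 ^ d + snd (rec_pos y)"
      using record_slot(1) x y n by simp
    moreover have "(fst (rec_pos x) * 2 ^ d + snd (rec_pos x)) div 2 ^ d = fst (rec_pos x)"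
      "(fst (rec_pos y) * 2 ^ d + snd (rec_pos y)) div 2 ^ d = fst (rec_pos y)"
      using record_slot(2) x y n by auto
    ultimately have "rec_pos x = rec_pos y" by (metis add_left_cancel prod_eqI)
    then show False using rec_pos_inj x y n ne by blast
  qed
  then show ?thesis by blast
next
  fix k assume "block x = None" "block y = Some k"
  then show ?thesis using record_less[OF x] block_slot[OF y] R_le[of k] by force
next
  fix k assume "block x = Some k" "block y = None"
  then show ?thesis using record_less[OF y] block_slot[OF x] R_le[of k] by force
next
  fix k k' assume b: "block x = Some k" "block y = Some k'"
  show ?thesis
  proof (cases "k = k'")
    case False
    then show ?thesis using block_slot[OF x b(1)] block_slot[OF y b(2)] Zs_step[of k k'] Zs_step[of k' k]
      by (cases "k < k'") auto
  next
    case True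
    have ptr: "g div E3 \<noteq> g' div E3 \<or> g mod E3 * (4 * s) + 4 * s \<le> g' mod E3 * (4 * s)
        \<or> g' mod E3 * (4 * s) + 4 * s \<le> g mod E3 * (4 * s)" if "g \<noteq> g'" for g g'
    proof (cases "g div E3 = g' div E3")
      case True
      then have "g mod E3 \<noteq> g' mod E3" using that by (metis div_mult_mod_eq)
      then consider "g mod E3 + 1 \<le> g' mod E3" | "g' mod E3 + 1 \<le> g mod E3" by linarith
      then show ?thesis
      proof cases
        case 1
        from mult_right_mono[OF this, of "4 * s"] show ?thesis by simp
      next
        case 2
        from mult_right_mono[OF this, of "4 * s"] show ?thesis by simp
      qed
    qed simp
    have grp: "vpos k g div cap \<noteq> vpos k g' div cap \<or> vpos k g mod cap + glen (k * NG + g) \<le> vpos k g' mod cap"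
      if "g < g'" for g g'
      using mod_less_div_ge[OF _ vpos_step[OF that]] by blast
    have cross: "g div E3 \<noteq> vpos k g' div cap" if "g < NG" for g g'
    proof -
      have "g div E3 \<le> NG div E3" using that by (simp add: div_le_mono)
      then show ?thesis using np_le[of k g'] by (simp add: np_def)
    qed
    have ctr: "j = j' \<and> t = t'" if "j * D + t = j' * D + t'" "t < D" "t' < D" for j j' t t'
      using mult_add_inject[OF that] .
    show ?thesis
    proof (cases x)
      case (Ptr kx g)
      show ?thesis
      proof (cases y)
        case (Ptr ky g')
        then show ?thesis using \<open>x = Ptr kx g\<close> True b ne ptr[of g g'] by auto
      next
        case (Grp ky g')
        then show ?thesis using Ptr True b x cross[of g g'] by auto
      qed (use Ptr x y b True in auto)
    next
      case (Grp kx g)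
      show ?thesis
      proof (cases y)
        case (Ptr ky g')
        then show ?thesis using Grp True b y cross[of g' g] by auto
      next
        case (Grp ky g')
        then show ?thesis using \<open>x = Grp kx g\<close> True b ne grp[of g g'] grp[of g' g] by (cases "g < g'") auto
      qed (use Grp x y b True in auto)
    next
      case (Ctr kx j t)
      then obtain j' t' where y': "y = Ctr k j' t'" using x y b True by (cases y) auto
      have "kx = k" using b Ctr by simp
      then show ?thesis using x y ne ctr[of j t j' t'] Ctr y' by auto
    qed (use b in auto)
  qed
qed

section \<open>Reading and writing single fields\<close>

lemma slot_pos_le: "islot x mod 2 ^ e * f + f \<le> w"
  by (rule slot_bound[OF slots_fit])

lemma ipos_le: "valid x \<Longrightarrow> ipos x + iwid x \<le> w"
  using ifit[of x] slot_pos_le[of x] by (simp add: ipos_def)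

lemma content_eq: "valid x \<Longrightarrow> content M x = fld (M (iword x)) (ipos x) (iwid x)"
  using ifit[of x] by (simp add: content_def slot_def iword_def ipos_def fld_fld)

lemma pos_disj:
  assumes "valid x" "valid y" "x \<noteq> y"
  shows "iword x \<noteq> iword y \<or> ipos x + iwid x \<le> ipos y \<or> ipos y + iwid y \<le> ipos x"
proof (cases "iword x = iword y")
  case True
  have fits: "ioff x + iwid x \<le> f" "ioff y + iwid y \<le> f" using ifit assms by auto
  show ?thesis
  proof (cases "islot x mod 2 ^ e = islot y mod 2 ^ e")
    case eq: True
    then have "islot x = islot y" using True unfolding iword_def by (metis div_mult_mod_eq)
    then show ?thesis using idisj[OF assms] by (auto simp: ipos_def)
  next
    case False
    then consider "islot x mod 2 ^ e + 1 \<le> islot y mod 2 ^ e" | "islot y mod 2 ^ e + 1 \<le> islot x mod 2 ^ e" by linarith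
    then show ?thesis
    proof cases
      case 1
      from mult_right_mono[OF this, of f] show ?thesis using fits by (simp add: ipos_def)
    next
      case 2
      from mult_right_mono[OF this, of f] show ?thesis using fits by (simp add: ipos_def)
    qed
  qed
qed simp

lemma content_put_same: "valid x \<Longrightarrow> u < 2 ^ iwid x \<Longrightarrow> content (put x u M) x = u"
  by (simp add: content_eq put_def fld_fld_upd_same)

lemma content_put_other:
  assumes "valid x" "valid y" "x \<noteq> y" "u < 2 ^ iwid x"
  shows "content (put x u M) y = content M y"
  using pos_disj[OF assms(1-3)] fld_fld_upd_disjoint[OF assms(4), of "ipos x" "ipos y" "iwid y" "M (iword x)"] assms(2)
  by (auto simp: content_eq put_def)

lemma put_memory:
  assumes "valid x" "u < 2 ^ iwid x" "is_memory w M"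
  shows "is_memory w (put x u M)"
  using assms fld_upd_less[OF _ ipos_le[OF assms(1)] assms(2)] by (auto simp: is_memory_def put_def)

lemma pos_less_S:
  assumes "z < Zmax"
  shows "z div 2 ^ e * w + z mod 2 ^ e * f + f \<le> S"
proof (cases "z div 2 ^ e = Zmax div 2 ^ e")
  case True
  have "z mod 2 ^ e < Zmax mod 2 ^ e"
    using assms True by (metis add_less_cancel_left div_mult_mod_eq)
  then have "(z mod 2 ^ e + 1) * f \<le> Zmax mod 2 ^ e * f" by (intro mult_right_mono) auto
  then show ?thesis using True by (simp add: S_def)
next
  case False
  moreover have "z div 2 ^ e \<le> Zmax div 2 ^ e" using assms by (simp add: div_le_mono)
  ultimately have "(z div 2 ^ e + 1) * w \<le> Zmax div 2 ^ e * w" by (intro mult_right_mono) auto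
  then show ?thesis using slot_bound[OF slots_fit, of z] by (simp add: S_def)
qed

lemma w_pos: "1 \<le> w" using e_less_w by simp

lemma put_beyond:
  assumes "valid x" "u < 2 ^ iwid x"
  shows "unchanged_beyond w S M (put x u M)"
proof -
  have "mem_bit w (put x u M) j = mem_bit w M j" if "S \<le> j" for j
  proof (cases "j div w = iword x")
    case True
    have "ipos x + iwid x \<le> islot x mod 2 ^ e * f + f" using ifit[OF assms(1)] by (simp add: ipos_def)
    then have "iword x * w + (ipos x + iwid x) \<le> j"
      using pos_less_S[OF islot_less[OF assms(1)]] that by (simp add: iword_def)
    moreover have "j = iword x * w + j mod w" using True by (metis div_mult_mod_eq)
    ultimately have "ipos x + iwid x \<le> j mod w" by linarith
    then show ?thesis using True by (simp add: mem_bit_def put_def bit_fld_upd[OF assms(2)])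
  qed (simp add: mem_bit_def put_def)
  then show ?thesis by (simp add: unchanged_beyond_def)
qed

lemma slot_cong:
  assumes "\<forall>j<S. mem_bit w M j = mem_bit w M' j" "z < Zmax"
  shows "slot e f M z = slot e f M' z"
proof (rule bit_eqI)
  fix b
  show "bit (slot e f M z) b = bit (slot e f M' z) b"
  proof (cases "b < f")
    case True
    let ?j = "z div 2 ^ e * w + (z mod 2 ^ e * f + b)"
    have "?j < S" using pos_less_S[OF assms(2)] True by linarith
    moreover have "z mod 2 ^ e * f + b < w" using slot_bound[OF slots_fit, of z] True by linarith
    ultimately show ?thesis using assms(1)[rule_format, of ?j] True w_pos by (simp add: slot_def bit_fld mem_bit_def)
  qed (simp add: slot_def bit_fld)
qed

text \<open>This is what allows a predicate on memories to be turned into a set of bit strings of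
  length \<open>S\<close>.\<close>

lemma represents_cong:
  assumes "\<forall>j<S. mem_bit w M j = mem_bit w M' j" "represents ys M"
  shows "represents ys M'"
proof -
  have c: "content M' x = content M x" if "valid x" for x
    using slot_cong[OF assms(1) islot_less[OF that]] by (simp add: content_def)
  have "fixed M'" using assms(2) c by (simp add: represents_def fixed_def)
  moreover have "ctr M' k j = ctr M k j" if "k < nsb" "heavy k" "j < B" for k j
    unfolding ctr_def using that c by (intro sum.cong) auto
  moreover have "coded ys M' k g" if "k < nsb" "\<not> heavy k" "g < NG" for k g
    using that c[of "Grp k g"] assms(2) by (auto simp: represents_def coded_def)
  ultimately show ?thesis using assms(2) by (simp add: represents_def)
qed

lemma sval_less:
  assumes "valid x" "static x"
  shows "sval x < 2 ^ iwid x"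
proof (cases x)
  case Hdr
  let ?q = "2 ^ (2 * s) :: nat"
  have step: "a + ?q * b < 2 ^ (2 * s + c)" if "a < ?q" "b < 2 ^ c" for a b c
  proof -
    have "a + ?q * b < ?q * (b + 1)" using that by simp
    also have "\<dots> \<le> ?q * 2 ^ c" using that by (intro mult_left_mono) auto
    finally show ?thesis by (simp add: power_add)
  qed
  have "s < ?q" using less_exp[of "2 * s"] by linarith
  moreover have "(2::nat) ^ (2 * s - 1) < ?q" using s_pos by (intro power_strict_increasing) auto
  ultimately have "sval x < 2 ^ (2 * s + (2 * s + (2 * s + 2 * s)))"
    unfolding Hdr sval.simps using f_less e_less by (intro step)
  also have "2 ^ (2 * s + (2 * s + (2 * s + 2 * s))) \<le> (2::nat) ^ f" using hdr_fits by (intro power_increasing) auto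
  finally show ?thesis using Hdr by simp
next
  case (Tbl W j)
  then have "sval x \<le> 2 ^ T" using table_le assms by simp
  also have "\<dots> < 2 ^ f" using T_less by simp
  finally show ?thesis using Tbl by simp
next
  case (Flag k)
  then show ?thesis using f_pos one_less_power[of "2::nat" f] by simp
next
  case (Dig k t)
  \<comment> \<open>A digit has w bits but its slot only f. If f < w, then the number
    \<open>Zs k\<close> itself is below 2^f, and so are its digits.\<close>
  show ?thesis
  proof (cases "f = w")
    case True
    have "Zs k div 2 ^ (w * t) mod 2 ^ w < 2 ^ w" by simp
    from less_le_trans[OF this eq_refl[OF arg_cong[OF True[symmetric], of "power 2"]]]
    show ?thesis unfolding Dig sval.simps iwid.simps .
  next
    case False
    then have "Zs k < 2 ^ f" using slot_wide Zs_mono[of k nsb] assms Dig by (auto simp: Zmax_def)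
    moreover have "Zs k div 2 ^ (w * t) mod 2 ^ w \<le> Zs k"
      by (rule le_trans[OF mod_less_eq_dividend div_le_dividend])
    ultimately have "Zs k div 2 ^ (w * t) mod 2 ^ w < 2 ^ f" by (rule le_less_trans[rotated])
    then show ?thesis using Dig by simp
  qed
next
  case (Ptr k g)
  then show ?thesis using vpos_less assms by simp
qed (use assms in auto)
end

subsection \<open>Represented sequences\<close>

lemma get_update: "i < length ys \<Longrightarrow> get (ys[i := y]) i' = (if i' = i then y else get ys i')"
  by (auto simp: get_def)

lemma get_le_sum: "get xs i \<le> sum_list xs"
  by (auto simp: get_def member_le_sum_list)

context valid_layout
begin

lemma finite_valid: "finite {x. valid x}"
proof -
  have "{x. valid x} \<subseteq> {Hdr} \<union> (\<Union>W<2 ^ T. Tbl W ` {..<h}) \<union> Flag ` {..<nsb} \<union> (\<Union>k<nsb. Dig k ` {..<K}) \<union>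
      (\<Union>k<nsb. Ptr k ` {..<NG}) \<union> (\<Union>k<nsb. \<Union>j<B. Ctr k j ` {..<D}) \<union> (\<Union>k<nsb. Grp k ` {..<NG})"
    (is "_ \<subseteq> ?F")
  proof
    fix x assume "x \<in> {x. valid x}"
    then have "valid x" by simp
    then show "x \<in> ?F" by (cases x) auto
  qed
  then show ?thesis by (rule finite_subset) auto
qed

lemma group_index:
  assumes "g < NG" "j < h"
  shows "(k * NG + g) * h + j = k * B + (g * h + j)" "g * h + j < B"
proof -
  have "(k * NG + g) * h + j = k * (NG * h) + (g * h + j)" by (simp add: algebra_simps)
  then show "(k * NG + g) * h + j = k * B + (g * h + j)" unfolding B_eq .
  show "g * h + j < B" using mult_add_less[OF assms] unfolding B_eq .
qed

lemma represents_init: "\<exists>M. is_memory w M \<and> represents xs M"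
proof -
  define cw where "cw \<gamma> = (SOME cw. group_code (6 * s) (grp xs \<gamma>) cw \<and> length cw = glen \<gamma>)" for \<gamma>
  have cw: "group_code (6 * s) (grp xs (k * NG + g)) (cw (k * NG + g))"
    "length (cw (k * NG + g)) = glen (k * NG + g)" if "\<not> heavy k" "g < NG" for k g
  proof -
    have "x < 2 ^ (6 * s)" if "x \<in> set (grp xs (k * NG + g))" for x
    proof -
      from that obtain j where "j < h" "x = get xs ((k * NG + g) * h + j)" by (auto simp: grp_def)
      then show ?thesis using group_index(1)[OF \<open>g < NG\<close>, of j k] group_index(2)[OF \<open>g < NG\<close>, of j] \<open>\<not> heavy k\<close>
        unfolding heavy_def by (metis not_le)
    qed
    then have "\<exists>cw. group_code (6 * s) (grp xs (k * NG + g)) cw \<and> length cw = glen (k * NG + g)"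
      unfolding glen_def by (intro group_code_exists) auto
    from someI_ex[OF this] show "group_code (6 * s) (grp xs (k * NG + g)) (cw (k * NG + g))"
      "length (cw (k * NG + g)) = glen (k * NG + g)" unfolding cw_def by auto
  qed
  define u where "u x = (case x of Ctr k j t \<Rightarrow> get xs (k * B + j) div (2 ^ f) ^ t mod 2 ^ f
     | Grp k g \<Rightarrow> num (cw (k * NG + g)) | _ \<Rightarrow> sval x)" for x
  have u_static: "u x = sval x" if "static x" for x using that by (cases x) (auto simp: u_def)
  have u_less: "u x < 2 ^ iwid x" if "valid x" for x
  proof (cases "static x")
    case False
    then consider k j t where "x = Ctr k j t" | k g where "x = Grp k g" by (cases x) auto
    then show ?thesis
    proof cases
      case (2 k g)
      then have "length (cw (k * NG + g)) = iwid x" using cw that by simp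
      then show ?thesis using num_less[of "cw (k * NG + g)"] 2 by (simp add: u_def)
    qed (simp add: u_def)
  qed (use that sval_less u_static in auto)
  obtain M where M: "\<forall>b. M b < 2 ^ w" "\<forall>x\<in>{x. valid x}. fld (M (iword x)) (ipos x) (iwid x) = u x"
    using exists_fields[OF finite_valid, where p = ipos and t = iwid and w = w and u = u and a = iword] ipos_le u_less pos_disj by auto
  have c: "content M x = u x" if "valid x" for x using M(2) that by (simp add: content_eq)
  have "fixed M" using c u_static by (auto simp: fixed_def)
  moreover have "ctr M k j = get xs (k * B + j)" if "k < nsb" "heavy k" "j < B" for k j
  proof -
    have "get xs (k * B + j) < (2 ^ f) ^ D"
      using ctr_fits get_le_sum[of xs "k * B + j"] by (simp add: power_mult)
    from sum_digits[OF this] show ?thesis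
      using c that by (simp add: ctr_def u_def)
  qed
  moreover have "coded xs M k g" if "k < nsb" "\<not> heavy k" "g < NG" for k g
    using cw[OF that(2,3)] c[of "Grp k g"] that by (auto simp: coded_def u_def)
  ultimately show ?thesis using M by (auto simp: represents_def is_memory_def)
qed

lemma fixed_eq:
  assumes "fixed M" "\<And>x. valid x \<Longrightarrow> static x \<Longrightarrow> content M' x = content M x"
  shows "fixed M'"
  using assms by (simp add: fixed_def)

lemma grp_update:
  assumes "i < length ys" "i = \<gamma> * h + j" "j < h"
  shows "grp (ys[i := y]) \<gamma>' = (if \<gamma>' = \<gamma> then (grp ys \<gamma>)[j := y] else grp ys \<gamma>')"
proof (rule nth_equalityI)
  fix j' assume "j' < length (grp (ys[i := y]) \<gamma>')"
  then have j': "j' < h" by simp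
  have "\<gamma>' * h + j' = i \<longleftrightarrow> \<gamma>' = \<gamma> \<and> j' = j"
    using mult_add_inject[of \<gamma>' h j' \<gamma> j] j' assms by auto
  then show "grp (ys[i := y]) \<gamma>' ! j' = (if \<gamma>' = \<gamma> then (grp ys \<gamma>)[j := y] else grp ys \<gamma>') ! j'"
    using j' assms by (auto simp: grp_def get_update nth_list_update)
qed simp

lemma block_eq:
  assumes "k * B + j = k' * B + j'" "j < B" "j' < B"
  shows "k = k' \<and> j = j'"
  using mult_add_inject[OF assms] .

lemma represents_put_grp:
  assumes rep: "represents ys M" and k: "k < nsb" "\<not> heavy k" "g < NG" "j < h"
    and i: "i = (k * NG + g) * h + j" "i < length ys"
    and cw: "group_code (6 * s) ((grp ys (k * NG + g))[j := y]) cw" "length cw = glen (k * NG + g)"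
  shows "represents (ys[i := y]) (put (Grp k g) (num cw) M)"
proof -
  let ?x = "Grp k g" and ?M = "put (Grp k g) (num cw) M"
  have vx: "valid ?x" using k by simp
  have u: "num cw < 2 ^ iwid ?x" using num_less[of cw] cw by simp
  have other: "content ?M y = content M y" if "valid y" "y \<noteq> ?x" for y
    using content_put_other[OF vx that(1) _ u] that(2) by blast
  have "fixed ?M"
  proof (rule fixed_eq)
    show "fixed M" using rep by (simp add: represents_def)
    show "content ?M x = content M x" if "valid x" "static x" for x
      using other[OF that(1)] that(2) by (cases x) auto
  qed
  moreover have "ctr ?M k' j' = get (ys[i := y]) (k' * B + j')" if "k' < nsb" "heavy k'" "j' < B" for k' j'
  proof -
    have "ctr ?M k' j' = ctr M k' j'" unfolding ctr_def using that other by (intro sum.cong) auto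
    moreover have "k' * B + j' \<noteq> i"
      using group_index(1)[OF k(3,4), of k] group_index(2)[OF k(3,4)] block_eq[of k' j' k "g * h + j"] that k i by auto
    ultimately show ?thesis using rep that i by (auto simp: represents_def get_update)
  qed
  moreover have "coded (ys[i := y]) ?M k' g'" if "k' < nsb" "\<not> heavy k'" "g' < NG" for k' g'
  proof (cases "k' * NG + g' = k * NG + g")
    case True
    then have "k' = k" "g' = g" using mult_add_inject[OF True] that k by auto
    then show ?thesis using cw content_put_same[OF vx u] grp_update[OF i(2,1) k(4)] by (auto simp: coded_def)
  next
    case False
    then have "Grp k' g' \<noteq> ?x" by auto
    then have "content ?M (Grp k' g') = content M (Grp k' g')" using other that by simp
    moreover have "coded ys M k' g'" using rep that by (auto simp: represents_def)
    moreover have "grp (ys[i := y]) (k' * NG + g') = grp ys (k' * NG + g')"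
      using False grp_update[OF i(2,1) k(4)] by simp
    ultimately show ?thesis by (simp add: coded_def)
  qed
  ultimately show ?thesis using rep by (auto simp: represents_def)
qed

text \<open>The digits of a counter are written one at a time, and the intermediate memories do not
  yet represent the decremented sequence. Hence \<open>M'\<close> is compared with \<open>M\<close>
  only outside these digits.\<close>

lemma represents_put_ctr:
  assumes rep: "represents ys M" and k: "k < nsb" "heavy k" "j < B"
    and i: "i = k * B + j" "i < length ys"
    and other: "\<And>x. valid x \<Longrightarrow> (\<forall>t. x \<noteq> Ctr k j t) \<Longrightarrow> content M' x = content M x"
    and y: "ctr M' k j = y"
  shows "represents (ys[i := y]) M'"
proof -
  have "fixed M'"
  proof (rule fixed_eq)
    show "fixed M" using rep by (simp add: represents_def)
    show "content M' x = content M x" if "valid x" "static x" for x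
      using other[OF that(1)] that(2) by (cases x) auto
  qed
  moreover have "ctr M' k' j' = get (ys[i := y]) (k' * B + j')" if "k' < nsb" "heavy k'" "j' < B" for k' j'
  proof (cases "k' * B + j' = i")
    case True
    then have "k' = k \<and> j' = j" using block_eq[of k' j' k j] that k i by auto
    then show ?thesis using y i by (simp add: get_update)
  next
    case False
    have "content M' (Ctr k' j' t) = content M (Ctr k' j' t)" if "t < D" for t
      by (rule other) (use that False i \<open>k' < nsb\<close> \<open>heavy k'\<close> \<open>j' < B\<close> in auto)
    then have "ctr M' k' j' = ctr M k' j'" unfolding ctr_def by (intro sum.cong) auto
    then show ?thesis using rep that i False by (auto simp: represents_def get_update)
  qed
  moreover have "coded (ys[i := y]) M' k' g'" if "k' < nsb" "\<not> heavy k'" "g' < NG" for k' g'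
  proof -
    have "content M' (Grp k' g') = content M (Grp k' g')" using other that by simp
    moreover have "coded ys M k' g'" using rep that by (auto simp: represents_def)
    moreover have "grp (ys[i := y]) (k' * NG + g') = grp ys (k' * NG + g')"
    proof -
      have "(k' * NG + g') * h + j' \<noteq> i" if "j' < h" for j'
        using group_index(1)[OF \<open>g' < NG\<close> that, of k'] group_index(2)[OF \<open>g' < NG\<close> that] block_eq[of k' "g' * h + j'" k j] \<open>\<not> heavy k'\<close> k i by auto
      then show ?thesis using i by (auto simp: grp_def get_update)
    qed
    ultimately show ?thesis by (simp add: coded_def)
  qed
  ultimately show ?thesis using rep by (auto simp: represents_def)
qed

end

subsection \<open>The query expressions\<close>

definition "hdr_exp = Ld [Num 0]"
text \<open>Evaluates to 2^(2 s), the base in which the header lists f, s and e, by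
  \<open>xor_pred\<close>.\<close>

definition "Q_exp = Op Add (Op Xor hdr_exp (Op Sub hdr_exp (Num 1))) (Num 1)"
definition "f_exp = Op Mod (Op Div hdr_exp Q_exp) Q_exp"
definition "s_exp = Op Mod (Op Div (Op Div hdr_exp Q_exp) Q_exp) Q_exp"
definition "e_exp = Op Mod (Op Div (Op Div (Op Div hdr_exp Q_exp) Q_exp) Q_exp) Q_exp"
definition "E_exp = Op Shl (Num 1) e_exp"
definition "h_exp = Op Mul s_exp s_exp"
definition "T_exp = Op Add (Op Mul (Op Mul (Num 6) s_exp) h_exp) (Num 1)"
definition "cap_exp = Op Sub f_exp T_exp"
definition "s4_exp = Op Mul (Num 4) s_exp"
definition "E3_exp = Op Div f_exp s4_exp"
text \<open>The low word of i suffices for i mod B, because 3 s < w.\<close>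

definition "j_exp = Op Mod (Var 0) (Op Shl (Num 1) (Op Mul (Num 3) s_exp))"
definition "idx K = map Var [0..<K]"
text \<open>A shift by 3 s - d instead of 3 s, followed by clearing the low d bits, gives k 2^d
  without a multi-word left shift. The slot number t then goes into the cleared bits, so no carry
  leaves the lowest word.\<close>

definition "rec_idx K d t =
  (case shr (Op Shl (Num 1) (Op Sub (Op Mul (Num 3) s_exp) (Num d))) (idx K) of
     x # xs \<Rightarrow> Op Add (Op Sub x (Op Mod x (Num (2 ^ d)))) (Num t) # xs | [] \<Rightarrow> [])"
definition "rd_exp = slot_rd E_exp f_exp"
definition "wr_exp = slot_wr E_exp f_exp"
definition "flag_exp K d = rd_exp (rec_idx K d 2)"
definition "Z_exps K d = map (\<lambda>t. rd_exp (rec_idx K d (3 + t))) [0..<K]"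
definition "ctr_idx K d D t = addl (Z_exps K d) (Op Add (Op Mul j_exp (Num D)) (Num t))"
definition "g_exp = Op Div j_exp h_exp"
definition "jj_exp = Op Mod j_exp h_exp"
definition "ptr_exp K d =
  fld_exp (rd_exp (addl (Z_exps K d) (Op Div g_exp E3_exp))) (Op Mul (Op Mod g_exp E3_exp) s4_exp) s4_exp"
definition "grp_idx K d = addl (Z_exps K d) (Op Div (ptr_exp K d) cap_exp)"
definition "off_exp K d = Op Mod (ptr_exp K d) cap_exp"
definition "win_exp K d = fld_exp (rd_exp (grp_idx K d)) (off_exp K d) T_exp"
definition "tbl_exp K d = rd_exp
  [Op Add (Op Mul (Op Add (Op Mul (win_exp K d) h_exp) jj_exp) (Num (2 ^ d))) (Num 1)]"
definition "all_zero rd t = foldr (\<lambda>u b. Conj (Op Equal (rd u) (Num 0)) b) [0..<t] (Num 1)"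
definition "big_zero K d D = Ite (flag_exp K d) (all_zero (\<lambda>t. rd_exp (ctr_idx K d D t)) D)
  (Op Equal (tbl_exp K d) (Op Shl (Num 1) T_exp))"
text \<open>If the condition fails, the word that is found is written back, so the store is harmless
  even if the address is meaningless. \<open>b\<close> switches the store off for short
  words.\<close>

definition "ctr_store K d D b t = (shr E_exp (ctr_idx K d D t),
  Ite (Conj b (Conj (flag_exp K d) (all_zero (\<lambda>t. rd_exp (ctr_idx K d D t)) t)))
    (wr_exp (ctr_idx K d D t) (Op Mod (Op Sub (rd_exp (ctr_idx K d D t)) (Num 1)) (Op Shl (Num 1) f_exp)))
    (Ld (shr E_exp (ctr_idx K d D t))))"
definition "grp_store K d b = (shr E_exp (grp_idx K d),
  Ite (Conj b (Op Equal (flag_exp K d) (Num 0)))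
    (wr_exp (grp_idx K d) (upd_exp (rd_exp (grp_idx K d)) (off_exp K d) (win_exp K d) (tbl_exp K d)))
    (Ld (shr E_exp (grp_idx K d))))"

lemma val_map:
  assumes "\<And>t. t < K \<Longrightarrow> ev c w R M (X t) = x div 2 ^ (w * t) mod 2 ^ w" "x < 2 ^ (w * K)"
  shows "val c w R M (map X [0..<K]) = x"
proof -
  have "val c w R M (map X [0..<K]) = (\<Sum>t<K. (x div (2 ^ w) ^ t mod 2 ^ w) * (2 ^ w) ^ t)"
    unfolding val_def horner_sum_eq_sum using assms(1)
    by (auto simp: power_mult intro!: sum.cong)
  also have "\<dots> = x" by (rule sum_digits) (use assms(2) in \<open>simp add: power_mult\<close>)
  finally show ?thesis .
qed

lemma ev_all_zero:
  assumes "good w R M"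
  shows "ev c w R M (all_zero rd t) = (if \<forall>u<t. ev c w R M (rd u) = 0 then 1 else 0)"
proof -
  have "ev c w R M (foldr (\<lambda>u b. Conj (Op Equal (rd u) (Num 0)) b) us (Num 1)) =
      (if \<forall>u\<in>set us. ev c w R M (rd u) = 0 then 1 else 0)" for us
  proof (induction us)
    case Nil
    show ?case using good_one[OF assms] by simp
  next
    case (Cons u us)
    have "ev c w R M (Op Equal (rd u) (Num 0)) = (if ev c w R M (rd u) = 0 then 1 else 0)"
      using ev_eq[OF assms, of c "rd u" "Num 0"] by simp
    from ev_Conj[OF assms this Cons.IH] show ?case by simp
  qed
  from this[of "[0..<t]"] show ?thesis by (auto simp: all_zero_def)
qed

section \<open>Values of the query expressions in a given memory\<close>

declare ev.simps [simp del]

text \<open>Only the static fields are assumed to be intact, instead of \<open>represents\<close>,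
  so that the locale also applies between two digit updates of a counter.\<close>

locale loaded = valid_layout +
  fixes M :: "nat \<Rightarrow> nat" and i :: nat
  assumes fixed: "fixed M" and memory: "is_memory w M" and i_less: "i < length xs"
begin

abbreviation v :: "expr \<Rightarrow> nat" where "v \<equiv> ev K w (digits w i) M"
abbreviation vl :: "expr list \<Rightarrow> nat" where "vl \<equiv> val K w (digits w i) M"
abbreviation k :: nat where "k \<equiv> i div B"
abbreviation g :: nat where "g \<equiv> (i mod B) div h"
abbreviation j :: nat where "j \<equiv> (i mod B) mod h"

lemma good: "good w (digits w i) M"
  using memory w_pos by (auto simp: good_def is_memory_def)

lemma k_less: "k < nsb"
  using i_less by (simp add: nsb_def div_le_mono less_Suc_eq_le)

lemma B_pos: "0 < B" by (simp add: B_def)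

lemma g_less: "g < NG"
  using B_eq B_pos by (simp add: less_mult_imp_div_less)

lemma j_less: "j < h" using h_pos by simp

lemma i_eq: "i = (k * NG + g) * h + j"
proof -
  have "(k * NG + g) * h + j = k * B + (g * h + j)" by (rule group_index(1)[OF g_less j_less])
  then show ?thesis by simp
qed

lemma full_content:
  assumes "ioff x = 0" "iwid x = f"
  shows "content M x = slot e f M (islot x)"
proof -
  have "fld X 0 f = X" if "X < 2 ^ f" for X using that by (simp add: fld_def)
  then show ?thesis using assms fld_less by (simp add: content_def slot_def)
qed

lemma static_slot:
  assumes "valid x" "static x" "ioff x = 0" "iwid x = f"
  shows "slot e f M (islot x) = sval x"
  using fixed assms(1,2) full_content[OF assms(3,4)] by (simp add: fixed_def)

lemma small: "x \<le> w \<Longrightarrow> x < 2 ^ w"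
  using less_exp[of w] by linarith

lemma fits_word: "2 * s \<le> w" "3 * s \<le> w" "4 * s \<le> w" "s \<le> w" "T \<le> w" "h \<le> w" "6 * s \<le> w" "f \<le> w"
proof -
  show "f \<le> w" by (rule f_le_w)
  then show "2 * s \<le> w" "3 * s \<le> w" "4 * s \<le> w" "s \<le> w" "T \<le> w" "6 * s \<le> w"
    using hdr_fits T_less by auto
  have "1 * h \<le> 6 * s * h" using s_pos by (intro mult_right_mono) auto
  also have "\<dots> \<le> T" by (simp add: T_def)
  finally show "h \<le> w" using \<open>T \<le> w\<close> by simp
qed

lemma v_hdr: "v hdr_exp = M 0" unfolding hdr_exp_def by (simp add: ev.simps)

text \<open>Since f is not known at this point, the program cannot isolate slot 0 and decodes word 0
  as a whole. \<open>G\<close> collects the remaining bits, which other slots may occupy.\<close>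

lemma header:
  obtains G where "M 0 = 2 ^ (2 * s - 1) + 2 ^ (2 * s) * (f + 2 ^ (2 * s) * (s + 2 ^ (2 * s) * (e + 2 ^ (2 * s) * G)))"
proof -
  let ?Q = "2 ^ (2 * s) :: nat"
  have "slot e f M 0 = sval Hdr" using static_slot[of Hdr] by simp
  then have 1: "M 0 mod 2 ^ f = 2 ^ (2 * s - 1) + ?Q * (f + ?Q * (s + ?Q * e))" by (simp add: slot_def fld_def)
  have "(2::nat) ^ f = 2 ^ (2 * s + (2 * s + (2 * s + (2 * s + (f - 8 * s)))))" using hdr_fits by simp
  also have "\<dots> = ?Q * (?Q * (?Q * (?Q * 2 ^ (f - 8 * s))))" by (simp only: power_add)
  finally have 2: "(2::nat) ^ f = ?Q * (?Q * (?Q * (?Q * 2 ^ (f - 8 * s))))" .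
  have "M 0 = M 0 mod 2 ^ f + 2 ^ f * (M 0 div 2 ^ f)" by simp
  then have "M 0 = 2 ^ (2 * s - 1) + ?Q * (f + ?Q * (s + ?Q * (e + ?Q * (2 ^ (f - 8 * s) * (M 0 div 2 ^ f)))))"
    unfolding 1 unfolding 2 by (simp only: distrib_left ac_simps)
  then show ?thesis by (rule that)
qed

lemma v_Q: "v Q_exp = 2 ^ (2 * s)"
proof -
  obtain G where G: "M 0 = 2 ^ (2 * s - 1) + 2 ^ (2 * s) * G" using header by blast
  have "(2::nat) ^ (2 * s) = 2 ^ (2 * s - 1) * 2" using s_pos by (cases "2 * s") auto
  then have M0: "M 0 = 2 ^ (2 * s - 1) * (2 * G + 1)" unfolding G by (simp only: distrib_left mult.assoc mult_1_right add.commute)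
  have "1 \<le> M 0" using one_le_power[of "2::nat" "2 * s - 1"] unfolding G by linarith
  then have sub: "v (Op Sub hdr_exp (Num 1)) = M 0 - 1"
    using ev_num[OF good_pow[OF good]] by (subst ev_sub[OF good]) (simp_all only: v_hdr)
  have "v (Op Xor hdr_exp (Op Sub hdr_exp (Num 1))) = xor (M 0) (M 0 - 1) mod 2 ^ w"
    by (simp only: ev.simps(3)[where f = Xor] eval_binop.simps v_hdr sub)
  also have "xor (M 0) (M 0 - 1) = 2 ^ (2 * s) - 1"
    unfolding M0 xor_pred using s_pos by simp
  also have "\<dots> mod 2 ^ w = 2 ^ (2 * s) - 1"
    using hdr_fits f_le_w s_pos by (intro mod_less le_less_trans[OF diff_le_self]) (auto intro!: power_strict_increasing)
  finally have x: "v (Op Xor hdr_exp (Op Sub hdr_exp (Num 1))) = 2 ^ (2 * s) - 1" .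
  have "(2::nat) ^ (2 * s) < 2 ^ w" using hdr_fits f_le_w s_pos by (intro power_strict_increasing) auto
  then show ?thesis unfolding Q_exp_def using x ev_num[OF good_pow[OF good]] by (subst ev_add) auto
qed

lemma Q_header:
  shows "v f_exp = f" "v s_exp = s" "v e_exp = e"
proof -
  obtain G where G: "M 0 = 2 ^ (2 * s - 1) + 2 ^ (2 * s) * (f + 2 ^ (2 * s) * (s + 2 ^ (2 * s) * (e + 2 ^ (2 * s) * G)))"
    by (rule header)
  define Q where "Q = (2::nat) ^ (2 * s)"
  have s: "s < Q" unfolding Q_def using less_exp[of "2 * s"] by linarith
  have p: "(2::nat) ^ (2 * s - 1) < Q" unfolding Q_def using s_pos by (intro power_strict_increasing) auto
  have dm: "(a + Q * b) div Q = b" "(a + Q * b) mod Q = a" if "a < Q" for a b using that by auto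
  note d = dm[OF p] dm[OF f_less[folded Q_def]] dm[OF s] dm[OF e_less[folded Q_def]]
  note vs = ev_mod[OF good] ev_div[OF good] v_Q v_hdr G Q_def[symmetric] d
  show "v f_exp = f" unfolding f_exp_def by (simp only: vs)
  show "v s_exp = s" unfolding s_exp_def by (simp only: vs)
  show "v e_exp = e" unfolding e_exp_def by (simp only: vs)
qed

lemma v_E: "v E_exp = 2 ^ e"
  unfolding E_exp_def using ev_pow2[OF good] Q_header(3) e_less_w by simp

lemma numeral_val: "x \<le> w \<Longrightarrow> v (Num x) = x"
  by (rule ev_num[OF small])

lemma v_mul_small: "v a = x \<Longrightarrow> v b = y \<Longrightarrow> x * y < 2 ^ w \<Longrightarrow> v (Op Mul a b) = x * y"
  using ev_mul[of K w "digits w i" M a b] by simp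

lemma v_add_small: "v a = x \<Longrightarrow> v b = y \<Longrightarrow> x + y < 2 ^ w \<Longrightarrow> v (Op Add a b) = x + y"
  using ev_add[of K w "digits w i" M a b] by simp

lemma v_div_eq: "v a = x \<Longrightarrow> v b = y \<Longrightarrow> v (Op Div a b) = x div y"
  using ev_div[OF good, of K a b] by simp

lemma v_mod_eq: "v a = x \<Longrightarrow> v b = y \<Longrightarrow> v (Op Mod a b) = x mod y"
  using ev_mod[OF good, of K a b] by simp

lemma v_sub_eq: "v a = x \<Longrightarrow> v b = y \<Longrightarrow> y \<le> x \<Longrightarrow> v (Op Sub a b) = x - y"
  using ev_sub[OF good, of K b a] by simp

lemma v_num: "x < 2 ^ w \<Longrightarrow> v (Num x) = x" by (rule ev_num)

lemma v_pow2: "v b = y \<Longrightarrow> y < w \<Longrightarrow> v (Op Shl (Num 1) b) = 2 ^ y"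
  using ev_pow2[OF good, of K b] by simp

lemma v_params: "v h_exp = h" "v T_exp = T" "v cap_exp = cap" "v s4_exp = 4 * s" "v E3_exp = E3"
proof -
  note s = Q_header(2)
  have c: "v (Num 6) = 6" "v (Num 4) = 4" "v (Num 1) = 1"
    using fits_word s_pos by (intro numeral_val; linarith)+
  show h: "v h_exp = h" unfolding h_exp_def h_def
    using s fits_word(6)[THEN small] by (intro v_mul_small) (auto simp: h_def)
  have 6: "v (Op Mul (Num 6) s_exp) = 6 * s" using c s fits_word(7)[THEN small] by (intro v_mul_small) auto
  have "v (Op Mul (Op Mul (Num 6) s_exp) h_exp) = 6 * s * h"
    using fits_word(5)[THEN small] by (intro v_mul_small[OF 6 h]) (simp add: T_def)
  then show T: "v T_exp = T" unfolding T_exp_def T_def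
    using c fits_word(5)[THEN small] by (intro v_add_small) (auto simp: T_def)
  show "v cap_exp = cap" unfolding cap_exp_def cap_def
    using T Q_header(1) T_less by (intro v_sub_eq) auto
  show s_powers: "v s4_exp = 4 * s" unfolding s4_exp_def using c s fits_word(3)[THEN small] by (intro v_mul_small) auto
  show "v E3_exp = E3" unfolding E3_exp_def E3_def by (rule v_div_eq[OF Q_header(1) s_powers])
qed

lemma v_3s: "v (Op Mul (Num 3) s_exp) = 3 * s"
  using numeral_val[of 3] fits_word s_pos Q_header(2) small[of "3 * s"] by (intro v_mul_small) auto

lemma three_s_less: "3 * s < w" using hdr_fits f_le_w s_pos by linarith

lemma v_j: "v j_exp = i mod B"
proof -
  have "v (Var 0) = i mod 2 ^ w" using K_pos by (simp add: ev.simps)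
  then have "v j_exp = i mod 2 ^ w mod 2 ^ (3 * s)"
    unfolding j_exp_def by (intro v_mod_eq v_pow2 v_3s three_s_less)
  also have "\<dots> = i mod B" unfolding B_def
    using three_s_less by (intro mod_mod_cancel le_imp_power_dvd) simp
  finally show ?thesis .
qed

lemma v_g: "v g_exp = g" and v_jj: "v jj_exp = j"
  unfolding g_exp_def jj_exp_def by (intro v_div_eq v_mod_eq v_j v_params)+

lemma vl_idx: "vl (idx K) = i"
  unfolding idx_def using i_less n_le by (intro val_map) (auto simp: ev.simps)

lemma idx_ne: "idx K \<noteq> []" using K_pos by (simp add: idx_def)

lemma d_less_w: "d < w" using d_le three_s_less by linarith

lemma rec_idx:
  assumes t: "t < 2 ^ d"
  shows "vl (rec_idx K d t) = k * 2 ^ d + t" "rec_idx K d t \<noteq> []"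
proof -
  let ?q = "i div 2 ^ (3 * s - d)" and ?P = "2 ^ d :: nat"
  let ?E = "Op Shl (Num 1) (Op Sub (Op Mul (Num 3) s_exp) (Num d))"
  have "v (Num d) = d" using d_less_w by (intro numeral_val) simp
  then have E: "v ?E = 2 ^ (3 * s - d)"
    using three_s_less d_le by (intro v_pow2 v_sub_eq v_3s) auto
  have "vl (shr ?E (idx K)) = ?q"
    using val_shr[OF good E, of "idx K"] three_s_less vl_idx by simp
  moreover obtain x zs where x: "shr ?E (idx K) = x # zs"
    using idx_ne length_shr[of ?E "idx K"] by (metis length_0_conv neq_Nil_conv)
  ultimately have q: "?q = v x + 2 ^ w * vl zs" by simp
  have w: "(2::nat) ^ w = ?P * 2 ^ (w - d)" using d_less_w by (simp flip: power_add)
  have P: "v (Num ?P) = ?P" using d_less_w by (intro v_num power_strict_increasing) auto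
  have tw: "v (Num t) = t" using t less_trans[OF t power_strict_increasing[OF d_less_w, of "2::nat"]] by (intro v_num) simp
  have sub: "v x - v x mod ?P = v x div ?P * ?P" by (simp add: minus_mod_eq_div_mult)
  have "v x div ?P < 2 ^ (w - d)" using ev_less[OF good, of K x] w by (simp add: less_mult_imp_div_less mult.commute)
  from mult_add_less[OF this t] have lt: "v x div ?P * ?P + t < 2 ^ w" unfolding w by (simp only: mult.commute)
  have s1: "v (Op Sub x (Op Mod x (Num ?P))) = v x div ?P * ?P"
    using v_sub_eq[OF refl v_mod_eq[OF refl P], of x x] unfolding sub by simp
  have s2: "v (Op Add (Op Sub x (Op Mod x (Num ?P))) (Num t)) = v x div ?P * ?P + t"
    by (rule v_add_small[OF s1 tw lt])
  have "?q div ?P = k" using d_le by (simp add: B_def flip: div_mult2_eq power_add)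
  moreover have "?q div ?P = v x div ?P + 2 ^ (w - d) * vl zs" unfolding q w by (simp add: mult.assoc)
  ultimately have "k * ?P + t = v x div ?P * ?P + t + 2 ^ w * vl zs" unfolding w by (simp add: algebra_simps)
  then show "vl (rec_idx K d t) = k * 2 ^ d + t"
    unfolding rec_idx_def x by (simp only: list.case val_simps s2)
  show "rec_idx K d t \<noteq> []" unfolding rec_idx_def x by simp
qed

lemma v_rd:
  assumes "vl z = Z" "z \<noteq> []"
  shows "v (rd_exp z) = slot e f M Z"
  unfolding rd_exp_def using ev_slot(2)[OF good v_E Q_header(1) slots_fit f_pos assms(2,1)] .

lemma v_flag: "v (flag_exp K d) = (if heavy k then 1 else 0)"
proof -
  have 2: "2 < (2::nat) ^ d" using d_ge by linarith
  show ?thesis unfolding flag_exp_def v_rd[OF rec_idx[OF 2]]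
    using static_slot[of "Flag k"] k_less by simp
qed

lemma vl_Z: "vl (Z_exps K d) = Zs k"
  unfolding Z_exps_def
proof (rule val_map)
  fix t assume t: "t < K"
  then have "3 + t < 2 ^ d" using d_ge by linarith
  from v_rd[OF rec_idx[OF this]] show "v (rd_exp (rec_idx K d (3 + t))) = Zs k div 2 ^ (w * t) mod 2 ^ w"
    using static_slot[of "Dig k t"] k_less t by simp
next
  show "Zs k < 2 ^ (w * K)" using Zs_mono[of k nsb] k_less Zmax_le by (simp add: Zmax_def)
qed

lemma vl_addl:
  assumes "v r = y" "Zs k + y < Zmax"
  shows "vl (addl (Z_exps K d) r) = Zs k + y" "addl (Z_exps K d) r \<noteq> []"
proof -
  have l: "length (Z_exps K d) = K" by (simp add: Z_exps_def)
  show "vl (addl (Z_exps K d) r) = Zs k + y"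
    using val_addl_exact[OF good, of K "Z_exps K d" r] assms Zmax_le unfolding vl_Z l by simp
  show "addl (Z_exps K d) r \<noteq> []" using l K_pos by auto
qed

lemma vl_ctr_idx:
  assumes "heavy k" "t < D"
  shows "vl (ctr_idx K d D t) = islot (Ctr k (i mod B) t)" "ctr_idx K d D t \<noteq> []"
proof -
  have v: "valid (Ctr k (i mod B) t)" using assms k_less B_pos by simp
  have "i mod B * D + t < B * D" by (rule mult_add_less) (use assms B_pos in auto)
  then have lt: "i mod B * D + t < 2 ^ w" using ctr_idx by linarith
  moreover have "D < 2 ^ w"
  proof -
    have "1 * D \<le> B * D" using B_pos by (intro mult_right_mono) auto
    then show ?thesis using ctr_idx by linarith
  qed
  ultimately have r: "v (Op Add (Op Mul j_exp (Num D)) (Num t)) = i mod B * D + t"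
    using assms(2) by (intro v_add_small v_mul_small v_j v_num) auto
  show "vl (ctr_idx K d D t) = islot (Ctr k (i mod B) t)" "ctr_idx K d D t \<noteq> []"
    unfolding ctr_idx_def using vl_addl[OF r] islot_less[OF v] by simp_all
qed

lemma v_ctr: "heavy k \<Longrightarrow> t < D \<Longrightarrow> v (rd_exp (ctr_idx K d D t)) = content M (Ctr k (i mod B) t)"
  using v_rd[OF vl_ctr_idx] full_content[of "Ctr k (i mod B) t"] by simp

lemma v_ptr: assumes "\<not> heavy k" shows "v (ptr_exp K d) = vpos k g"
proof -
  have vp: "valid (Ptr k g)" using assms k_less g_less by simp
  have lt: "ioff (Ptr k g) + 4 * s \<le> f" using ifit[OF vp] by simp
  have "v (Op Mul (Op Mod g_exp E3_exp) s4_exp) = g mod E3 * (4 * s)"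
    using lt fits_word(8) by (intro v_mul_small v_mod_eq v_g v_params small) auto
  moreover have "v (rd_exp (addl (Z_exps K d) (Op Div g_exp E3_exp))) = slot e f M (islot (Ptr k g))"
  proof -
    have "v (Op Div g_exp E3_exp) = g div E3" by (intro v_div_eq v_g v_params)
    from v_rd[OF vl_addl[OF this]] islot_less[OF vp] show ?thesis by simp
  qed
  ultimately have "v (ptr_exp K d) = content M (Ptr k g)"
    unfolding ptr_exp_def content_def using lt f_le_w s_pos fits_word(3)
    by (subst ev_fld_exp[OF good]) (simp_all add: v_params)
  then show ?thesis using fixed vp by (simp add: fixed_def)
qed

context
  assumes light: "\<not> heavy k"
begin

abbreviation "x \<equiv> Grp k g"

lemma valid_grp: "valid x" using light k_less g_less by simp

lemma vl_grp_idx: "vl (grp_idx K d) = islot x" "grp_idx K d \<noteq> []"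
proof -
  have "v (Op Div (ptr_exp K d) cap_exp) = vpos k g div cap" by (intro v_div_eq v_ptr light v_params)
  from vl_addl[OF this] islot_less[OF valid_grp]
  show "vl (grp_idx K d) = islot x" "grp_idx K d \<noteq> []" by (simp_all add: grp_idx_def)
qed

lemma v_off: "v (off_exp K d) = ioff x"
  unfolding off_exp_def by (simp add: v_mod_eq[OF v_ptr[OF light] v_params(3)])

lemma off_le: "ioff x + T \<le> f"
proof -
  have "vpos k g mod cap < cap" using cap_pos by simp
  moreover have "cap + T = f" using T_less by (simp add: cap_def)
  ultimately show ?thesis by simp
qed

definition "win = fld (slot e f M (islot x)) (ioff x) T"

lemma v_win: "v (win_exp K d) = win"
proof -
  have "T \<ge> 1" by (simp add: T_def)
  then have "ioff x < w" using off_le f_le_w by linarith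
  then show ?thesis unfolding win_exp_def win_def using fits_word(5)
    by (subst ev_fld_exp[OF good]) (simp_all only: v_off v_params v_rd[OF vl_grp_idx])
qed

lemma v_tbl: "v (tbl_exp K d) = table (6 * s) h T win j"
proof -
  have W: "win < 2 ^ T" by (simp add: win_def fld_less)
  \<comment> \<open>By \<open>tab_idx\<close> all table entries have slot numbers below 2^w, so the
    index is a single word and is computed by ordinary word operations.\<close>
  have "(2 ^ T * h) * 2 ^ d \<le> (2 ^ T * 2 ^ (2 * s)) * 2 ^ d" using h_le by simp
  also have "\<dots> \<le> 2 ^ w" unfolding power_add[symmetric] using tab_idx by (intro power_increasing) auto
  finally have "(2 ^ T * h) * 2 ^ d \<le> 2 ^ w" .
  moreover have one: "1 < (2::nat) ^ d" using d_ge by linarith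
  moreover have "(win * h + j) * 2 ^ d + 1 < (2 ^ T * h) * 2 ^ d"
    by (rule mult_add_less[OF mult_add_less[OF W j_less] one])
  ultimately have lt: "(win * h + j) * 2 ^ d + 1 < 2 ^ w" by linarith
  have "win * h + j \<le> (win * h + j) * 2 ^ d" by simp
  then have lt2: "win * h + j < 2 ^ w" using lt by linarith
  have "v (Op Add (Op Mul (Op Add (Op Mul (win_exp K d) h_exp) jj_exp) (Num (2 ^ d))) (Num 1)) = (win * h + j) * 2 ^ d + 1"
    using lt lt2 d_less_w
    by (intro v_add_small v_mul_small v_win v_params v_jj v_num) (auto intro: power_strict_increasing less_imp_le)
  then have "vl [Op Add (Op Mul (Op Add (Op Mul (win_exp K d) h_exp) jj_exp) (Num (2 ^ d))) (Num 1)] = islot (Tbl win j)"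
    by (simp only: val_simps islot.simps mult_0_right add_0_right)
  from v_rd[OF this] show ?thesis unfolding tbl_exp_def using static_slot[of "Tbl win j"] W j_less by simp
qed

end
end

subsection \<open>The update programs\<close>

text \<open>
  Digit t changes iff all lower digits are 0, and these are still unchanged when the digits are
  processed from the top down.
\<close>

definition "big_stores K d D b = map (ctr_store K d D b) (rev [0..<D]) @ [grp_store K d b]"

lemma do_store_Ite:
  assumes "good w R M" "ev c w R M b = (if P then 1 else 0)"
  shows "do_store c w R (z, Ite b y (Ld z)) M = (if P then M(val c w R M z := ev c w R M y) else M)"
  using ev_Ite[OF assms] by (simp add: do_store_def val_def ev.simps(4))

lemma ev_Conj_0: "ev c w R M b = 0 \<Longrightarrow> ev c w R M (Conj b x) = 0"
  by (simp add: Conj_def ev.simps(3))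

lemma big_stores_inactive:
  assumes "good w R M" "\<And>M. ev K w R M b = 0"
  shows "fold (do_store K w R) (big_stores K d D b) M = M"
proof -
  have 1: "do_store K w R (ctr_store K d D b t) M = M" for t
    unfolding ctr_store_def using do_store_Ite[OF assms(1), where P = False] ev_Conj_0 assms(2) by simp
  have "fold (do_store K w R) (map (ctr_store K d D b) ts) M = M" for ts
    by (induction ts) (simp_all add: 1)
  moreover have "do_store K w R (grp_store K d b) M = M"
    unfolding grp_store_def using do_store_Ite[OF assms(1), where P = False] ev_Conj_0 assms(2) by simp
  ultimately show ?thesis by (simp add: big_stores_def)
qed

lemma unchanged_beyond_trans:
  "unchanged_beyond w S M M' \<Longrightarrow> unchanged_beyond w S M' M'' \<Longrightarrow> unchanged_beyond w S M M''"
  by (simp add: unchanged_beyond_def)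

context loaded
begin

lemma get_i: "represents ys M \<Longrightarrow> get ys i = ys ! i"
  using i_less by (simp add: get_def represents_def)

lemma decodes_win:
  assumes "represents ys M" "\<not> heavy k"
  obtains cw where "decodes (6 * s) h T win (cw, grp ys (k * NG + g))" "length cw = glen (k * NG + g)"
proof -
  have "coded ys M k g" using assms k_less g_less by (simp add: represents_def)
  then obtain cw where cw: "group_code (6 * s) (grp ys (k * NG + g)) cw" "length cw = glen (k * NG + g)"
     "content M (Grp k g) = num cw" unfolding coded_def by blast
  have "fld win 0 (length cw) = num cw"
    using cw glen_le[of "k * NG + g"] assms(2) by (simp add: win_def fld_fld content_def)
  then show ?thesis using that[of cw] cw glen_le[of "k * NG + g"] by (simp add: decodes_def)
qed

lemma grp_nth: "represents ys M \<Longrightarrow> grp ys (k * NG + g) ! j = ys ! i"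
  using get_i j_less i_eq by (simp add: grp_def)

lemma v_big_zero:
  assumes "represents ys M"
  shows "v (big_zero K d D) = (if ys ! i = 0 then 1 else 0)"
proof (cases "heavy k")
  case True
  have "ctr M k (i mod B) = ys ! i"
    using assms True k_less B_pos get_i[OF assms] by (simp add: represents_def)
  then have c: "(\<Sum>t<D. content M (Ctr k (i mod B) t) * (2 ^ f) ^ t) = ys ! i" by (simp add: ctr_def)
  have "(\<Sum>t<D. content M (Ctr k (i mod B) t) * (2 ^ f) ^ t) = 0 \<longleftrightarrow> (\<forall>t<D. content M (Ctr k (i mod B) t) = 0)"
    by (rule sum_digits_zero_iff) simp
  then have "ys ! i = 0 \<longleftrightarrow> (\<forall>t<D. content M (Ctr k (i mod B) t) = 0)" unfolding c .
  then show ?thesis unfolding big_zero_def using ev_Ite[OF good v_flag] True ev_all_zero[OF good] v_ctr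
    by auto
next
  case False
  obtain cw where cw: "decodes (6 * s) h T win (cw, grp ys (k * NG + g))" by (rule decodes_win[OF assms False])
  have W: "win < 2 ^ T" using False by (simp add: win_def fld_less)
  have "v (Op Shl (Num 1) T_exp) = 2 ^ T" using T_less f_le_w by (intro v_pow2 v_params) simp
  moreover have "table (6 * s) h T win j = 2 ^ T \<longleftrightarrow> ys ! i = 0"
    using table_eq[OF cw j_less] table_step_less[OF W cw j_less] grp_nth[OF assms] by auto
  ultimately have "v (Op Equal (tbl_exp K d) (Op Shl (Num 1) T_exp)) = (if ys ! i = 0 then 1 else 0)"
    using ev_eq[OF good] v_tbl[OF False] by simp
  then show ?thesis unfolding big_zero_def using ev_Ite[OF good v_flag] False by simp
qed

lemma do_ctr_store:
  assumes b: "v b = 1" and t: "t < D"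
  shows "do_store K w (digits w i) (ctr_store K d D b t) M =
    (if heavy k \<and> (\<forall>u<t. content M (Ctr k (i mod B) u) = 0)
     then put (Ctr k (i mod B) t) ((content M (Ctr k (i mod B) t) + 2 ^ f - 1) mod 2 ^ f) M else M)"
proof (cases "heavy k")
  case False
  have "v (Conj b (Conj (flag_exp K d) (all_zero (\<lambda>t. rd_exp (ctr_idx K d D t)) t))) = (if True \<and> False then 1 else 0)"
    by (intro ev_Conj good) (use b v_flag False ev_Conj_0 in auto)
  then show ?thesis unfolding ctr_store_def using do_store_Ite[OF good, where P = False] False by simp
next
  case True
  let ?x = "Ctr k (i mod B) t"
  let ?c = "content M ?x"
  let ?P = "\<forall>u<t. content M (Ctr k (i mod B) u) = 0"
  have "v (all_zero (\<lambda>t. rd_exp (ctr_idx K d D t)) t) = (if ?P then 1 else 0)"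
    using ev_all_zero[OF good] v_ctr[OF True] t by auto
  then have "v (Conj (flag_exp K d) (all_zero (\<lambda>t. rd_exp (ctr_idx K d D t)) t)) = (if True \<and> ?P then 1 else 0)"
    by (intro ev_Conj good) (use v_flag True in simp_all)
  then have "v (Conj b (Conj (flag_exp K d) (all_zero (\<lambda>t. rd_exp (ctr_idx K d D t)) t))) = (if True \<and> (True \<and> ?P) then 1 else 0)"
    by (rule ev_Conj[OF good, rotated]) (use b in simp_all)
  then have v: "v (Conj b (Conj (flag_exp K d) (all_zero (\<lambda>t. rd_exp (ctr_idx K d D t)) t))) = (if ?P then 1 else 0)"
    by (simp only: simp_thms)
  have 1: "do_store K w (digits w i) (ctr_store K d D b t) M = (if ?P
     then M(vl (shr E_exp (ctr_idx K d D t)) := v (wr_exp (ctr_idx K d D t)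
        (Op Mod (Op Sub (rd_exp (ctr_idx K d D t)) (Num 1)) (Op Shl (Num 1) f_exp)))) else M)"
    unfolding ctr_store_def by (rule do_store_Ite[OF good v])
  note ix = vl_ctr_idx[OF True t]
  have a: "vl (shr E_exp (ctr_idx K d D t)) = iword ?x"
    using val_shr[OF good v_E e_less_w] ix(1) by (simp add: iword_def)
  have "v (Op Sub (rd_exp (ctr_idx K d D t)) (Num 1)) = (?c + 2 ^ w - 1) mod 2 ^ w"
    using v_ctr[OF True t] v_num[OF good_pow[OF good]] by (simp add: ev.simps(3))
  moreover have "v (Op Mod (Op Sub (rd_exp (ctr_idx K d D t)) (Num 1)) (Op Shl (Num 1) f_exp)) =
      v (Op Sub (rd_exp (ctr_idx K d D t)) (Num 1)) mod 2 ^ f"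
    using ev_mod_pow2[OF good, of K f_exp] Q_header(1) f_le_w by simp
  ultimately have "v (Op Mod (Op Sub (rd_exp (ctr_idx K d D t)) (Num 1)) (Op Shl (Num 1) f_exp)) =
      (?c + 2 ^ w - 1) mod 2 ^ w mod 2 ^ f" by simp
  \<comment> \<open>The subtraction wraps around modulo 2^w, which is consistent with the slot
    because 2^f divides 2^w.\<close>
  also have "\<dots> = (?c + 2 ^ w - 1) mod 2 ^ f"
    using f_le_w by (intro mod_mod_cancel le_imp_power_dvd)
  also have "?c + 2 ^ w - 1 = (?c + 2 ^ f - 1) + (2 ^ (w - f) - 1) * 2 ^ f"
  proof -
    have "(2::nat) ^ w = 2 ^ (w - f) * 2 ^ f" using f_le_w by (simp flip: power_add)
    then have "(2 ^ (w - f) - 1) * 2 ^ f + 2 ^ f = (2::nat) ^ w" by (simp add: diff_mult_distrib)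
    moreover have "1 \<le> (2::nat) ^ f" by simp
    ultimately show ?thesis by linarith
  qed
  also have "\<dots> mod 2 ^ f = (?c + 2 ^ f - 1) mod 2 ^ f" by simp
  finally have y: "v (Op Mod (Op Sub (rd_exp (ctr_idx K d D t)) (Num 1)) (Op Shl (Num 1) f_exp)) = (?c + 2 ^ f - 1) mod 2 ^ f" .
  have "v (wr_exp (ctr_idx K d D t) (Op Mod (Op Sub (rd_exp (ctr_idx K d D t)) (Num 1)) (Op Shl (Num 1) f_exp))) =
     fld_upd (M (iword ?x)) (ipos ?x) f ((?c + 2 ^ f - 1) mod 2 ^ f)"
  proof -
    have "v (Op Mod (Op Sub (rd_exp (ctr_idx K d D t)) (Num 1)) (Op Shl (Num 1) f_exp)) < 2 ^ f"
      unfolding y by simp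
    from ev_slot(3)[OF good v_E Q_header(1) slots_fit f_pos ix(2,1) this]
    show ?thesis unfolding wr_exp_def y iword_def by (simp only: ipos_def ioff.simps add_0_right)
  qed
  then show ?thesis unfolding 1 a put_def using True by auto
qed

lemma do_grp_store_heavy:
  assumes b: "v b = 1" and "heavy k"
  shows "do_store K w (digits w i) (grp_store K d b) M = M"
proof -
  have "v (Op Equal (flag_exp K d) (Num 0)) = (if False then 1 else 0)"
    using ev_eq[OF good] v_flag assms(2) v_num[of 0] by simp
  then have "v (Conj b (Op Equal (flag_exp K d) (Num 0))) = (if True \<and> False then 1 else 0)"
    by (intro ev_Conj good) (use b in simp_all)
  then show ?thesis unfolding grp_store_def using do_store_Ite[OF good, where P = False] by simp
qed

lemma do_grp_store_light:
  assumes b: "v b = 1" and light: "\<not> heavy k" and rep: "represents ys M" and nz: "ys ! i \<noteq> 0"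
  obtains cw where "do_store K w (digits w i) (grp_store K d b) M = put (Grp k g) (num cw) M"
    "group_code (6 * s) ((grp ys (k * NG + g))[j := ys ! i - 1]) cw" "length cw = glen (k * NG + g)"
proof -
  let ?x = "Grp k g"
  obtain cw where cw: "decodes (6 * s) h T win (cw, grp ys (k * NG + g))" "length cw = glen (k * NG + g)"
    by (rule decodes_win[OF rep light])
  define cw' where "cw' = next_code (6 * s) (grp ys (k * NG + g)) j (length cw)"
  have nz': "grp ys (k * NG + g) ! j \<noteq> 0" using grp_nth[OF rep] nz by simp
  have gc: "group_code (6 * s) (grp ys (k * NG + g)) cw" using cw by (simp add: decodes_def)
  have jl: "j < length (grp ys (k * NG + g))" using j_less by simp
  have cw': "group_code (6 * s) ((grp ys (k * NG + g))[j := ys ! i - 1]) cw'" "length cw' = glen (k * NG + g)"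
    using next_code[OF gc jl nz'] grp_nth[OF rep] cw(2) by (simp_all add: cw'_def)
  have W: "win < 2 ^ T" using light by (simp add: win_def fld_less)
  have tb: "table (6 * s) h T win j = fld_upd win 0 (glen (k * NG + g)) (num cw')"
    using table_eq[OF cw(1) j_less] nz' cw(2) by (simp add: cw'_def)
  have tl: "table (6 * s) h T win j < 2 ^ T" by (rule table_step_less[OF W cw(1) j_less nz'])
  have "v (Op Equal (flag_exp K d) (Num 0)) = (if True then 1 else 0)"
    using ev_eq[OF good] v_flag light v_num[of 0] by simp
  then have "v (Conj b (Op Equal (flag_exp K d) (Num 0))) = (if True \<and> True then 1 else 0)"
    by (intro ev_Conj good) (use b in simp_all)
  then have 1: "do_store K w (digits w i) (grp_store K d b) M = M(vl (shr E_exp (grp_idx K d)) :=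
      v (wr_exp (grp_idx K d) (upd_exp (rd_exp (grp_idx K d)) (off_exp K d) (win_exp K d) (tbl_exp K d))))"
    unfolding grp_store_def using do_store_Ite[OF good, where P = True] by simp
  note ix = vl_grp_idx[OF light]
  have a: "vl (shr E_exp (grp_idx K d)) = iword ?x"
    using val_shr[OF good v_E e_less_w] ix(1) by (simp add: iword_def)
  let ?X = "slot e f M (islot ?x)"
  have rd: "v (rd_exp (grp_idx K d)) = ?X" by (rule v_rd[OF ix])
  have off: "v (off_exp K d) = ioff ?x" by (rule v_off[OF light])
  have ol: "ioff ?x + T \<le> f" by (rule off_le[OF light])
  have T1: "1 \<le> T" by (simp add: T_def)
  have u: "v (upd_exp (rd_exp (grp_idx K d)) (off_exp K d) (win_exp K d) (tbl_exp K d)) =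
     fld_upd ?X (ioff ?x) T (table (6 * s) h T win j)"
  proof -
    have "v (off_exp K d) < w" "v (off_exp K d) + T \<le> w" using off ol f_le_w T1 by linarith+
    moreover have "v (win_exp K d) = fld (v (rd_exp (grp_idx K d))) (v (off_exp K d)) T"
      using v_win[OF light] by (simp only: win_def[OF light] rd off)
    moreover have "v (tbl_exp K d) < 2 ^ T" using v_tbl[OF light] tl by simp
    ultimately have "v (upd_exp (rd_exp (grp_idx K d)) (off_exp K d) (win_exp K d) (tbl_exp K d)) =
        fld_upd (v (rd_exp (grp_idx K d))) (v (off_exp K d)) T (v (tbl_exp K d))"
      by (intro ev_upd_exp[OF good])
    then show ?thesis by (simp only: rd off v_tbl[OF light])
  qed
  have nl: "num cw' < 2 ^ glen (k * NG + g)" using num_less[of cw'] cw'(2) by simp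
  \<comment> \<open>The program overwrites the whole window of T bits. As the table entry preserves
    what follows the code word, only the field of the group changes.\<close>
  have u2: "fld_upd ?X (ioff ?x) T (table (6 * s) h T win j) = fld_upd ?X (ioff ?x) (glen (k * NG + g)) (num cw')"
    unfolding tb unfolding win_def[OF light]
    using fld_fld_upd_nested[of 0 "glen (k * NG + g)" T "num cw'" ?X "ioff ?x"] glen_le nl
    by simp
  have ft: "ioff ?x + iwid ?x \<le> f" by (rule ifit[OF valid_grp[OF light]])
  have lt: "fld_upd ?X (ioff ?x) (glen (k * NG + g)) (num cw') < 2 ^ f"
    by (rule fld_upd_less) (use ft nl in \<open>simp_all add: slot_def fld_less\<close>)
  have "v (wr_exp (grp_idx K d) (upd_exp (rd_exp (grp_idx K d)) (off_exp K d) (win_exp K d) (tbl_exp K d))) =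
     fld_upd (M (iword ?x)) (islot ?x mod 2 ^ e * f) f (fld_upd ?X (ioff ?x) (glen (k * NG + g)) (num cw'))"
    unfolding wr_exp_def
    by (subst ev_slot(3)[OF good v_E Q_header(1) slots_fit f_pos ix(2,1)]) (simp_all only: u u2 lt iword_def)
  also have "\<dots> = fld_upd (M (iword ?x)) (ipos ?x) (glen (k * NG + g)) (num cw')"
    using fld_fld_upd_nested[of "ioff ?x" "glen (k * NG + g)" f "num cw'" "M (iword ?x)" "islot ?x mod 2 ^ e * f"] ft nl
    by (simp add: slot_def iword_def ipos_def)
  finally show ?thesis using that[of cw'] cw' 1 a by (simp add: put_def)
qed

end

context valid_layout
begin

lemma loaded: "represents ys M \<Longrightarrow> is_memory w M \<Longrightarrow> i < length xs \<Longrightarrow> loaded w e f s K D d xs M i"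
  by unfold_locales (simp_all add: represents_def)

lemma big_stores_correct:
  assumes rep: "represents ys M" and mem: "is_memory w M" and i: "i < length xs"
    and nz: "ys ! i \<noteq> 0" and b: "\<And>M. is_memory w M \<Longrightarrow> ev K w (digits w i) M b = 1"
  defines "M' \<equiv> fold (do_store K w (digits w i)) (big_stores K d D b) M"
  shows "is_memory w M'" "unchanged_beyond w S M M'" "represents (ys[i := ys ! i - 1]) M'"
proof -
  interpret l: loaded w e f s K D d xs M i by (rule loaded[OF rep mem i])
  let ?j = "i mod B"
  \<comment> \<open>The memory after the digits from D - 1 down to \<tau> have been
    processed.\<close>
  define N where "N \<tau> = fold (do_store K w (digits w i)) (map (ctr_store K d D b) (rev [\<tau>..<D])) M" for \<tau>
  have M': "M' = do_store K w (digits w i) (grp_store K d b) (N 0)"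
    by (simp add: M'_def N_def big_stores_def)
  have N_Suc: "N \<tau> = do_store K w (digits w i) (ctr_store K d D b \<tau>) (N (Suc \<tau>))" if "\<tau> < D" for \<tau>
    using that by (simp add: N_def upt_conv_Cons)
  have len: "i < length ys" using rep i by (simp add: represents_def)
  show "is_memory w M'" "unchanged_beyond w S M M'" "represents (ys[i := ys ! i - 1]) M'"
  proof (atomize(full), cases "heavy l.k")
    case False
    have "N \<tau> = M" if "\<tau> \<le> D" for \<tau>
      using that
    proof (induction rule: inc_induct)
      case (step \<tau>)
      then show ?case using N_Suc[of \<tau>] l.do_ctr_store[OF b[OF mem]] False by simp
    qed (simp add: N_def)
    then have M'2: "M' = do_store K w (digits w i) (grp_store K d b) M" unfolding M' by simp
    obtain cw where cw: "do_store K w (digits w i) (grp_store K d b) M = put (Grp l.k l.g) (num cw) M"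
      "group_code (6 * s) ((grp ys (l.k * NG + l.g))[l.j := ys ! i - 1]) cw" "length cw = glen (l.k * NG + l.g)"
      by (rule l.do_grp_store_light[OF b[OF mem] False rep nz])
    have u: "num cw < 2 ^ iwid (Grp l.k l.g)" using num_less[of cw] cw(3) by simp
    have v: "valid (Grp l.k l.g)" by (rule l.valid_grp[OF False])
    show "is_memory w M' \<and> unchanged_beyond w S M M' \<and> represents (ys[i := ys ! i - 1]) M'"
      unfolding M'2 cw(1) using put_memory[OF v u mem] put_beyond[OF v u]
        represents_put_grp[OF rep l.k_less False l.g_less l.j_less l.i_eq len cw(2,3)] by simp
  next
    case True
    define \<delta> where "\<delta> t = content M (Ctr l.k ?j t)" for t
    have dl: "\<delta> t < 2 ^ f" for t by (simp add: \<delta>_def content_def fld_less)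
    have v: "valid (Ctr l.k ?j t)" if "t < D" for t using that True l.k_less l.B_pos by simp
    have inv: "is_memory w (N \<tau>) \<and> unchanged_beyond w S M (N \<tau>) \<and>
       (\<forall>x. valid x \<and> (\<forall>t\<ge>\<tau>. x \<noteq> Ctr l.k ?j t) \<longrightarrow> content (N \<tau>) x = content M x) \<and>
       (\<forall>t. \<tau> \<le> t \<and> t < D \<longrightarrow> content (N \<tau>) (Ctr l.k ?j t) = dec_digit (2 ^ f) \<delta> t)" if "\<tau> \<le> D" for \<tau>
      using that
    proof (induction rule: inc_induct)
      case base
      show ?case using mem by (simp add: N_def unchanged_beyond_def)
    next
      case (step \<tau>)
      let ?N = "N (Suc \<tau>)" and ?x = "Ctr l.k ?j \<tau>"
      have IH: "is_memory w ?N" "unchanged_beyond w S M ?N"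
        "\<And>x. valid x \<Longrightarrow> \<forall>t\<ge>Suc \<tau>. x \<noteq> Ctr l.k ?j t \<Longrightarrow> content ?N x = content M x"
        "\<And>t. Suc \<tau> \<le> t \<Longrightarrow> t < D \<Longrightarrow> content ?N (Ctr l.k ?j t) = dec_digit (2 ^ f) \<delta> t"
        using step.IH by auto
      have "content ?N x = content M x" if "valid x" "static x" for x
        using that by (intro IH(3)) auto
      then have "fixed ?N" using rep fixed_eq[of M ?N] by (auto simp: represents_def)
      then interpret n: loaded w e f s K D d xs ?N i
        using IH(1) i by unfold_locales
      have c: "content ?N (Ctr l.k ?j u) = \<delta> u" if "u \<le> \<tau>" for u
        using that step.hyps v[of u] by (simp add: \<delta>_def IH(3))
      define u where "u = dec_digit (2 ^ f) \<delta> \<tau>"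
      have u: "u < 2 ^ iwid ?x" using dec_digit_less[of \<delta> \<tau> "2 ^ f"] dl by (simp add: u_def)
      have vx: "valid ?x" using v step.hyps by simp
      \<comment> \<open>If a lower digit is nonzero, then nothing is written, and
        \<open>dec_digit\<close> gives the old digit.\<close>
      have N: "N \<tau> = put ?x u ?N \<or> (N \<tau> = ?N \<and> u = content ?N ?x)"
        using n.do_ctr_store[OF b[OF IH(1)] step.hyps(2)] N_Suc[OF step.hyps(2)] True c
        by (auto simp: u_def dec_digit_def)
      then show ?case
      proof
        assume N: "N \<tau> = put ?x u ?N"
        have "content (N \<tau>) x = content M x" if "valid x" "\<forall>t\<ge>\<tau>. x \<noteq> Ctr l.k ?j t" for x
        proof -
          have "?x \<noteq> x" using that(2) by blast
          then have "content (N \<tau>) x = content ?N x" unfolding N using content_put_other[OF vx that(1) _ u] by simp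
          then show ?thesis using IH(3)[OF that(1)] that(2) by simp
        qed
        moreover have "content (N \<tau>) (Ctr l.k ?j t) = dec_digit (2 ^ f) \<delta> t" if "\<tau> \<le> t" "t < D" for t
        proof (cases "t = \<tau>")
          case True
          then show ?thesis unfolding N using content_put_same[OF vx u] by (simp add: u_def)
        next
          case False
          then show ?thesis unfolding N
            using content_put_other[OF vx v[OF that(2)] _ u, of ?N] IH(4)[of t] that by simp
        qed
        moreover have "is_memory w (N \<tau>)" unfolding N by (rule put_memory[OF vx u IH(1)])
        moreover have "unchanged_beyond w S M (N \<tau>)" unfolding N
          by (rule unchanged_beyond_trans[OF IH(2) put_beyond[OF vx u]])
        ultimately show ?thesis by blast
      next
        assume N: "N \<tau> = ?N \<and> u = content ?N ?x"
        have "content ?N (Ctr l.k ?j t) = dec_digit (2 ^ f) \<delta> t" if "\<tau> \<le> t" "t < D" for t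
          using IH(4)[of t] that N by (cases "t = \<tau>") (auto simp: u_def)
        moreover have "content ?N x = content M x" if "valid x" "\<forall>t\<ge>\<tau>. x \<noteq> Ctr l.k ?j t" for x
          using IH(3)[OF that(1)] that(2) by simp
        ultimately show ?thesis using IH(1,2) N by auto
      qed
    qed
    have I: "is_memory w (N 0)" "unchanged_beyond w S M (N 0)"
      "\<And>x. valid x \<Longrightarrow> \<forall>t. x \<noteq> Ctr l.k ?j t \<Longrightarrow> content (N 0) x = content M x"
      "\<And>t. t < D \<Longrightarrow> content (N 0) (Ctr l.k ?j t) = dec_digit (2 ^ f) \<delta> t"
      using inv[of 0] by auto
    have "ctr M l.k ?j = ys ! i"
      using rep True l.k_less l.B_pos l.get_i[OF rep] by (simp add: represents_def)
    then have sd: "(\<Sum>t<D. \<delta> t * (2 ^ f) ^ t) = ys ! i" by (simp add: ctr_def \<delta>_def)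
    have "ctr (N 0) l.k ?j = (\<Sum>t<D. dec_digit (2 ^ f) \<delta> t * (2 ^ f) ^ t)"
      unfolding ctr_def using I(4) by (intro sum.cong) auto
    also have "\<dots> = ys ! i - 1"
      using sum_dec_digit_pos[of D \<delta> "2 ^ f"] dl nz unfolding sd by simp
    finally have y: "ctr (N 0) l.k ?j = ys ! i - 1" .
    have "i = l.k * B + ?j" by simp
    then have rep': "represents (ys[i := ys ! i - 1]) (N 0)"
      using l.B_pos by (intro represents_put_ctr[OF rep l.k_less True _ _ len I(3) y]) simp_all
    interpret n: loaded w e f s K D d xs "N 0" i by (rule loaded[OF rep' I(1) i])
    have "M' = N 0" unfolding M' by (rule n.do_grp_store_heavy[OF b[OF I(1)] True])
    then show "is_memory w M' \<and> unchanged_beyond w S M M' \<and> represents (ys[i := ys ! i - 1]) M'"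
      using I(1,2) rep' by simp
  qed
qed

end

subsection \<open>Correctness of both programs\<close>

text \<open>A bit string represents ys iff every memory that extends it satisfies \<open>P\<close>,
  so arbitrary contents beyond \<open>S\<close> are covered. By \<open>cong\<close>, one such memory
  is enough.\<close>

lemma decrement_structureI:
  fixes P :: "nat list \<Rightarrow> (nat \<Rightarrow> nat) \<Rightarrow> bool"
  assumes init: "\<exists>M. is_memory w M \<and> P xs M"
    and cong: "\<And>ys M M'. is_memory w M \<Longrightarrow> is_memory w M' \<Longrightarrow> \<forall>j<S. mem_bit w M j = mem_bit w M' j \<Longrightarrow> P ys M \<Longrightarrow> P ys M'"
    and zero: "\<And>ys M i. P ys M \<Longrightarrow> is_memory w M \<Longrightarrow> i < length ys \<Longrightarrow>
      (let s = run w zp T (start w i M)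
       in halted zp s \<and> regs s 0 = (if ys ! i = 0 then 1 else 0) \<and> mem s = M)"
    and dec: "\<And>ys M i. P ys M \<Longrightarrow> is_memory w M \<Longrightarrow> i < length ys \<Longrightarrow> ys ! i \<noteq> 0 \<Longrightarrow>
      (let s = run w dp T (start w i M)
       in halted dp s \<and> is_memory w (mem s) \<and> unchanged_beyond w S M (mem s) \<and> P (ys[i := ys ! i - 1]) (mem s))"
  shows "decrement_structure w zp dp T S xs"
proof -
  define Rep where "Rep ys = {B. length B = S \<and> (\<forall>M. is_memory w M \<longrightarrow> stored w B M \<longrightarrow> P ys M)}" for ys
  have bits: "map (mem_bit w M) [0..<S] \<in> Rep ys" if "is_memory w M" "P ys M" for ys M
    unfolding Rep_def using cong[OF that(1) _ _ that(2)] by (auto simp: stored_def)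
  have st: "stored w (map (mem_bit w M) [0..<S]) M" for M by (simp add: stored_def)
  have tz: "tests_zero w zp T ys B i" if "B \<in> Rep ys" "i < length ys" for ys B i
    unfolding tests_zero_def using that zero by (auto simp: Rep_def)
  have td: "transforms w dp T B (Rep (ys[i := ys ! i - 1])) i"
    if B: "B \<in> Rep ys" and i: "i < length ys" and nz: "ys ! i \<noteq> 0" for ys B i
    unfolding transforms_def
  proof (intro allI impI)
    fix M assume M: "is_memory w M \<and> stored w B M"
    have P: "P ys M" and l: "length B = S" using B M by (auto simp: Rep_def)
    note r = dec[OF P conjunct1[OF M] i nz, unfolded Let_def]
    show "let s = run w dp T (start w i M) in halted dp s \<and> unchanged_beyond w (length B) M (mem s) \<and>
        (\<exists>B'\<in>Rep (ys[i := ys ! i - 1]). stored w B' (mem s))"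
      unfolding Let_def l using r bits[of "mem (run w dp T (start w i M))"] st by blast
  qed
  have "Rep xs \<noteq> {}" using init bits by blast
  moreover have "length B = S" if "B \<in> Rep ys" for B ys using that by (simp add: Rep_def)
  ultimately show ?thesis unfolding decrement_structure_def using tz td by (intro exI[of _ Rep]) blast
qed

section \<open>Short words, and the combination with long ones\<close>

text \<open>The constant 2^(w0 - 1) overflows to 0 iff w < w0.\<close>

definition "small_exp w0 = Op Equal (Num (2 ^ (w0 - 1))) (Num 0)"
definition "large_exp w0 = Op Equal (small_exp w0) (Num 0)"
text \<open>The address consists of the words of i, then t zeros, then a 1, so it needs no
  arithmetic, and different pairs (i, t) get different cells. The scattering over memory is
  affordable since w is bounded here.\<close>

definition "cell_idx K t = idx K @ replicate t (Num 0) @ [Num 1]"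
definition "cell_zero K = all_zero (\<lambda>t. Ld (cell_idx K t))"
definition "cell_store K w0 t = (cell_idx K t, Ite (Conj (small_exp w0) (cell_zero K t))
  (Op Sub (Ld (cell_idx K t)) (Num 1)) (Ld (cell_idx K t)))"
definition "zero_exp K d D a w0 = Ite (small_exp w0) (cell_zero K a) (big_zero K d D)"
text \<open>The same program serves short and long words: the stores of the inactive case write back
  what they find.\<close>

definition "dec_stores K d D a w0 =
  big_stores K d D (large_exp w0) @ map (cell_store K w0) (rev [0..<a])"

lemma ev_small:
  assumes "good w R M" "1 \<le> w0"
  shows "ev c w R M (small_exp w0) = (if w < w0 then 1 else 0)"
    and "ev c w R M (large_exp w0) = (if w < w0 then 0 else 1)"
proof -
  have "(2::nat) ^ (w0 - 1) mod 2 ^ w = 0 \<longleftrightarrow> w < w0"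
  proof (cases "w < w0")
    case True
    then have "(2::nat) ^ w dvd 2 ^ (w0 - 1)" by (intro le_imp_power_dvd) simp
    then show ?thesis using True by (simp add: dvd_eq_mod_eq_0)
  next
    case False
    then have "(2::nat) ^ (w0 - 1) < 2 ^ w" using assms(2) by (intro power_strict_increasing) auto
    then show ?thesis using False by simp
  qed
  then show 1: "ev c w R M (small_exp w0) = (if w < w0 then 1 else 0)"
    unfolding small_exp_def by (simp only: ev_eq[OF assms(1)] ev.simps(2) mod_0)
  show "ev c w R M (large_exp w0) = (if w < w0 then 0 else 1)"
    unfolding large_exp_def by (simp only: ev_eq[OF assms(1)] 1 ev.simps(2) mod_0) simp
qed

lemma val_append: "val c w R M (as @ bs) = val c w R M as + 2 ^ (w * length as) * val c w R M bs"
  by (induction as) (simp_all add: power_add algebra_simps)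

lemma val_zeros: "val c w R M (replicate t (Num 0) @ bs) = 2 ^ (w * t) * val c w R M bs"
  by (induction t) (simp_all add: power_add algebra_simps ev.simps)

definition cell :: "nat \<Rightarrow> nat \<Rightarrow> nat \<Rightarrow> nat \<Rightarrow> nat" where
  "cell K w i t = i + 2 ^ (w * (K + t))"

lemma val_cell_idx:
  assumes "good w (digits w i) M" "i < 2 ^ (w * K)"
  shows "val K w (digits w i) M (cell_idx K t) = cell K w i t"
proof -
  have "val K w (digits w i) M (idx K) = i"
    unfolding idx_def using assms(2) by (intro val_map) (auto simp: ev.simps)
  moreover have "val K w (digits w i) M (replicate t (Num 0) @ [Num 1]) = 2 ^ (w * t)"
    unfolding val_zeros using good_one[OF assms(1)] by (simp add: ev.simps)
  moreover have "length (idx K) = K" by (simp add: idx_def)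
  ultimately show ?thesis
    unfolding cell_idx_def val_append[of _ _ _ _ "idx K"] cell_def by (simp add: distrib_left power_add)
qed

lemma cell_stores_inactive:
  assumes "good w R M" "1 \<le> w0" "w0 \<le> w"
  shows "fold (do_store K w R) (map (cell_store K w0) ts) M = M"
proof (induction ts)
  case (Cons t ts)
  have "ev K w R M (Conj (small_exp w0) (cell_zero K t)) = (if False then 1 else 0)"
    using ev_small[OF assms(1,2)] assms(3) ev_Conj_0 by simp
  from do_store_Ite[OF assms(1) this] have "do_store K w R (cell_store K w0 t) M = M"
    by (simp add: cell_store_def)
  then show ?case using Cons by simp
qed simp

lemma do_cell_store:
  assumes g: "good w (digits w i) M" and w: "w < w0" and i: "i < 2 ^ (w * K)"
  shows "do_store K w (digits w i) (cell_store K w0 t) M =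
    M(cell K w i t := dec_digit (2 ^ w) (\<lambda>t. M (cell K w i t)) t)"
proof -
  have "1 \<le> w0" using w by simp
  note sm = ev_small(1)[OF g this, of K]
  have "ev K w (digits w i) M (cell_zero K t) = (if \<forall>u<t. M (cell K w i u) = 0 then 1 else 0)"
    unfolding cell_zero_def ev_all_zero[OF g] by (simp add: ev_Ld val_cell_idx[OF g i])
  from ev_Conj[OF g sm this]
  have "ev K w (digits w i) M (Conj (small_exp w0) (cell_zero K t)) = (if \<forall>u<t. M (cell K w i u) = 0 then 1 else 0)"
    using w by simp
  note do_store_Ite[OF g this]
  then have 1: "do_store K w (digits w i) (cell_store K w0 t) M = (if \<forall>u<t. M (cell K w i u) = 0
     then M(cell K w i t := ev K w (digits w i) M (Op Sub (Ld (cell_idx K t)) (Num 1))) else M)"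
    by (simp only: cell_store_def val_cell_idx[OF g i])
  have "ev K w (digits w i) M (Op Sub (Ld (cell_idx K t)) (Num 1)) = (M (cell K w i t) + 2 ^ w - 1) mod 2 ^ w"
    by (simp only: ev.simps(3) eval_binop.simps ev_Ld val_cell_idx[OF g i] ev_num[OF good_pow[OF g]] mod_mod_trivial)
  then show ?thesis unfolding 1 dec_digit_def by auto
qed

lemma ev_cell_zero:
  assumes g: "good w (digits w i) M" and i: "i < 2 ^ (w * K)"
  shows "ev K w (digits w i) M (cell_zero K a) = (if (\<Sum>t<a. M (cell K w i t) * (2 ^ w) ^ t) = 0 then 1 else 0)"
proof -
  have "(\<Sum>t<a. M (cell K w i t) * (2 ^ w) ^ t) = 0 \<longleftrightarrow> (\<forall>t<a. M (cell K w i t) = 0)"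
    by (rule sum_digits_zero_iff) simp
  then show ?thesis unfolding cell_zero_def ev_all_zero[OF g] by (simp only: ev_Ld val_cell_idx[OF g i])
qed

lemma cell_inject:
  assumes "cell K w i t = cell K w i' t'" "i < 2 ^ (w * K)" "i' < 2 ^ (w * K)" "1 \<le> w"
  shows "i = i' \<and> t = t'"
proof -
  have c: "cell K w i t = 2 ^ (w * t) * 2 ^ (w * K) + i" for i t by (simp add: cell_def power_add algebra_simps)
  have "2 ^ (w * t) = (2::nat) ^ (w * t') \<and> i = i'"
    using assms(1) unfolding c by (rule mult_add_inject) (fact assms)+
  then show ?thesis using assms(4) by simp
qed

lemma cell_less:
  assumes "i < 2 ^ (w * K)" "t < a" "1 \<le> w"
  shows "cell K w i t < 2 ^ (w * (K + a + 1))"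
proof -
  have "(2::nat) ^ (w * (K + t)) \<le> 2 ^ (w * (K + a))" "(2::nat) ^ (w * K) \<le> 2 ^ (w * (K + a))"
    using assms(2) by (intro power_increasing; simp)+
  then have "cell K w i t < 2 * 2 ^ (w * (K + a))"
    unfolding cell_def using assms(1) by linarith
  also have "2 * (2::nat) ^ (w * (K + a)) = 2 ^ (w * (K + a) + 1)" by simp
  also have "\<dots> \<le> (2::nat) ^ (w * (K + a + 1))" using assms(3) by (intro power_increasing) (auto simp: algebra_simps)
  finally show ?thesis .
qed

text \<open>The space is exponential in w, but w < w0 makes it a constant, which the o(m + n) term
  absorbs.\<close>

lemma decrement_structure_small:
  fixes K d D a w w0 :: nat
  assumes w: "1 \<le> w" "w < w0" and n: "length xs \<le> 2 ^ (w * K)" and m: "sum_list xs < 2 ^ (a * w)" and K: "1 \<le> K"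
    and T: "length (comp_result K (zero_exp K d D a w0)) \<le> T" "length (comp_stores K (dec_stores K d D a w0)) \<le> T"
  shows "decrement_structure w (comp_result K (zero_exp K d D a w0)) (comp_stores K (dec_stores K d D a w0)) T
    (2 ^ (w * (K + a + 1)) * w) xs"
proof -
  let ?S = "2 ^ (w * (K + a + 1)) * w"
  define v where "v M i = (\<Sum>t<a. M (cell K w i t) * (2 ^ w) ^ t)" for M :: "nat \<Rightarrow> nat" and i
  define P where "P ys M \<longleftrightarrow> length ys = length xs \<and> (\<forall>i<length xs. v M i = ys ! i)" for ys M
  have w0: "1 \<le> w0" using w by simp
  have il: "i < 2 ^ (w * K)" if "i < length xs" for i using that n by simp
  have good: "good w (digits w i) M" if "is_memory w M" for i M
    using that w by (auto simp: good_def is_memory_def)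
  show ?thesis
  proof (rule decrement_structureI[where P = P])
    let ?I = "{..<length xs} \<times> {..<a}"
    have "case_prod (cell K w) x \<noteq> case_prod (cell K w) y" if "x \<in> ?I" "y \<in> ?I" "x \<noteq> y" for x y
      using that cell_inject[OF _ il il w(1), of "fst x" "snd x" "fst y" "snd y"]
      by (metis SigmaE lessThan_iff case_prod_conv fst_conv snd_conv)
    then have "\<exists>M. (\<forall>b. M b < 2 ^ w) \<and>
        (\<forall>x\<in>?I. fld (M (case_prod (cell K w) x)) 0 w = xs ! fst x div (2 ^ w) ^ snd x mod 2 ^ w)"
      by (intro exists_fields) auto
    then obtain M where M: "\<forall>b. M b < 2 ^ w" "\<And>i t. i < length xs \<Longrightarrow> t < a \<Longrightarrow> fld (M (cell K w i t)) 0 w = xs ! i div (2 ^ w) ^ t mod 2 ^ w"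
      by (metis (no_types, lifting) SigmaI lessThan_iff case_prod_conv fst_conv snd_conv)
    have "v M i = xs ! i" if "i < length xs" for i
    proof -
      have "xs ! i < (2 ^ w) ^ a" using get_le_sum[of xs i] m that by (simp add: get_def mult.commute flip: power_mult)
      from sum_digits[OF this] show ?thesis using M that by (simp add: v_def fld_def)
    qed
    then show "\<exists>M. is_memory w M \<and> P xs M" using M by (auto simp: P_def is_memory_def)
  next
    fix ys M M' assume mem: "is_memory w M" "is_memory w M'"
      and eq: "\<forall>j<?S. mem_bit w M j = mem_bit w M' j" and P: "P ys M"
    have "M q = M' q" if "q < 2 ^ (w * (K + a + 1))" for q
    proof -
      have "bit (M q) b = bit (M' q) b" if "b < w" for b
        using eq[rule_format, OF mult_add_less[OF \<open>q < _\<close> that]] that w(1) by (simp add: mem_bit_def)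
      then have "take_bit w (M q) = take_bit w (M' q)" by (intro bit_eqI) (auto simp: bit_take_bit_iff)
      then show ?thesis using mem by (simp add: is_memory_def take_bit_nat_eq_self)
    qed
    then have "v M' i = v M i" if "i < length xs" for i
      unfolding v_def using cell_less[OF il[OF that] _ w(1)] by (intro sum.cong) auto
    then show "P ys M'" using P by (simp add: P_def)
  next
    fix ys M i assume P: "P ys M" and mem: "is_memory w M" and i: "i < length ys"
    have il': "i < 2 ^ (w * K)" using i il P by (simp add: P_def)
    have "(\<Sum>t<a. M (cell K w i t) * (2 ^ w) ^ t) = ys ! i" using P i by (simp add: P_def v_def)
    then have "ev K w (digits w i) M (cell_zero K a) = (if ys ! i = 0 then 1 else 0)"
      using ev_cell_zero[OF good[OF mem] il', of a] by (simp only:)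
    then have "ev K w (digits w i) M (zero_exp K d D a w0) = (if ys ! i = 0 then 1 else 0)"
      unfolding zero_exp_def using ev_Ite[OF good[OF mem] ev_small(1)[OF good[OF mem] w0]] w by simp
    then show "let s = run w (comp_result K (zero_exp K d D a w0)) T (start w i M)
       in halted (comp_result K (zero_exp K d D a w0)) s \<and> regs s 0 = (if ys ! i = 0 then 1 else 0) \<and> mem s = M"
      using run_comp_result[OF T(1) mem, of i] good_one[OF good[OF mem]] by (auto simp: halted_def)
  next
    fix ys M i assume P: "P ys M" and mem: "is_memory w M" and i: "i < length ys" and nz: "ys ! i \<noteq> 0"
    have il': "i < 2 ^ (w * K)" using i il P by (simp add: P_def)
    let ?c = "cell K w i"
    define \<delta> where "\<delta> t = M (?c t)" for t
    have dl: "\<delta> t < 2 ^ w" for t using mem by (simp add: \<delta>_def is_memory_def)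
    define N where "N \<tau> = fold (do_store K w (digits w i)) (map (cell_store K w0) (rev [\<tau>..<a])) M" for \<tau>
    have N_Suc: "N \<tau> = do_store K w (digits w i) (cell_store K w0 \<tau>) (N (Suc \<tau>))" if "\<tau> < a" for \<tau>
      using that by (simp add: N_def upt_conv_Cons)
    have inv: "is_memory w (N \<tau>) \<and> (\<forall>t<a. N \<tau> (?c t) = (if \<tau> \<le> t then dec_digit (2 ^ w) \<delta> t else \<delta> t)) \<and>
        (\<forall>b. (\<forall>t<a. b \<noteq> ?c t) \<longrightarrow> N \<tau> b = M b)" if "\<tau> \<le> a" for \<tau>
      using that
    proof (induction rule: inc_induct)
      case base
      then show ?case using mem by (simp add: N_def \<delta>_def)
    next
      case (step \<tau>)
      let ?N = "N (Suc \<tau>)"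
      have IH: "is_memory w ?N" "\<And>t. t < a \<Longrightarrow> ?N (?c t) = (if Suc \<tau> \<le> t then dec_digit (2 ^ w) \<delta> t else \<delta> t)"
        "\<And>b. \<forall>t<a. b \<noteq> ?c t \<Longrightarrow> ?N b = M b" using step.IH by auto
      have "?N (?c u) = \<delta> u" if "u \<le> \<tau>" for u using IH(2)[of u] that step.hyps by simp
      then have "(\<forall>u<\<tau>. ?N (?c u) = 0) \<longleftrightarrow> (\<forall>u<\<tau>. \<delta> u = 0)" "?N (?c \<tau>) = \<delta> \<tau>" by auto
      then have "dec_digit (2 ^ w) (\<lambda>t. ?N (?c t)) \<tau> = dec_digit (2 ^ w) \<delta> \<tau>"
        by (simp only: dec_digit_def)
      then have N: "N \<tau> = ?N(?c \<tau> := dec_digit (2 ^ w) \<delta> \<tau>)"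
        using N_Suc[OF step.hyps(2)] do_cell_store[OF good[OF IH(1)] w(2) il'] by simp
      have "dec_digit (2 ^ w) \<delta> \<tau> < 2 ^ w" by (rule dec_digit_less[of \<delta> \<tau>, OF dl])
      then have "is_memory w (N \<tau>)" using IH(1) unfolding N by (simp add: is_memory_def)
      moreover have "N \<tau> (?c t) = (if \<tau> \<le> t then dec_digit (2 ^ w) \<delta> t else \<delta> t)" if "t < a" for t
        using IH(2)[OF that] cell_inject[OF _ il' il' w(1), of t \<tau>] unfolding N
        by (cases "t = \<tau>") auto
      moreover have "N \<tau> b = M b" if "\<forall>t<a. b \<noteq> ?c t" for b
        using IH(3)[OF that] that step.hyps unfolding N by auto
      ultimately show ?case by blast
    qed
    have I: "is_memory w (N 0)" "\<And>t. t < a \<Longrightarrow> N 0 (?c t) = dec_digit (2 ^ w) \<delta> t"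
      "\<And>b. \<forall>t<a. b \<noteq> ?c t \<Longrightarrow> N 0 b = M b" using inv[of 0] by auto
    have sd: "(\<Sum>t<a. \<delta> t * (2 ^ w) ^ t) = ys ! i" using P i by (simp add: P_def v_def \<delta>_def)
    have "v (N 0) i = (\<Sum>t<a. dec_digit (2 ^ w) \<delta> t * (2 ^ w) ^ t)"
      unfolding v_def using I(2) by (intro sum.cong) auto
    also have "\<dots> = ys ! i - 1"
      using sum_dec_digit_pos[of a \<delta> "2 ^ w"] dl nz unfolding sd by simp
    finally have vi: "v (N 0) i = ys ! i - 1" .
    have vo: "v (N 0) i' = v M i'" if "i' < length xs" "i' \<noteq> i" for i'
    proof -
      have "N 0 (cell K w i' t) = M (cell K w i' t)" for t
        using cell_inject[OF _ il[OF that(1)] il' w(1)] that(2) by (intro I(3)) blast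
      then show ?thesis by (simp add: v_def)
    qed
    have P': "P (ys[i := ys ! i - 1]) (N 0)"
      using P vi vo i by (auto simp: P_def nth_list_update)
    have unch: "unchanged_beyond w ?S M (N 0)"
    proof -
      have "mem_bit w (N 0) j = mem_bit w M j" if "?S \<le> j" for j
      proof -
        have "2 ^ (w * (K + a + 1)) \<le> j div w" using that w(1) by (simp add: less_eq_div_iff_mult_less_eq)
        then have "\<forall>t<a. j div w \<noteq> ?c t" using cell_less[OF il' _ w(1)] by fastforce
        then show ?thesis using I(3) by (simp add: mem_bit_def)
      qed
      then show ?thesis by (simp add: unchanged_beyond_def)
    qed
    have "fold (do_store K w (digits w i)) (dec_stores K d D a w0) M = N 0"
    proof -
      have "ev K w (digits w i) M' (large_exp w0) = 0" for M'
      proof -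
        have "ev K w (digits w i) M' (large_exp w0) = ev K w (digits w i) M (large_exp w0)"
          by (simp add: large_exp_def small_exp_def ev.simps)
        then show ?thesis using ev_small(2)[OF good[OF mem] w0] w(2) by simp
      qed
      from big_stores_inactive[OF good[OF mem] this] show ?thesis
        by (simp add: dec_stores_def N_def)
    qed
    then show "let s = run w (comp_stores K (dec_stores K d D a w0)) T (start w i M)
       in halted (comp_stores K (dec_stores K d D a w0)) s \<and> is_memory w (mem s) \<and> unchanged_beyond w ?S M (mem s) \<and> P (ys[i := ys ! i - 1]) (mem s)"
      using run_comp_stores[OF T(2), of w i M] P' I(1) unch by (auto simp: halted_def)
  qed
qed

lemma (in valid_layout) decrement_structure_large:
  assumes w0: "1 \<le> w0" "w0 \<le> w"
    and T: "length (comp_result K (zero_exp K d D a w0)) \<le> T'" "length (comp_stores K (dec_stores K d D a w0)) \<le> T'"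
  shows "decrement_structure w (comp_result K (zero_exp K d D a w0)) (comp_stores K (dec_stores K d D a w0)) T' S xs"
proof -
  have good: "good w (digits w i) M" if "is_memory w M" for i M
    using that w_pos by (auto simp: good_def is_memory_def)
  show ?thesis
  proof (rule decrement_structureI[where P = represents])
    show "\<exists>M. is_memory w M \<and> represents xs M" by (rule represents_init)
  next
    show "\<And>ys M M'. is_memory w M \<Longrightarrow> is_memory w M' \<Longrightarrow> \<forall>j<S. mem_bit w M j = mem_bit w M' j \<Longrightarrow>
        represents ys M \<Longrightarrow> represents ys M'"
      using represents_cong by blast
  next
    fix ys M i assume rep: "represents ys M" and mem: "is_memory w M" and i: "i < length ys"
    have "i < length xs" using rep i by (simp add: represents_def)
    from loaded[OF rep mem this] interpret l: loaded w e f s K D d xs M i .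
    have "ev K w (digits w i) M (zero_exp K d D a w0) = (if ys ! i = 0 then 1 else 0)"
      unfolding zero_exp_def using ev_Ite[OF good[OF mem] ev_small(1)[OF good[OF mem] w0(1)]] w0(2)
        l.v_big_zero[OF rep] by simp
    then show "let s = run w (comp_result K (zero_exp K d D a w0)) T' (start w i M)
       in halted (comp_result K (zero_exp K d D a w0)) s \<and> regs s 0 = (if ys ! i = 0 then 1 else 0) \<and> mem s = M"
      using run_comp_result[OF T(1) mem, of i] good_one[OF good[OF mem]] by (auto simp: halted_def)
  next
    fix ys M i assume rep: "represents ys M" and mem: "is_memory w M" and i: "i < length ys" and nz: "ys ! i \<noteq> 0"
    have ix: "i < length xs" using rep i by (simp add: represents_def)
    have b: "ev K w (digits w i) M' (large_exp w0) = 1" if "is_memory w M'" for M'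
      using ev_small(2)[OF good[OF that] w0(1)] w0(2) by simp
    note c = big_stores_correct[OF rep mem ix nz b]
    have "fold (do_store K w (digits w i)) (dec_stores K d D a w0) M =
        fold (do_store K w (digits w i)) (big_stores K d D (large_exp w0)) M"
      using cell_stores_inactive[OF good[OF c(1)] w0] by (simp add: dec_stores_def)
    then show "let s = run w (comp_stores K (dec_stores K d D a w0)) T' (start w i M)
       in halted (comp_stores K (dec_stores K d D a w0)) s \<and> is_memory w (mem s) \<and> unchanged_beyond w S M (mem s) \<and>
          represents (ys[i := ys ! i - 1]) (mem s)"
      using run_comp_stores[OF T(2), of w i M] c by (auto simp: halted_def)
  qed
qed

subsection \<open>Space\<close>

text \<open>\<open>l\<close> plays the role of lg N. Slot numbers stay below 2^(2 l), and l \<le> K1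
  w, hence addresses of 2 K1 words. The bound 32 K1 s^4 \<le> l makes slots much longer than
  groups.\<close>

locale layout_parameters = structure_layout w e f s "2 * K1" D d xs
  for w e f s K1 D d :: nat and xs :: "nat list" +
  fixes l :: nat
  assumes s_dvd: "s * s dvd 2 ^ (3 * s)"
    and s_ge: "8 \<le> s" and d_le_s: "d \<le> s" and D_le_s: "D \<le> s"
    and l_le: "l \<le> 2 ^ s" and l_ge: "32 * K1 * s ^ 4 \<le> l"
    and K1_pos: "1 \<le> K1" and d_large: "2 * K1 + 3 \<le> 2 ^ d"
    and size_less: "length xs + sum_list xs < 2 ^ l"
    and l_w: "l \<le> K1 * w"
    and ef_le: "2 ^ e * f \<le> w" and f_wide: "2 * l \<le> f \<or> f = w" and f_le: "f \<le> 4 * l"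
    and w_tight: "w < 2 ^ e * (f + 1) \<or> e = 2 * l" and e_le: "e \<le> 2 * l"
    and sum_fits: "sum_list xs < 2 ^ (f * D)"
begin

lemma s_powers: "s \<le> s ^ 4" "s ^ 2 \<le> s ^ 4" "s ^ 3 \<le> s ^ 4" "8 * s ^ 3 \<le> s ^ 4" "64 * s \<le> s ^ 4"
proof -
  have s: "1 \<le> s" using s_ge by simp
  show "s ^ 2 \<le> s ^ 4" "s ^ 3 \<le> s ^ 4" using s by (auto intro!: power_increasing)
  show "s \<le> s ^ 4" using power_increasing[of 1 4 s] s by simp
  have "s ^ 4 = s * s ^ 3" by (simp add: power_numeral_reduce)
  then show "8 * s ^ 3 \<le> s ^ 4" using s_ge by simp
  have "s ^ 4 = s * (s * s * s)" by (simp add: power_numeral_reduce)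
  moreover have "8 * 8 * 1 \<le> s * s * s" using s_ge s by (intro mult_le_mono) auto
  ultimately show "64 * s \<le> s ^ 4" using s by simp
qed

lemma T_le: "T + 1 \<le> 7 * s ^ 3"
proof -
  have "s ^ 3 = s * (s * s)" by (simp add: power_numeral_reduce)
  moreover have "2 \<le> s * (s * s)" using s_ge mult_le_mono[of 2 s 1 "s * s"] by simp
  ultimately show ?thesis by (simp add: T_def h_def)
qed

text \<open>A slot that is a whole word may be shorter than l by the factor K1; this is why K1
  occurs in \<open>l_ge\<close>.\<close>

lemma f_ge: "32 * s ^ 4 \<le> f"
proof -
  have "l \<le> K1 * f"
  proof (cases "f = w")
    case False
    then have "l \<le> f" using f_wide by linarith
    also have "f \<le> K1 * f" using K1_pos by simp
    finally show ?thesis .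
  qed (use l_w in simp)
  moreover have "K1 * (32 * s ^ 4) = 32 * K1 * s ^ 4" by simp
  ultimately have "K1 * (32 * s ^ 4) \<le> K1 * f" using l_ge by linarith
  then show ?thesis using K1_pos by (subst (asm) mult_le_cancel1) auto
qed

lemma f_le_w': "f \<le> w"
proof -
  have "1 * f \<le> 2 ^ e * f" by (intro mult_right_mono) auto
  also note ef_le
  finally show ?thesis by simp
qed

lemma NG_h: "NG * h = B"
  using s_dvd by (simp add: NG_def h_def B_def)

lemma NG_le: "NG \<le> B" by (simp add: NG_def)

lemma E3: "1 \<le> E3" "f \<le> 8 * s * E3"
proof -
  have "4 * s \<le> f" using f_ge s_powers by linarith
  then show 1: "1 \<le> E3" using s_ge by (simp add: E3_def div_greater_zero_iff Suc_leI)
  have "f = 4 * s * E3 + f mod (4 * s)" by (simp add: E3_def)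
  also have "f mod (4 * s) < 4 * s" using s_ge by (intro mod_less_divisor) simp
  finally have "f \<le> 4 * s * E3 + 4 * s * 1" by simp
  also have "4 * s * 1 \<le> 4 * s * E3" using 1 by (intro mult_left_mono) auto
  finally show "f \<le> 8 * s * E3" by simp
qed

lemma cap: "cap + T = f" "15 * s ^ 4 \<le> f" "s * (T + 1) \<le> cap" "1 \<le> cap"
proof -
  have T: "T + 1 \<le> s ^ 4" using T_le s_powers(4) by linarith
  then show 1: "cap + T = f" using f_ge by (simp add: cap_def)
  show "15 * s ^ 4 \<le> f" using f_ge by linarith
  have "s * (T + 1) \<le> s * (7 * s ^ 3)" using T_le by (intro mult_left_mono) auto
  also have "\<dots> = 7 * s ^ 4" by (simp add: power_numeral_reduce)
  finally show "s * (T + 1) \<le> cap" using 1 T f_ge by linarith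
  show "1 \<le> cap" using 1 T f_ge by linarith
qed

lemma np_cap: "np * f \<le> 8 * s * NG + f"
proof -
  have "(NG div E3) * f \<le> (NG div E3) * (8 * s * E3)" using E3(2) by (intro mult_left_mono) auto
  also have "\<dots> = 8 * s * (NG div E3 * E3)" by simp
  also have "\<dots> \<le> 8 * s * NG" by (intro mult_left_mono) auto
  finally show ?thesis by (simp add: np_def algebra_simps)
qed

lemma s_exp: "14 * s + 6 < 2 ^ s"
proof -
  have "14 * (8 + k) + 6 < 256 * (2::nat) ^ k" for k
  proof (induction k)
    case (Suc k)
    then show ?case by simp
  qed simp
  then have "14 * (8 + k) + 6 < (2::nat) ^ (8 + k)" for k by (simp add: power_add)
  from this[of "s - 8"] show ?thesis using s_ge by simp
qed

lemma vpos_bound: assumes "g \<le> NG" shows "vpos k g < 2 ^ (4 * s)"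
proof -
  have "(\<Sum>i<g. glen (k * NG + i)) \<le> (\<Sum>i<g. T)" by (intro sum_mono glen_le)
  also have "\<dots> \<le> NG * T" using assms by simp
  also have "NG * T = 6 * s * (NG * h) + NG" by (simp add: T_def algebra_simps)
  also have "\<dots> \<le> 6 * s * B + B" using NG_le by (simp add: NG_h)
  finally have 1: "(\<Sum>i<g. glen (k * NG + i)) \<le> 6 * s * B + B" .
  have "np * cap \<le> np * f" using cap(1) by (intro mult_left_mono) auto
  also note np_cap
  also have "8 * s * NG \<le> 8 * s * B" using NG_le by (intro mult_left_mono) auto
  also have "f \<le> 4 * B"
  proof -
    have "(2::nat) ^ s \<le> B" unfolding B_def by (intro power_increasing) auto
    then show ?thesis using f_le l_le by linarith
  qed
  \<comment> \<open>The codes contribute (6 s + 1) B and the pointer slots (8 s + 4) B.\<close>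
  finally have "vpos k g \<le> (14 * s + 5) * B" using 1 by (simp add: vpos_def algebra_simps)
  also have "\<dots> < 2 ^ s * B" using s_exp by (intro mult_strict_right_mono) (auto simp: B_def)
  also have "\<dots> = 2 ^ (4 * s)" by (simp add: B_def flip: power_add)
  finally show ?thesis .
qed

lemma len_le: "len k \<le> 2 ^ (4 * s)"
proof (cases "heavy k")
  case True
  have "D \<le> 2 ^ s" using D_le_s less_exp[of s] by linarith
  then have "B * D \<le> 2 ^ (3 * s) * 2 ^ s" unfolding B_def by (intro mult_left_mono) auto
  then show ?thesis using True by (simp add: len_def flip: power_add)
next
  case False
  have "vpos k NG div cap \<le> vpos k NG" by (rule div_le_dividend)
  then have "vpos k NG div cap + 1 \<le> 2 ^ (4 * s)" using vpos_bound[of NG k] by linarith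
  then show ?thesis using False by (simp add: len_def)
qed

lemma nsb_le: "nsb \<le> 2 ^ l"
proof -
  have "length xs div B \<le> length xs" by (rule div_le_dividend)
  then show ?thesis using size_less unfolding nsb_def by linarith
qed

lemma l_big: "32 * s ^ 4 \<le> l"
proof -
  have "32 * s ^ 4 \<le> K1 * (32 * s ^ 4)" using K1_pos by simp
  moreover have "K1 * (32 * s ^ 4) = 32 * K1 * s ^ 4" by simp
  ultimately show ?thesis using l_ge by linarith
qed

lemma Zmax_less: "Zmax < 2 ^ (2 * l)"
proof -
  \<comment> \<open>Superblocks, their records and the records of the table each take at most a
    quarter of 2^(2 l).\<close>
  have "(\<Sum>i<nsb. len i) \<le> (\<Sum>i<nsb. 2 ^ (4 * s))" by (intro sum_mono len_le)
  also have "\<dots> \<le> 2 ^ l * 2 ^ (4 * s)" using nsb_le by simp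
  also have "\<dots> \<le> 2 ^ (2 * l - 2)" unfolding power_add[symmetric]
    using l_big s_powers s_ge by (intro power_increasing; linarith)
  finally have 1: "(\<Sum>i<nsb. len i) \<le> 2 ^ (2 * l - 2)" .
  have "nsb * 2 ^ d \<le> 2 ^ l * 2 ^ d" using nsb_le by simp
  also have "\<dots> \<le> 2 ^ (2 * l - 2)" unfolding power_add[symmetric]
    using l_big s_powers s_ge d_le_s by (intro power_increasing; linarith)
  finally have 2: "nsb * 2 ^ d \<le> 2 ^ (2 * l - 2)" .
  have "2 ^ T * h * 2 ^ d \<le> 2 ^ T * 2 ^ (2 * s) * 2 ^ d" using h_le by simp
  also have "\<dots> \<le> 2 ^ (2 * l - 2)" unfolding power_add[symmetric]
    using l_big s_powers s_ge d_le_s T_le by (intro power_increasing; linarith)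
  finally have 3: "2 ^ T * h * 2 ^ d \<le> 2 ^ (2 * l - 2)" .
  have "Zmax \<le> 3 * 2 ^ (2 * l - 2)" using 1 2 3
    by (simp add: Zmax_def Zs_def R_def recs_def add_mult_distrib)
  also have "\<dots> < 4 * 2 ^ (2 * l - 2)" by simp
  also have "\<dots> = 2 ^ (2 * l - 2 + 2)" by (simp add: power_add)
  also have "2 * l - 2 + 2 = 2 * l" using l_big s_powers s_ge by linarith
  finally show ?thesis .
qed

lemma valid: "valid_layout w e f s (2 * K1) D d xs"
proof
  show "s * s dvd 2 ^ (3 * s)" by (rule s_dvd)
  show "T < f" using cap by linarith
  show "8 * s \<le> f" using f_ge s_powers by linarith
  have "4 * 2 ^ s = (2::nat) ^ (2 + s)" by (simp add: power_add)
  also have "\<dots> < 2 ^ (2 * s)" using s_ge by (intro power_strict_increasing) auto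
  finally have 4: "4 * 2 ^ s < (2::nat) ^ (2 * s)" .
  show "f < 2 ^ (2 * s)" "e < 2 ^ (2 * s)" using 4 f_le e_le l_le by linarith+
  show "2 ^ e * f \<le> w" by (rule ef_le)
  show "Zmax < 2 ^ f \<or> f = w"
  proof (cases "f = w")
    case False
    then have "(2::nat) ^ (2 * l) \<le> 2 ^ f" using f_wide by (intro power_increasing) auto
    then show ?thesis using less_le_trans[OF Zmax_less] by blast
  qed simp
  have lw: "2 * l \<le> w * (2 * K1)"
  proof -
    have "2 * l \<le> 2 * (K1 * w)" using l_w by (rule mult_left_mono) simp
    also have "\<dots> = w * (2 * K1)" by simp
    finally show ?thesis .
  qed
  have "(2::nat) ^ (2 * l) \<le> 2 ^ (w * (2 * K1))" using lw by (intro power_increasing) simp_all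
  then show "Zmax < 2 ^ (w * (2 * K1))" by (rule less_le_trans[OF Zmax_less])
  have "(2::nat) ^ l \<le> 2 ^ (w * (2 * K1))" using lw by (intro power_increasing) linarith+
  then show "length xs \<le> 2 ^ (w * (2 * K1))" using size_less by linarith
  show "1 \<le> 2 * K1" using K1_pos by simp
  show "d \<le> 3 * s" using d_le_s by simp
  show "2 * K1 + 3 \<le> 2 ^ d" by (rule d_large)
  have w: "10 * s ^ 4 \<le> w" using f_ge f_le_w' by linarith
  then show "T + 2 * s + d \<le> w" using T_le s_powers d_le_s by linarith
  have "D < 2 ^ s" using D_le_s less_exp[of s] by linarith
  then have "B * D < 2 ^ (3 * s) * 2 ^ s" unfolding B_def by simp
  also have "\<dots> \<le> 2 ^ w" unfolding power_add[symmetric] using w s_powers by (intro power_increasing; linarith)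
  finally show "B * D < 2 ^ w" .
  show "vpos k g < 2 ^ (4 * s)" if "g \<le> NG" for k g by (rule vpos_bound[OF that])
  show "sum_list xs < 2 ^ (f * D)" by (rule sum_fits)
qed

text \<open>A word has fewer than 2^e bits outside its 2^e slots, which amounts to one extra bit per
  slot. If e = 2 l, the structure lies within one word, of which only the slots count.\<close>

lemma S_le: "S \<le> Zmax * (f + 1)"
proof (cases "w < 2 ^ e * (f + 1)")
  case True
  have "S \<le> Zmax div 2 ^ e * (2 ^ e * (f + 1)) + Zmax mod 2 ^ e * (f + 1)"
    unfolding S_def using True by (intro add_mono mult_left_mono) auto
  also have "\<dots> = (Zmax div 2 ^ e * 2 ^ e + Zmax mod 2 ^ e) * (f + 1)" by (simp only: add_mult_distrib mult.assoc)
  finally show ?thesis by (simp only: div_mult_mod_eq)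
next
  case False
  then have "Zmax < 2 ^ e" using Zmax_less w_tight by simp
  then show ?thesis by (simp add: S_def)
qed

section \<open>Total lengths of codes and superblocks\<close>

lemma sum_get: "(\<Sum>i<n. get xs i) \<le> sum_list xs"
proof -
  have "(\<Sum>i<n. get xs i) = (\<Sum>i\<in>{..<n} \<inter> {..<length xs}. xs ! i)"
    by (intro sum.mono_neutral_cong_right) (auto simp: get_def)
  also have "\<dots> \<le> (\<Sum>i<length xs. xs ! i)" by (intro sum_mono2) auto
  also have "\<dots> = sum_list xs" by (simp add: sum_list_sum_nth atLeast0LessThan)
  finally show ?thesis .
qed

lemma sum_blocks: "(\<Sum>k<a. \<Sum>i<b. F (k * b + i)) = (\<Sum>i<a * b. F i)" for F :: "nat \<Rightarrow> nat"
proof (induction a)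
  case (Suc a)
  have "(\<Sum>i<m + n. F i) = (\<Sum>i<m. F i) + (\<Sum>i<n. F (m + i))" for m n by (induction n) simp_all
  from this[of "a * b" b] Suc show ?case by (simp add: add.commute)
qed simp

lemma glen_sum: "(\<Sum>\<gamma><nsb * NG. glen \<gamma>) \<le> sum_list xs + 2 * (nsb * B) + nsb * NG"
proof -
  have "glen \<gamma> \<le> 1 + (\<Sum>j<h. get xs (\<gamma> * h + j) + 2)" for \<gamma>
    by (simp add: glen_def group_len_def grp_def sum_list_sum_nth atLeast0LessThan)
  then have "(\<Sum>\<gamma><nsb * NG. glen \<gamma>) \<le> (\<Sum>\<gamma><nsb * NG. 1 + (\<Sum>j<h. get xs (\<gamma> * h + j) + 2))"
    by (rule sum_mono)
  also have "\<dots> = nsb * NG + (\<Sum>i<nsb * NG * h. get xs i + 2)"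
    unfolding sum.distrib[of "\<lambda>_. 1"] sum_blocks[of "\<lambda>i. get xs i + 2"] by simp
  also have "\<dots> = nsb * NG + (\<Sum>i<nsb * B. get xs i) + 2 * (nsb * B)"
    unfolding sum.distrib[of "get xs"] by (simp add: mult.assoc NG_h)
  finally show ?thesis using sum_get[of "nsb * B"] by linarith
qed

definition "num_heavy = card {k. k < nsb \<and> heavy k}"

text \<open>Markov's inequality: each heavy superblock contributes at least 2^(6 s) to the sum of
  all counters.\<close>

lemma num_heavy_le: "num_heavy * 2 ^ (6 * s) \<le> sum_list xs"
proof -
  have "num_heavy * 2 ^ (6 * s) = (\<Sum>k | k < nsb \<and> heavy k. 2 ^ (6 * s))" by (simp add: num_heavy_def)
  also have "\<dots> \<le> (\<Sum>k | k < nsb \<and> heavy k. \<Sum>j<B. get xs (k * B + j))"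
  proof (rule sum_mono)
    fix k assume "k \<in> {k. k < nsb \<and> heavy k}"
    then obtain j where "j < B" "2 ^ (6 * s) \<le> get xs (k * B + j)" by (auto simp: heavy_def)
    then show "2 ^ (6 * s) \<le> (\<Sum>j<B. get xs (k * B + j))"
      using member_le_sum[of j "{..<B}" "\<lambda>j. get xs (k * B + j)"] by simp
  qed
  also have "\<dots> \<le> (\<Sum>k<nsb. \<Sum>j<B. get xs (k * B + j))" by (intro sum_mono2) auto
  also have "\<dots> = (\<Sum>i<nsb * B. get xs i)" by (rule sum_blocks)
  also have "\<dots> \<le> sum_list xs" by (rule sum_get)
  finally show ?thesis .
qed

lemma len_sum: "(\<Sum>k<nsb. len k) \<le> num_heavy * (B * D) + nsb * (np + 1) + (\<Sum>\<gamma><nsb * NG. glen \<gamma>) div cap"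
proof -
  have div_sum: "(\<Sum>k<a. F k div c) \<le> (\<Sum>k<a. F k) div c" if "0 < c" for F :: "nat \<Rightarrow> nat" and a c
  proof -
    have "(\<Sum>k<a. F k div c) * c = (\<Sum>k<a. F k div c * c)" by (rule sum_distrib_right)
    also have "\<dots> \<le> (\<Sum>k<a. F k)" by (intro sum_mono) simp
    finally show ?thesis using that by (simp add: less_eq_div_iff_mult_less_eq)
  qed
  have "len k \<le> (if heavy k then B * D else 0) + (np + 1) + (\<Sum>i<NG. glen (k * NG + i)) div cap" for k
    using cap(4) by (simp add: len_def vpos_def)
  then have "(\<Sum>k<nsb. len k) \<le>
      (\<Sum>k<nsb. (if heavy k then B * D else 0) + (np + 1) + (\<Sum>i<NG. glen (k * NG + i)) div cap)"
    by (rule sum_mono)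
  also have "\<dots> = (\<Sum>k<nsb. if heavy k then B * D else 0) + nsb * (np + 1) +
      (\<Sum>k<nsb. (\<Sum>i<NG. glen (k * NG + i)) div cap)"
    unfolding sum.distrib[of _ "\<lambda>k. (\<Sum>i<NG. glen (k * NG + i)) div cap"] sum.distrib[of "\<lambda>k. if heavy k then B * D else 0"]
    by simp
  also have "(\<Sum>k<nsb. if heavy k then B * D else 0) = num_heavy * (B * D)"
  proof -
    have "{..<nsb} \<inter> {k. heavy k} = {k. k < nsb \<and> heavy k}" by auto
    then show ?thesis by (simp add: num_heavy_def sum.If_cases)
  qed
  also have "(\<Sum>k<nsb. (\<Sum>i<NG. glen (k * NG + i)) div cap) \<le> (\<Sum>\<gamma><nsb * NG. glen \<gamma>) div cap"
    using div_sum[of cap "\<lambda>k. \<Sum>i<NG. glen (k * NG + i)" nsb] cap(4) unfolding sum_blocks by simp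
  finally show ?thesis by simp
qed

text \<open>Up to a constant factor the bits of the table: 2^T h records with h \<le> 2^(2 s), 2^d
  slots per record and f + 1 \<le> 5 * 2^s. It also dominates \<open>B\<close> and the other terms
  that come from rounding up the number of superblocks.\<close>

definition "table_bound = (2::nat) ^ (T + 3 * s + d)"

text \<open>The exponent is O(s^3) whereas l is at least 32 s^4, so the table takes no more than
  2^(l/2) up to constants.\<close>

lemma table_bound_sq: "table_bound ^ 2 \<le> 2 ^ l"
proof -
  have "(t + 3 * s + d) * 2 \<le> l" if "t + 1 \<le> 7 * c" "8 * c \<le> q" "64 * s \<le> q" "32 * q \<le> l" for t c q
    using that d_le_s by simp
  from this[OF T_le s_powers(4,5) l_big] have "(T + 3 * s + d) * 2 \<le> l" .
  then show ?thesis unfolding table_bound_def power_mult[symmetric] by (intro power_increasing) auto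
qed

text \<open>The factor s keeps the estimate within the natural numbers; after division by s, the
  second term is the O(N / s) overhead.\<close>

lemma size_bound:
  "s * S \<le> s * (sum_list xs + 2 * length xs) +
     (36 + 5 * D + 5 * 2 ^ d) * (sum_list xs + length xs) + 48 * (s * table_bound)"
proof -
  let ?m = "sum_list xs" and ?n = "length xs"
  define F where "F = f + 1"
  define G where "G = (\<Sum>\<gamma><nsb * NG. glen \<gamma>)"
  have BX: "B \<le> table_bound" unfolding B_def table_bound_def by (intro power_increasing) auto
  have sX: "2 ^ (s + d) \<le> table_bound" unfolding table_bound_def by (intro power_increasing) auto
  have s1: "1 \<le> s" using s_ge by simp
  have F: "F \<le> 5 * 2 ^ s" "F \<le> 2 * f" "f \<le> 4 * 2 ^ s" using f_le l_le f_ge s_powers s1 one_le_power[of "2::nat" s]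
    by (simp_all add: F_def)
  have sB: "s * 2 ^ s \<le> B"
  proof -
    have "s \<le> 2 ^ s" by (simp add: less_imp_le)
    then have "s * 2 ^ s \<le> 2 ^ s * 2 ^ s" by simp
    also have "\<dots> \<le> B" unfolding B_def power_add[symmetric] by (intro power_increasing) auto
    finally show ?thesis .
  qed
  have qB: "nsb * B \<le> ?n + B" by (simp add: nsb_def add_mult_distrib)
  have qs: "s * 2 ^ s * nsb \<le> ?n + s * 2 ^ s"
  proof -
    have "s * 2 ^ s * (?n div B) \<le> B * (?n div B)" using sB by (rule mult_right_mono) simp
    also have "\<dots> \<le> ?n" by simp
    finally show ?thesis by (simp add: nsb_def distrib_left)
  qed
  have qNG: "s * (s * (nsb * NG)) \<le> ?n + B"
    using qB by (simp add: h_def ac_simps flip: NG_h)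
  have qNG': "nsb * NG \<le> s * (nsb * NG)" "s * (nsb * NG) \<le> ?n + B"
  proof -
    show 1: "nsb * NG \<le> s * (nsb * NG)" using s1 by simp
    have "s * (nsb * NG) \<le> s * (s * (nsb * NG))" using s1 by simp
    then show "s * (nsb * NG) \<le> ?n + B" using qNG by (rule le_trans)
  qed
  have G: "G \<le> ?m + 2 * ?n + 2 * B + nsb * NG" using glen_sum qB by (simp add: G_def)
  \<comment> \<open>The codes. Only \<open>cap\<close> of the F bits per slot hold code, which costs
    a factor F / cap \<le> 1 + 1/s.\<close>
  have p1: "s * (F * (G div cap)) \<le> s * (?m + 2 * ?n) + 4 * (?m + ?n) + 6 * (s * table_bound)"
  proof -
    have "F = cap + (T + 1)" using cap(1) by (simp add: F_def)
    then have "s * (F * (G div cap)) = s * (G div cap * cap) + s * (T + 1) * (G div cap)" by (simp add: algebra_simps)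
    also have "\<dots> \<le> s * G + cap * (G div cap)" using cap(3) by (intro add_mono mult_left_mono mult_right_mono) auto
    also have "\<dots> \<le> s * G + G" by simp
    also have "s * G \<le> s * (?m + 2 * ?n + 2 * B + nsb * NG)" using G by (rule mult_left_mono) simp
    also have "\<dots> = s * (?m + 2 * ?n) + 2 * (s * B) + s * (nsb * NG)" by (simp add: algebra_simps)
    finally have "s * (F * (G div cap)) \<le> s * (?m + 2 * ?n) + 2 * (s * B) + ?m + 4 * ?n + 4 * B"
      using G qNG' by linarith
    moreover have "B \<le> s * B" using s1 by simp
    moreover have "s * B \<le> s * table_bound" using BX by simp
    moreover have "x \<le> y + 4 * (m + n) + 6 * z"
      if "x \<le> y + 2 * u + m + 4 * n + 4 * v" "v \<le> u" "u \<le> z" for x y z u v m n :: nat using that by simp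
    ultimately show ?thesis by blast
  qed
  \<comment> \<open>The pointers, O(s) bits for s^2 counters, and the partly filled slots of each
    superblock, O(2^s) bits for 2^(3 s) counters.\<close>
  have p2: "s * (F * (nsb * (np + 1))) \<le> 32 * ?n + 32 * (s * table_bound)"
  proof -
    have "F * (np + 1) \<le> 2 * f * (np + 1)" using F(2) by (rule mult_right_mono) simp
    also have "\<dots> = 2 * (np * f) + 2 * f" by (simp add: algebra_simps)
    also have "\<dots> \<le> 16 * (s * NG) + 16 * 2 ^ s" using np_cap F(3) by simp
    finally have "s * nsb * (F * (np + 1)) \<le> s * nsb * (16 * (s * NG) + 16 * 2 ^ s)" by (rule mult_left_mono) simp
    also have "\<dots> = 16 * (s * (s * (nsb * NG))) + 16 * (s * 2 ^ s * nsb)" by (simp add: algebra_simps)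
    also have "\<dots> \<le> 16 * (?n + B) + 16 * (?n + s * 2 ^ s)" using qNG qs by (intro add_mono mult_left_mono) auto
    finally have "s * (F * (nsb * (np + 1))) \<le> 32 * ?n + 32 * B" using sB by (simp add: algebra_simps)
    moreover have "B \<le> s * table_bound" using BX s1 mult_le_mono[of 1 s B table_bound] by simp
    ultimately show ?thesis by linarith
  qed
  \<comment> \<open>The heavy superblocks. Since s F B \<le> 5 * 2^(6 s), the large counter of each
    of them pays for its B D slots; this is the origin of the threshold 2^(6 s).\<close>
  have p3: "s * (F * (num_heavy * (B * D))) \<le> 5 * D * ?m"
  proof -
    have "s \<le> 2 ^ (2 * s)" using less_exp[of "2 * s"] by linarith
    then have "s * (F * (num_heavy * (B * D))) \<le> 2 ^ (2 * s) * (5 * 2 ^ s * (num_heavy * (B * D)))"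
      using F(1) by (intro mult_mono mult_right_mono) auto
    also have "\<dots> = 5 * D * (num_heavy * (2 ^ (2 * s) * 2 ^ s * B))" by simp
    also have "2 ^ (2 * s) * 2 ^ s * B = 2 ^ (6 * s)" by (simp add: B_def flip: power_add)
    also have "5 * D * (num_heavy * 2 ^ (6 * s)) \<le> 5 * D * ?m" using num_heavy_le by (rule mult_left_mono) simp
    finally show ?thesis .
  qed
  \<comment> \<open>The records. Those of the superblocks are negligible because s 2^s \<le>
    B.\<close>
  have p4: "s * (F * R) \<le> 5 * 2 ^ d * ?n + 10 * (s * table_bound)"
  proof -
    have "F * R \<le> 5 * 2 ^ s * ((nsb + 2 ^ T * 2 ^ (2 * s)) * 2 ^ d)"
      unfolding R_def recs_def using F(1) h_le by (intro mult_mono mult_right_mono add_mono) auto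
    also have "\<dots> = 5 * 2 ^ d * (2 ^ s * nsb) + 5 * (2 ^ T * (2 ^ s * 2 ^ (2 * s)) * 2 ^ d)"
      by (simp add: algebra_simps)
    also have "2 ^ T * (2 ^ s * 2 ^ (2 * s)) * 2 ^ d = table_bound" unfolding table_bound_def power_add[symmetric] by simp
    finally have "s * (F * R) \<le> s * (5 * 2 ^ d * (2 ^ s * nsb) + 5 * table_bound)" by (rule mult_left_mono) simp
    also have "\<dots> = 5 * 2 ^ d * (s * 2 ^ s * nsb) + 5 * (s * table_bound)" by (simp add: algebra_simps)
    also have "\<dots> \<le> 5 * 2 ^ d * (?n + s * 2 ^ s) + 5 * (s * table_bound)" using qs by (intro add_mono mult_left_mono) auto
    also have "\<dots> = 5 * 2 ^ d * ?n + 5 * (s * 2 ^ (s + d)) + 5 * (s * table_bound)" by (simp add: power_add algebra_simps)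
    also have "s * 2 ^ (s + d) \<le> s * table_bound" using sX by simp
    finally show ?thesis by simp
  qed
  have "S \<le> Zmax * F" using S_le by (simp add: F_def)
  also have "Zmax \<le> R + (num_heavy * (B * D) + nsb * (np + 1) + G div cap)"
    using len_sum by (simp add: Zmax_def Zs_def G_def)
  finally have "s * S \<le> s * ((R + (num_heavy * (B * D) + nsb * (np + 1) + G div cap)) * F)" by simp
  also have "\<dots> = s * (F * R) + s * (F * (num_heavy * (B * D))) + s * (F * (nsb * (np + 1))) + s * (F * (G div cap))"
    by (simp add: algebra_simps)
  finally have "s * S \<le> s * (?m + 2 * ?n) + (4 * (?m + ?n) + 32 * ?n + 5 * D * ?m + 5 * 2 ^ d * ?n) + 48 * (s * table_bound)"
    using p1 p2 p3 p4 by linarith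
  also have "4 * (?m + ?n) + 32 * ?n + 5 * D * ?m + 5 * 2 ^ d * ?n \<le> (36 + 5 * D + 5 * 2 ^ d) * (?m + ?n)"
    by (simp add: algebra_simps)
  finally show ?thesis by simp
qed

end

subsection \<open>Choice of parameters\<close>

text \<open>
  The case e = 2 l occurs when a single word exceeds the whole structure. The structure then occupies
  only part of the word, since the number of slots is less than 2^(2 l).
\<close>

lemma choose_slot_width:
  fixes w l :: nat
  assumes "1 \<le> l"
  shows "\<exists>e f. 2 ^ e * f \<le> w \<and> (2 * l \<le> f \<or> f = w) \<and> f \<le> 4 * l \<and>
    (w < 2 ^ e * (f + 1) \<or> e = 2 * l) \<and> e \<le> 2 * l"
proof (cases "w < 2 * l")
  case True
  then show ?thesis by (intro exI[of _ 0] exI[of _ w]) simp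
next
  case False
  show ?thesis
  proof (cases "2 ^ (2 * l) * (2 * l) \<le> w")
    case True
    then show ?thesis by (intro exI[of _ "2 * l"]) simp
  next
    case nle: False
    \<comment> \<open>The largest e for which 2^e slots of 2 l bits fit into a word; dividing the
      word evenly among them gives 2 l \<le> f < 4 l.\<close>
    define e where "e = (LEAST e. w < 2 ^ Suc e * (2 * l))"
    have "w < 2 ^ Suc (2 * l - 1) * (2 * l)" using nle assms by (simp add: not_le del: power_Suc)
    then have e: "w < 2 ^ Suc e * (2 * l)" "e \<le> 2 * l - 1" unfolding e_def by (rule LeastI, rule Least_le)
    have lo: "2 ^ e * (2 * l) \<le> w"
    proof (cases e)
      case (Suc e')
      then have "\<not> w < 2 ^ Suc e' * (2 * l)" unfolding e_def by (intro not_less_Least) simp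
      then show ?thesis using Suc by simp
    qed (use \<open>\<not> w < 2 * l\<close> in simp)
    define f where "f = w div 2 ^ e"
    have "2 ^ e * f \<le> w" by (simp add: f_def)
    moreover have "2 * l \<le> f" using lo by (simp add: f_def less_eq_div_iff_mult_less_eq mult.commute)
    moreover have "f < 4 * l" using e(1) unfolding f_def by (intro less_mult_imp_div_less) (simp add: ac_simps)
    moreover have "w < 2 ^ e * (f + 1)"
      by (simp add: f_def dividend_less_times_div)
    ultimately show ?thesis using e(2) by (intro exI[of _ e] exI[of _ f]) simp
  qed
qed

section \<open>Bit lengths, the scale s and the lower-order term\<close>

definition bit_len :: "nat \<Rightarrow> nat" where "bit_len N = (LEAST l. N < 2 ^ l)"

lemma bit_len: "N < 2 ^ bit_len N" "N < 2 ^ l \<Longrightarrow> bit_len N \<le> l" "2 ^ bit_len N \<le> 2 * (N + 1)"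
proof -
  show "N < 2 ^ bit_len N" unfolding bit_len_def by (rule LeastI[of _ N]) simp
  show "N < 2 ^ l \<Longrightarrow> bit_len N \<le> l" unfolding bit_len_def by (rule Least_le)
  show "2 ^ bit_len N \<le> 2 * (N + 1)"
  proof (cases "bit_len N")
    case (Suc l)
    then have "\<not> N < 2 ^ l" unfolding bit_len_def by (intro not_less_Least) simp
    then show ?thesis using Suc by simp
  qed simp
qed

text \<open>
  A power of 2 between lg l and 2 lg l. That it is a power of 2 makes s^2 divide 2^(3 s).
\<close>

definition log_pow2 :: "nat \<Rightarrow> nat" where "log_pow2 l = 2 ^ (LEAST v. l \<le> 2 ^ 2 ^ v)"

lemma log_pow2:
  shows "l \<le> 2 ^ log_pow2 l" "log_pow2 l * log_pow2 l dvd 2 ^ (3 * log_pow2 l)"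
    "3 \<le> l \<Longrightarrow> 2 ^ log_pow2 l \<le> l ^ 2"
proof -
  define v where "v = (LEAST v. l \<le> 2 ^ 2 ^ v)"
  have s: "log_pow2 l = 2 ^ v" by (simp add: log_pow2_def v_def)
  have "l \<le> 2 ^ 2 ^ l"
    using less_exp[of l] less_exp[of "2 ^ l"] by linarith
  then show "l \<le> 2 ^ log_pow2 l" unfolding s v_def by (rule LeastI)
  have "v + v \<le> 3 * 2 ^ v" using less_exp[of v] by linarith
  then show "log_pow2 l * log_pow2 l dvd 2 ^ (3 * log_pow2 l)"
    unfolding s power_add[symmetric] by (rule le_imp_power_dvd)
  assume l: "3 \<le> l"
  show "2 ^ log_pow2 l \<le> l ^ 2"
  proof (cases v)
    case 0
    then show ?thesis using l power_mono[OF l, of 2] s by simp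
  next
    \<comment> \<open>Minimality of v gives 2^(2^(v - 1)) < l, and squaring the left side doubles
      its exponent.\<close>
    case (Suc u)
    then have "\<not> l \<le> 2 ^ 2 ^ u" unfolding v_def by (intro not_less_Least) simp
    then have "(2 ^ 2 ^ u) ^ 2 \<le> l ^ 2" by (intro power_mono) auto
    moreover have "(2::nat) ^ log_pow2 l = (2 ^ 2 ^ u) ^ 2" unfolding s Suc by (simp add: mult.commute flip: power_mult)
    ultimately show ?thesis by simp
  qed
qed

text \<open>The polynomial is squared because s is only known to satisfy 2^s \<le> l^2.\<close>

lemma poly_le_exp: "\<exists>s0. \<forall>s\<ge>s0. (C * s ^ 4) ^ 2 \<le> (2::nat) ^ s"
proof -
  have "eventually (\<lambda>s::nat. (x * real s ^ 4) ^ 2 \<le> 2 ^ s) at_top" if "x > 0" for x :: real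
    using that by real_asymp
  then have "eventually (\<lambda>s::nat. (real C * real s ^ 4) ^ 2 \<le> 2 ^ s) at_top"
    by (cases "C = 0") auto
  then obtain s0 where "\<forall>s\<ge>s0. (real C * real s ^ 4) ^ 2 \<le> 2 ^ s" by (auto simp: eventually_at_top_linorder)
  then have "\<forall>s\<ge>s0. real ((C * s ^ 4) ^ 2) \<le> real (2 ^ s)" by simp
  then show ?thesis unfolding of_nat_le_iff by blast
qed

text \<open>The three summands stand for the losses proportional to N / s, the table, and the whole
  structure in the case of short words. None of them depends on w, since l and s are functions of N
  alone.\<close>

definition overhead :: "nat \<Rightarrow> nat \<Rightarrow> nat \<Rightarrow> nat \<Rightarrow> real" where
  "overhead A L C N = A * (N / log_pow2 (L + bit_len N)) + 48 * sqrt (2 ^ (L + 1) * (real N + 1)) + C"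

lemma overhead_smallo: "overhead A L C \<in> o(\<lambda>k. real k)"
proof -
  have "(\<lambda>N. real N / real (log_pow2 (L + bit_len N))) \<in> o(\<lambda>k. real k)"
  proof (rule landau_o.smallI)
    fix \<epsilon> :: real assume \<epsilon>: "\<epsilon> > 0"
    define b where "b = nat \<lceil>1 / \<epsilon>\<rceil>"
    have "norm (real N / real (log_pow2 (L + bit_len N))) \<le> \<epsilon> * norm (real N)" if "N \<ge> 2 ^ 2 ^ b" for N
    proof -
      let ?s = "log_pow2 (L + bit_len N)"
      have "(2::nat) ^ 2 ^ b < 2 ^ bit_len N" using bit_len(1)[of N] that by linarith
      then have "2 ^ b < L + bit_len N" by simp
      also have "\<dots> \<le> 2 ^ ?s" by (rule log_pow2(1))
      finally have "b < ?s" by simp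
      then have "1 / \<epsilon> \<le> real ?s" unfolding b_def by linarith
      then have "1 / real ?s \<le> \<epsilon>" using \<epsilon> \<open>b < ?s\<close> by (simp add: field_simps)
      then have "real N * (1 / real ?s) \<le> real N * \<epsilon>" by (rule mult_left_mono) simp
      then show ?thesis by (simp add: mult.commute)
    qed
    then show "eventually (\<lambda>N. norm (real N / real (log_pow2 (L + bit_len N))) \<le> \<epsilon> * norm (real N)) at_top"
      unfolding eventually_at_top_linorder by blast
  qed
  then have "(\<lambda>N. real A * (real N / real (log_pow2 (L + bit_len N)))) \<in> o(\<lambda>k. real k)"
  proof (cases "A = 0")
    case False
    then have "real A \<noteq> 0" by simp
    from iffD2[OF landau_o.small.cmult_in_iff[OF this]] show ?thesis
      if "(\<lambda>N. real N / real (log_pow2 (L + bit_len N))) \<in> o(\<lambda>k. real k)" using that .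
  qed simp
  moreover have "(\<lambda>N::nat. 48 * sqrt (2 ^ (L + 1) * (real N + 1))) \<in> o(\<lambda>k. real k)" by real_asymp
  moreover have "(\<lambda>N::nat. real C) \<in> o(\<lambda>k. real k)" by real_asymp
  ultimately show ?thesis unfolding overhead_def by (intro sum_in_smallo)
qed

text \<open>Turns the logarithmic bound on the word length into the fact that an index fits into a
  constant number of words.\<close>

lemma length_le_pow:
  fixes c :: real
  assumes "c > 0" "real w \<ge> c * log 2 (real n)"
  shows "n \<le> 2 ^ (nat \<lceil>1 / c\<rceil> * w)"
proof (cases "n = 0")
  case False
  have "log 2 (real n) \<le> 1 / c * real w" using assms by (simp add: field_simps)
  also have "\<dots> \<le> real (nat \<lceil>1 / c\<rceil>) * real w" by (intro mult_right_mono) linarith+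
  finally have "real n \<le> 2 powr real (nat \<lceil>1 / c\<rceil> * w)" using False by (simp add: log_le_iff)
  also have "2 powr real (nat \<lceil>1 / c\<rceil> * w) = real (2 ^ (nat \<lceil>1 / c\<rceil> * w))"
    by (simp add: powr_realpow del: of_nat_mult)
  finally have "real n \<le> real (2 ^ (nat \<lceil>1 / c\<rceil> * w))" .
  then show ?thesis by (simp only: of_nat_le_iff)
qed simp

theorem theorem11:
  fixes c :: real and a :: nat
  assumes "c > 0"
  shows "\<exists>(zero_prog :: instr list) (dec_prog :: instr list) (T :: nat) (r :: nat \<Rightarrow> real).
           r \<in> o(\<lambda>k. real k) \<and>
           (\<forall>(xs :: nat list) (n :: nat) (m :: nat) (w :: nat).
              n = length xs \<longrightarrow> m = sum_list xs \<longrightarrow>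
              w \<ge> 1 \<longrightarrow> real w \<ge> c * log 2 (real n) \<longrightarrow> m < 2 ^ (a * w) \<longrightarrow>
              (\<exists>S :: nat. real S \<le> real m + 2 * real n + r (m + n) \<and>
                 decrement_structure w zero_prog dec_prog T S xs))"
proof -
  define C1 where "C1 = nat \<lceil>1 / c\<rceil>"
  \<comment> \<open>N is below 2^((a + C1) w + 1), and l adds L to its bit length; the two further
    words absorb the L + 1 bits because w \<ge> w0 = L + 2.\<close>
  define K1 where "K1 = a + C1 + 2"
  \<comment> \<open>A counter fits into a slots if f = w, and into a single slot otherwise.\<close>
  define D where "D = a + 1"
  \<comment> \<open>A record needs 2 K1 + 3 \<le> 2^d slots, and x < 2^x.\<close>
  define d where "d = 2 * K1 + 3"
  obtain s3 where s3: "\<forall>s\<ge>s3. (32 * K1 * s ^ 4) ^ 2 \<le> (2::nat) ^ s" using poly_le_exp by blast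
  define s0 where "s0 = Max {s3, 8, d, D}"
  have s0: "s3 \<le> s0" "8 \<le> s0" "d \<le> s0" "D \<le> s0" unfolding s0_def by auto
  \<comment> \<open>As L is added to the bit length, s \<ge> s0 holds for every N, and short
    sequences need no case of their own.\<close>
  define L where "L = (2::nat) ^ s0"
  define w0 where "w0 = L + 2"
  define A where "A = 36 + 5 * D + 5 * 2 ^ d"
  define C where "C = 2 ^ (w0 * (2 * K1 + a + 1)) * w0"
  define zp where "zp = comp_result (2 * K1) (zero_exp (2 * K1) d D a w0)"
  define dp where "dp = comp_stores (2 * K1) (dec_stores (2 * K1) d D a w0)"
  define T where "T = max (length zp) (length dp)"
  have "\<exists>S :: nat. real S \<le> real (sum_list xs) + 2 * real (length xs) + overhead A L C (sum_list xs + length xs) \<and>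
      decrement_structure w zp dp T S xs"
    if w: "w \<ge> 1" and n: "real w \<ge> c * log 2 (real (length xs))" and m: "sum_list xs < 2 ^ (a * w)"
    for xs :: "nat list" and w :: nat
  proof -
    let ?N = "sum_list xs + length xs"
    have nle: "length xs \<le> 2 ^ (C1 * w)" unfolding C1_def by (rule length_le_pow[OF assms n])
    show ?thesis
    proof (cases "w < w0")
      case True
      let ?S = "2 ^ (w * (2 * K1 + a + 1)) * w"
      have "(2::nat) ^ (C1 * w) \<le> 2 ^ (w * (2 * K1))" by (intro power_increasing) (auto simp: K1_def algebra_simps)
      with nle have "length xs \<le> 2 ^ (w * (2 * K1))" by (rule le_trans)
      moreover have "1 \<le> 2 * K1" by (simp add: K1_def)
      ultimately have "decrement_structure w zp dp T ?S xs"
        unfolding zp_def dp_def using w m True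
        by (intro decrement_structure_small) (simp_all add: T_def zp_def dp_def)
      moreover have "?S \<le> C" unfolding C_def using True by (intro mult_mono power_increasing) auto
      then have "real ?S \<le> real C" by (simp only: of_nat_le_iff)
      moreover have "real C \<le> overhead A L C ?N" by (simp add: overhead_def)
      ultimately show ?thesis by (intro exI[of _ ?S] conjI) linarith+
    next
      case False
      define l where "l = L + bit_len ?N"
      define s where "s = log_pow2 l"
      have L3: "3 \<le> L" unfolding L_def using s0(2) power_increasing[of 8 s0 "2::nat"] by simp
      then have l3: "3 \<le> l" by (simp add: l_def)
      have "(2::nat) ^ s0 \<le> l" by (simp add: l_def L_def)
      also have "l \<le> 2 ^ s" unfolding s_def by (rule log_pow2(1))
      finally have s: "s0 \<le> s" by simp
      have "(32 * K1 * s ^ 4) ^ 2 \<le> l ^ 2"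
        using s3 s s0(1) log_pow2(3)[OF l3] unfolding s_def[symmetric] by (meson le_trans)
      then have l_ge: "32 * K1 * s ^ 4 \<le> l" by (simp add: power2_nat_le_eq_le)
      have "?N < 2 ^ ((a + C1) * w + 1)"
      proof -
        have "(2::nat) ^ (a * w) \<le> 2 ^ ((a + C1) * w)" "(2::nat) ^ (C1 * w) \<le> 2 ^ ((a + C1) * w)"
          by (intro power_increasing; simp)+
        then have "?N < 2 * 2 ^ ((a + C1) * w)" using m nle by linarith
        then show ?thesis by simp
      qed
      then have "bit_len ?N \<le> (a + C1) * w + 1" by (rule bit_len(2))
      then have lw: "l \<le> K1 * w" using False by (simp add: l_def K1_def w0_def algebra_simps)
      obtain e f where ef: "2 ^ e * f \<le> w" "2 * l \<le> f \<or> f = w" "f \<le> 4 * l"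
        "w < 2 ^ e * (f + 1) \<or> e = 2 * l" "e \<le> 2 * l"
        using choose_slot_width[of l w] l3 by auto
      have size: "length xs + sum_list xs < 2 ^ l"
      proof -
        have "(2::nat) ^ bit_len ?N \<le> 2 ^ l" unfolding l_def by (intro power_increasing) auto
        then show ?thesis using bit_len(1)[of ?N] by linarith
      qed
      have sum: "sum_list xs < 2 ^ (f * D)"
      proof (cases "f = w")
        case True
        have "(2::nat) ^ (a * w) \<le> 2 ^ (f * D)" unfolding True D_def by (intro power_increasing) auto
        then show ?thesis using m by linarith
      next
        case False
        then have "l \<le> f" using ef(2) by linarith
        then have "(2::nat) ^ l \<le> 2 ^ (f * D)" unfolding D_def by (intro power_increasing) (auto intro: trans_le_add2)
        then show ?thesis using size by linarith
      qed
      interpret p: layout_parameters w e f s K1 D d xs l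
      proof
        show "s * s dvd 2 ^ (3 * s)" "l \<le> 2 ^ s" unfolding s_def by (rule log_pow2)+
        show "8 \<le> s" "d \<le> s" "D \<le> s" using s s0 by linarith+
        show "2 * K1 + 3 \<le> 2 ^ d" unfolding d_def using less_exp[of "2 * K1 + 3"] by (rule less_imp_le)
        show "1 \<le> K1" by (simp add: K1_def)
      qed (fact l_ge size lw ef sum)+
      interpret v: valid_layout w e f s "2 * K1" D d xs by (rule p.valid)
      have "decrement_structure w zp dp T p.S xs"
        unfolding zp_def dp_def using False
        by (intro v.decrement_structure_large) (auto simp: T_def zp_def dp_def w0_def)
      moreover have "real p.S \<le> real (sum_list xs) + 2 * real (length xs) + overhead A L C ?N"
      proof -
        have s1: "0 < real s" using p.s_ge by simp
        have "real (s * p.S) \<le> real (s * (sum_list xs + 2 * length xs) + A * ?N + 48 * (s * p.table_bound))"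
          using p.size_bound unfolding A_def by (simp only: of_nat_le_iff)
        then have "real s * real p.S \<le> real s * (real (sum_list xs) + 2 * real (length xs) + A * (?N / s) + 48 * real p.table_bound)"
        proof -
          have "real s * (x + real A * (y / real s) + 48 * z) = real s * x + real A * y + 48 * (real s * z)" for x y z
            using s1 by (simp add: field_simps)
          then show "real (s * p.S) \<le> real (s * (sum_list xs + 2 * length xs) + A * ?N + 48 * (s * p.table_bound)) \<Longrightarrow> ?thesis"
            by simp
        qed
        then have 1: "real p.S \<le> real (sum_list xs) + 2 * real (length xs) + A * (?N / s) + 48 * real p.table_bound"
          using s1 by (simp only: mult_le_cancel_left_pos)
        have "p.table_bound ^ 2 \<le> 2 ^ L * 2 ^ bit_len ?N" using p.table_bound_sq by (simp add: l_def power_add)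
        also have "\<dots> \<le> 2 ^ L * (2 * (?N + 1))" by (intro mult_left_mono bit_len) simp
        also have "\<dots> = 2 ^ (L + 1) * (?N + 1)" by simp
        finally have "real (p.table_bound ^ 2) \<le> real (2 ^ (L + 1) * (?N + 1))" by (simp only: of_nat_le_iff)
        then have "(real p.table_bound)\<^sup>2 \<le> 2 ^ (L + 1) * (real ?N + 1)" by (simp add: distrib_left)
        then have "real p.table_bound \<le> sqrt (2 ^ (L + 1) * (real ?N + 1))" by (rule real_le_rsqrt)
        then show ?thesis using 1 unfolding overhead_def s_def l_def by linarith
      qed
      ultimately show ?thesis by blast
    qed
  qed
  then show ?thesis using overhead_smallo[of A L C] by blast
qed

end
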